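(* Let $G$ be sampled from either the sparse Erdős–Rényi distribution $\mathrm{ER}(n,K/n)$ ($K>0$ fixed) or the Barabási–Albert distribution $\mathrm{BA}(n,m)$ ($m\ge1$ fixed). Let $(T,\bar w)$ be a $k$-rooted graph and $\ell\in\mathbb{N}$. Then for every $(k+1)$-rooted graph $(T',\bar w,y)$ extending $(T,\bar w)$ there is $q_{T'\mid T}\in[0,1]$ such that for all $\epsilon,\theta>0$ there is $N$ such that for all $n\ge N$, with probability at least $1-\theta$, for all $k$-tuples of nodes $\bar u$ with $N^G_\ell(\bar u)\cong(T,\bar w)$, $$\left|\frac{|\{v: N^G_\ell(\bar u,v)\cong(T',\bar w,y)\}|}{n}-q_{T'\mid T}\right|<\epsilon.$$ Moreover $\sum_{T'\in\mathrm{Ext}(T)}q_{T'\mid T}=1$.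
   Context: A $k$-rooted graph $(T,\bar w)$ is a finite graph with a distinguished tuple $\bar w$ of $k$ nodes; isomorphisms of rooted graphs must map roots to roots in order. For a graph $G$ and tuple $\bar u$, $N^G_\ell(\bar u)$ is the $k$-rooted graph, rooted at $\bar u$, given by the induced subgraph on the nodes at distance at most $\ell$ from some $u_i$. A $(k+1)$-rooted graph $(T',\bar w,y)$ extends $(T,\bar w)$ if $T$ is a subgraph of $T'$ (with the same first $k$ roots); $\mathrm{Ext}(T)$ is the set of isomorphism classes of such extensions. $\mathrm{BA}(n,m)$ is the Barabási–Albert preferential attachment model in which each new node attaches $m$ edges. *)

theory Defs
  imports "HOL-Probability.Probability"
begin

record rgraph =
  rV :: "nat set"
  rE :: "nat set set"
  rroots :: "nat list"

definition wf_rgraph :: "rgraph \<Rightarrow> bool" where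
  "wf_rgraph A \<longleftrightarrow> finite (rV A) \<and> (\<forall>e\<in>rE A. e \<subseteq> rV A \<and> card e = 2)
     \<and> set (rroots A) \<subseteq> rV A"

definition riso :: "rgraph \<Rightarrow> rgraph \<Rightarrow> bool" where
  "riso A B \<longleftrightarrow> (\<exists>f. bij_betw f (rV A) (rV B)
     \<and> (\<forall>x\<in>rV A. \<forall>y\<in>rV A. {x, y} \<in> rE A \<longleftrightarrow> {f x, f y} \<in> rE B)
     \<and> map f (rroots A) = rroots B)"

definition extends :: "rgraph \<Rightarrow> rgraph \<Rightarrow> bool" where
  "extends T' T \<longleftrightarrow> wf_rgraph T' \<and> rV T \<subseteq> rV T' \<and> rE T \<subseteq> rE T'
     \<and> (\<exists>y. rroots T' = rroots T @ [y])"

definition iso_class :: "rgraph \<Rightarrow> rgraph set" where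
  "iso_class A = {S. wf_rgraph S \<and> riso S A}"

definition Ext :: "rgraph \<Rightarrow> rgraph set set" where
  "Ext T = iso_class ` {T'. extends T' T}"

fun ball :: "nat set set \<Rightarrow> nat \<Rightarrow> nat \<Rightarrow> nat set" where
  "ball E 0 u = {u}"
| "ball E (Suc l) u = ball E l u \<union> {y. \<exists>x\<in>ball E l u. {x, y} \<in> E}"

definition nbhd :: "nat set set \<Rightarrow> nat \<Rightarrow> nat list \<Rightarrow> rgraph" where
  "nbhd E l us = (let V = (\<Union>u\<in>set us. ball E l u) in
     \<lparr>rV = V, rE = {e \<in> E. e \<subseteq> V}, rroots = us\<rparr>)"

definition er :: "nat \<Rightarrow> real \<Rightarrow> nat set set pmf" where
  "er n p = map_pmf (\<lambda>f. {{i, j} | i j. i < j \<and> j < n \<and> f (i, j)})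
     (Pi_pmf {(i, j). i < j \<and> j < n} False (\<lambda>_. bernoulli_pmf p))"

definition endpoints :: "(nat \<times> nat) list \<Rightarrow> nat multiset" where
  "endpoints es = mset (concat (map (\<lambda>(a, b). [a, b]) es))"

text \<open>Bollobas-Riordan process G_1^t on nodes 0..<t: new node t attaches one edge to
  node i<t with probability deg(i)/(2t+1), or to itself with probability 1/(2t+1).\<close>
fun ba1 :: "nat \<Rightarrow> (nat \<times> nat) list pmf" where
  "ba1 0 = return_pmf []"
| "ba1 (Suc t) = bind_pmf (ba1 t) (\<lambda>es.
      map_pmf (\<lambda>x. es @ [(t, x)]) (pmf_of_multiset (add_mset t (endpoints es))))"

text \<open>BA(n,m): run G_1^{nm}, merge nodes m*i..m*i+m-1 into node i, and take the
  underlying simple graph (drop loops and multiple edges).\<close>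
definition ba :: "nat \<Rightarrow> nat \<Rightarrow> nat set set pmf" where
  "ba n m = map_pmf (\<lambda>es. {{a div m, b div m} | a b. (a, b) \<in> set es \<and> a div m \<noteq> b div m})
     (ba1 (n * m))"

end

theory Submission
  imports Defs
begin

text \<open>If every \<open>u\<close> in the tuple is at distance more than \<open>2 l + 1\<close> from \<open>v\<close>, the joint neighbourhood is the disjoint
  union of \<open>T\<close> and the neighbourhood of \<open>v\<close>.  Since \<open>\<Sum>\<^sub>v deg(v)\<^bsup>3/2\<^esup>\<close> is linear in expectation, small vertex sets have
  small balls around them with high probability, so this is the case for almost all \<open>v\<close>, uniformly in the
  tuple.  It remains to see that the frequencies of the rooted neighbourhoods converge to a probability
  distribution \<open>P\<close>; then \<open>q\<close> is the image of \<open>P\<close> under disjoint union with \<open>T\<close>.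

  For Erdos-Renyi graphs this is a first and second moment computation over the possible vertex sets of
  the neighbourhood.  For preferential attachment, count the vertex sets \<open>W\<close> on which the targets inside
  \<open>W\<close> and all indegrees are prescribed.  Conditionally on the past, the expected increment of such a count
  is \<open>- (a / n)\<close> times the count plus counts of smaller patterns, so by stochastic approximation and
  induction it converges in \<open>L\<^sup>1\<close> after division by \<open>n\<^sup>c\<close>, where \<open>c\<close> is the number of components of the pattern.\<close>

section \<open>Graphs and neighbourhoods\<close>

text \<open>The exponent 3/2 exceeds 1, so it makes the degrees uniformly integrable, and it is
  below 2, so it grows linearly under attachment: edge number \<open>t\<close> inflates the moment
  by a factor of about 1 + (3/4) / \<open>t\<close>, and a coefficient below 1 is absorbed by linear
  growth. For exponent 2 the coefficient would be 1 and a logarithm would appear. Neighbourhoods are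
  connected, yet patterns with several components are unavoidable: removing the newest block may
  disconnect a pattern. The induction closes because joining \<open>k\<close> components needs at
  least \<open>k\<close> hits, of probability of order \<open>1 / n ^ k\<close>. Recorded indegrees
  make attachment probabilities a function of the pattern, and they leave boundedly many positions
  for a component once one of its vertices is fixed. Types remember the order of the vertices, so a
  vertex set has exactly one type and no automorphisms are counted. In the attachment model
  infinitely many types may lead to one extension class, so convergence is needed for infinite sets
  of types; this and the total mass 1 rest on tightness.\<close>

definition sgraph :: "nat \<Rightarrow> nat set set \<Rightarrow> bool" where
  "sgraph n E \<longleftrightarrow> (\<forall>e\<in>E. e \<subseteq> {0..<n} \<and> card e = 2)"

definition dg :: "nat set set \<Rightarrow> nat \<Rightarrow> nat" where
  "dg E v = card {y. {v, y} \<in> E}"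

definition balls :: "nat set set \<Rightarrow> nat \<Rightarrow> nat set \<Rightarrow> nat set" where
  "balls E l S = (\<Union>u\<in>S. ball E l u)"

lemma ball_self [simp]: "u \<in> ball E l u"
  by (induction l) auto

lemma ball_mono: "k \<le> l \<Longrightarrow> ball E k u \<subseteq> ball E l u"
  by (induction l) (auto simp: le_Suc_eq)

lemma ball_trans: "y \<in> ball E a x \<Longrightarrow> z \<in> ball E b y \<Longrightarrow> z \<in> ball E (a + b) x"
proof (induction b arbitrary: z)
  case (Suc b)
  then show ?case by auto
qed auto

lemma ball_step: "y \<in> ball E l x \<Longrightarrow> {y, z} \<in> E \<Longrightarrow> z \<in> ball E (Suc l) x"
  by auto

lemma ball_sym: "v \<in> ball E l u \<Longrightarrow> u \<in> ball E l v"
proof (induction l arbitrary: v)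
  case (Suc l)
  then consider "v \<in> ball E l u" | x where "x \<in> ball E l u" "{x, v} \<in> E" by auto
  then show ?case
  proof cases
    case 1
    then show ?thesis using Suc.IH by auto
  next
    case 2
    have "x \<in> ball E 1 v" using 2 by (auto simp: insert_commute)
    from ball_trans[OF this Suc.IH[OF 2(1)]] show ?thesis by simp
  qed
qed auto

lemma sgraph_edge: "sgraph n E \<Longrightarrow> {x, y} \<in> E \<Longrightarrow> x < n \<and> y < n \<and> x \<noteq> y"
  unfolding sgraph_def by (force simp: card_insert_if)

lemma ball_subset: "sgraph n E \<Longrightarrow> u < n \<Longrightarrow> ball E l u \<subseteq> {0..<n}"
  by (induction l) (auto dest: sgraph_edge)

lemma finite_ball: "sgraph n E \<Longrightarrow> u < n \<Longrightarrow> finite (ball E l u)"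
  by (rule finite_subset[OF ball_subset]) auto

lemma balls_Suc: "balls E (Suc l) S = balls E 1 (balls E l S)"
  by (auto simp: balls_def)

lemma balls_subset: "sgraph n E \<Longrightarrow> S \<subseteq> {0..<n} \<Longrightarrow> balls E l S \<subseteq> {0..<n}"
  using ball_subset unfolding balls_def by fastforce

lemma balls_superset: "S \<subseteq> balls E l S"
  unfolding balls_def using ball_self by blast

lemma nbhd_simps: "rV (nbhd E l us) = balls E l (set us)"
  "rE (nbhd E l us) = {e \<in> E. e \<subseteq> balls E l (set us)}"
  "rroots (nbhd E l us) = us"
  by (simp_all add: nbhd_def balls_def Let_def)

lemma wf_nbhd:
  assumes "sgraph n E" "set us \<subseteq> {0..<n}"
  shows "wf_rgraph (nbhd E l us)"
proof -
  have "finite (balls E l (set us))" using balls_subset[OF assms, of l] finite_subset by blast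
  moreover have "set us \<subseteq> balls E l (set us)" by (rule balls_superset)
  ultimately show ?thesis using assms(1) unfolding wf_rgraph_def nbhd_simps sgraph_def by simp
qed

text \<open>Degrees are unbounded in both models. The degree mass above a large threshold, which is
  small compared with \<open>n\<close>, stands in for a maximum degree.\<close>

definition dtail :: "nat \<Rightarrow> nat set set \<Rightarrow> nat \<Rightarrow> nat" where
  "dtail n E K = (\<Sum>v | v < n \<and> dg E v > K. dg E v)"

text \<open>A vertex of degree at most \<open>K\<close> brings at most \<open>K + 1\<close> vertices
  including itself. The whole degree of any other vertex is charged to \<open>dtail\<close>, which
  does not depend on \<open>S\<close>; hence one event serves all sets \<open>S\<close> at
  once.\<close>

lemma card_balls_1:
  assumes sg: "sgraph n E" and S: "S \<subseteq> {0..<n}"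
  shows "card (balls E 1 S) \<le> (K + 1) * card S + dtail n E K"
proof -
  have fS: "finite S" using S finite_subset by blast
  have fy: "finite {y. {u, y} \<in> E}" for u
    by (rule finite_subset[of _ "{0..<n}"]) (auto dest: sgraph_edge[OF sg])
  have b: "card (ball E 1 u) \<le> 1 + dg E u" for u
  proof -
    have "ball E 1 u = insert u {y. {u, y} \<in> E}" by auto
    then show ?thesis using fy[of u] by (simp add: dg_def card_insert_if)
  qed
  have "card (balls E 1 S) \<le> (\<Sum>u\<in>S. card (ball E 1 u))"
    unfolding balls_def using fS by (rule card_UN_le)
  also have "\<dots> \<le> (\<Sum>u\<in>S. (K + 1) + (if dg E u > K then dg E u else 0))"
  proof (rule sum_mono)
    fix u
    show "card (ball E 1 u) \<le> (K + 1) + (if dg E u > K then dg E u else 0)" using b[of u] by auto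
  qed
  also have "\<dots> = (K + 1) * card S + (\<Sum>u\<in>S. if dg E u > K then dg E u else 0)"
    by (simp only: sum.distrib) simp
  also have "(\<Sum>u\<in>S. if dg E u > K then dg E u else 0) = (\<Sum>u\<in>{u\<in>S. dg E u > K}. dg E u)"
    using fS by (simp add: sum.inter_filter)
  also have "\<dots> \<le> dtail n E K"
    unfolding dtail_def by (rule sum_mono2) (use S in auto)
  finally show ?thesis by simp
qed

text \<open>Edges of \<open>F\<close> are edges of \<open>E\<close> between listed vertices, so
  paths carry over from indices to vertices. The converse inclusion may fail because a path in
  \<open>E\<close> can leave \<open>xs\<close>; excluding that is the role of the second condition
  in \<open>ball_transfer\<close>.\<close>

lemma ball_transfer_aux:
  assumes iso: "\<And>i j. i < length xs \<Longrightarrow> j < length xs \<Longrightarrow> {xs ! i, xs ! j} \<in> E \<longleftrightarrow> {i, j} \<in> F"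
    and F: "\<And>i j. {i, j} \<in> F \<Longrightarrow> i < length xs \<and> j < length xs"
    and r: "r < length xs"
  shows "ball F l r \<subseteq> {0..<length xs}" "(!) xs ` ball F l r \<subseteq> ball E l (xs ! r)"
proof (induction l)
  case 0
  { case 1 then show ?case using r by simp }
  { case 2 then show ?case by simp }
next
  case (Suc l)
  { case 1 then show ?case using Suc F by auto }
  { case 2
    show ?case
    proof
      fix y assume "y \<in> (!) xs ` ball F (Suc l) r"
      then obtain j where j: "y = xs ! j" "j \<in> ball F (Suc l) r" by auto
      then consider "j \<in> ball F l r" | i where "i \<in> ball F l r" "{i, j} \<in> F" by auto
      then show "y \<in> ball E (Suc l) (xs ! r)"
      proof cases
        case 1 then show ?thesis using Suc j by auto
      next
        case 2
        then have "{xs ! i, xs ! j} \<in> E" using F iso by blast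
        then show ?thesis using 2 Suc(2) j by auto
      qed
    qed }
qed

text \<open>Whether a vertex list is exactly the \<open>l\<close>-ball of one of its members depends only on the
  graph it induces and on which of its vertices have no neighbour outside.\<close>
lemma ball_transfer:
  assumes iso: "\<And>i j. i < length xs \<Longrightarrow> j < length xs \<Longrightarrow> {xs ! i, xs ! j} \<in> E \<longleftrightarrow> {i, j} \<in> F"
    and F: "\<And>i j. {i, j} \<in> F \<Longrightarrow> i < length xs \<and> j < length xs"
    and r: "r < length xs" and d: "distinct xs"
  shows "ball E l (xs ! r) = set xs \<longleftrightarrow> ball F l r = {0..<length xs}
      \<and> (\<forall>j<l. \<forall>i\<in>ball F j r. \<forall>y. {xs ! i, y} \<in> E \<longrightarrow> y \<in> set xs)" (is "?A \<longleftrightarrow> ?B \<and> ?C")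
proof -
  \<comment> \<open>Only vertices at distance below \<open>l\<close> are expanded, and
    \<open>?C\<close> keeps each of these steps inside \<open>xs\<close>; so the balls correspond
    exactly up to radius \<open>l\<close>.\<close>
  have key: "ball E j (xs ! r) = (!) xs ` ball F j r" if C: ?C and "j \<le> l" for j
    using that(2)
  proof (induction j)
    case (Suc j)
    have "ball E (Suc j) (xs ! r) \<subseteq> (!) xs ` ball F (Suc j) r"
    proof
      fix y assume "y \<in> ball E (Suc j) (xs ! r)"
      then consider "y \<in> ball E j (xs ! r)" | x where "x \<in> ball E j (xs ! r)" "{x, y} \<in> E" by auto
      then show "y \<in> (!) xs ` ball F (Suc j) r"
      proof cases
        case 1 then show ?thesis using Suc by auto
      next
        case 2
        then obtain i where i: "i \<in> ball F j r" "x = xs ! i" using Suc by auto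
        have "j < l" using Suc.prems by simp
        then have "y \<in> set xs" using C i 2(2) by blast
        then obtain k where k: "k < length xs" "y = xs ! k" by (auto simp: in_set_conv_nth)
        have "i < length xs" using ball_transfer_aux(1)[of xs E F, OF iso F r] i by fastforce
        then have "{i, k} \<in> F" using iso[of i k] k i 2 by simp
        then show ?thesis using i k by auto
      qed
    qed
    then show ?case using ball_transfer_aux(2)[of xs E F, OF iso F r, where l = "Suc j"] by blast
  qed auto
  have inj: "inj_on ((!) xs) {0..<length xs}" using d by (simp add: inj_on_nth)
  have setxs: "set xs = (!) xs ` {0..<length xs}" by (auto simp: set_conv_nth)
  show ?thesis
  proof
    assume A: ?A
    have C: ?C
    proof (intro allI impI ballI)
      fix j i y assume j: "j < l" "i \<in> ball F j r" "{xs ! i, y} \<in> E"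
      then have "xs ! i \<in> ball E j (xs ! r)"
        using ball_transfer_aux(2)[of xs E F, OF iso F r, where l = j] by blast
      then have "y \<in> ball E (Suc j) (xs ! r)" using j by auto
      moreover have "ball E (Suc j) (xs ! r) \<subseteq> ball E l (xs ! r)" using j by (intro ball_mono) simp
      ultimately show "y \<in> set xs" using A by blast
    qed
    have "(!) xs ` ball F l r = (!) xs ` {0..<length xs}" using key[OF C, of l] A setxs by simp
    then have ?B using inj ball_transfer_aux(1)[of xs E F, OF iso F r, where l = l]
      by (metis inj_on_image_eq_iff order_refl)
    then show "?B \<and> ?C" using C by blast
  next
    assume "?B \<and> ?C"
    then show ?A using key[of l] setxs by simp
  qed
qed

subsection \<open>Isomorphisms and disjoint unions\<close>

lemma wf_rgraph_edge: "wf_rgraph A \<Longrightarrow> {x, y} \<in> rE A \<Longrightarrow> x \<in> rV A \<and> y \<in> rV A"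
  unfolding wf_rgraph_def by fastforce

lemma riso_refl: "riso A A"
  unfolding riso_def by (rule exI[of _ id]) auto

lemma riso_sym:
  assumes "wf_rgraph A" "wf_rgraph B" "riso A B" shows "riso B A"
proof -
  obtain f where f: "bij_betw f (rV A) (rV B)"
    "\<forall>x\<in>rV A. \<forall>y\<in>rV A. {x, y} \<in> rE A \<longleftrightarrow> {f x, f y} \<in> rE B" "map f (rroots A) = rroots B"
    using assms unfolding riso_def by auto
  define g where "g = inv_into (rV A) f"
  have g: "bij_betw g (rV B) (rV A)" using f(1) g_def bij_betw_inv_into by blast
  have fg: "f (g y) = y" if "y \<in> rV B" for y
    using f(1) that g_def by (simp add: bij_betw_inv_into_right)
  have gf: "g (f y) = y" if "y \<in> rV A" for y
    using f(1) that g_def by (simp add: bij_betw_inv_into_left)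
  have gV: "g y \<in> rV A" if "y \<in> rV B" for y using g that bij_betwE by blast
  have "map g (rroots B) = rroots A"
    unfolding f(3)[symmetric] using assms(1) gf by (auto simp: wf_rgraph_def intro!: map_idI)
  moreover have "{x, y} \<in> rE B \<longleftrightarrow> {g x, g y} \<in> rE A" if "x \<in> rV B" "y \<in> rV B" for x y
    using f(2) gV fg that by simp
  ultimately show ?thesis using g unfolding riso_def by blast
qed

lemma riso_trans:
  assumes "riso A B" "riso B C" shows "riso A C"
proof -
  obtain f where f: "bij_betw f (rV A) (rV B)"
    "\<forall>x\<in>rV A. \<forall>y\<in>rV A. {x, y} \<in> rE A \<longleftrightarrow> {f x, f y} \<in> rE B" "map f (rroots A) = rroots B"
    using assms unfolding riso_def by auto
  obtain g where g: "bij_betw g (rV B) (rV C)"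
    "\<forall>x\<in>rV B. \<forall>y\<in>rV B. {x, y} \<in> rE B \<longleftrightarrow> {g x, g y} \<in> rE C" "map g (rroots B) = rroots C"
    using assms unfolding riso_def by auto
  have fV: "f y \<in> rV B" if "y \<in> rV A" for y using f(1) that bij_betwE by blast
  have "bij_betw (g \<circ> f) (rV A) (rV C)" using f g bij_betw_trans by blast
  moreover have "\<forall>x\<in>rV A. \<forall>y\<in>rV A. {x, y} \<in> rE A \<longleftrightarrow> {(g \<circ> f) x, (g \<circ> f) y} \<in> rE C"
    using f(2) g(2) fV by simp
  moreover have "map (g \<circ> f) (rroots A) = rroots C"
    using f(3) g(3) by (metis map_map)
  ultimately show ?thesis unfolding riso_def by blast
qed

lemma iso_class_eq:
  assumes "wf_rgraph A" "wf_rgraph B" "riso A B"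
  shows "iso_class A = iso_class B"
  using assms riso_trans riso_sym unfolding iso_class_def by blast

lemma iso_class_self: "wf_rgraph A \<Longrightarrow> A \<in> iso_class A"
  by (simp add: iso_class_def riso_refl)

lemma mem_iso_class: "wf_rgraph A \<Longrightarrow> wf_rgraph B \<Longrightarrow> A \<in> iso_class B \<longleftrightarrow> iso_class A = iso_class B"
  using iso_class_eq iso_class_self unfolding iso_class_def by blast

text \<open>A shift beyond every vertex of \<open>T\<close> makes the two copies disjoint;
  \<open>insert 0\<close> gives \<open>Max\<close> a nonempty set when \<open>T\<close> has no
  vertices.\<close>

definition join_shift :: "rgraph \<Rightarrow> nat" where
  "join_shift T = Suc (Max (insert 0 (rV T)))"

text \<open>\<open>T\<close> stays in place and only \<open>G\<close> is moved, so the result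
  extends \<open>T\<close> literally, as \<open>extends\<close> demands, and not merely up to
  isomorphism.\<close>

definition djoin :: "rgraph \<Rightarrow> rgraph \<Rightarrow> rgraph" where
  "djoin T G = \<lparr>rV = rV T \<union> (+) (join_shift T) ` rV G,
     rE = rE T \<union> (`) ((+) (join_shift T)) ` rE G,
     rroots = rroots T @ map ((+) (join_shift T)) (rroots G)\<rparr>"

lemma join_shift_gt: "wf_rgraph T \<Longrightarrow> x \<in> rV T \<Longrightarrow> x < join_shift T"
  unfolding join_shift_def wf_rgraph_def by (simp add: less_Suc_eq_le)

lemma wf_djoin:
  assumes "wf_rgraph T" "wf_rgraph G" shows "wf_rgraph (djoin T G)"
proof -
  have c: "card ((+) (join_shift T) ` e) = card e" for e
    by (rule card_image) (auto simp: inj_on_def)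
  have "(+) (join_shift T) ` e \<subseteq> (+) (join_shift T) ` rV G" if "e \<in> rE G" for e
    using assms(2) that unfolding wf_rgraph_def by blast
  moreover have "e \<subseteq> rV T \<union> X" if "e \<in> rE T" for e X
    using assms(1) that unfolding wf_rgraph_def by blast
  ultimately show ?thesis using assms unfolding wf_rgraph_def djoin_def by (simp add: c ball_Un) blast
qed

lemma extends_djoin:
  assumes "wf_rgraph T" "wf_rgraph G" "length (rroots G) = 1"
  shows "extends (djoin T G) T"
proof -
  obtain r where "rroots G = [r]" using assms(3) by (auto simp: length_Suc_conv)
  then show ?thesis using wf_djoin[OF assms(1,2)] unfolding extends_def by (auto simp: djoin_def)
qed

text \<open>The two isomorphisms are glued along the partition of the vertices. A pair with one end
  in each part is an edge on neither side, by well-formedness and by the separation through the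
  shift. The edges of \<open>U\<close> are compared on pairs of its vertices only, which is all that
  \<open>riso\<close> sees.\<close>

lemma riso_djoin:
  assumes wf: "wf_rgraph T" "wf_rgraph G" "wf_rgraph A" "wf_rgraph B"
    and A: "riso A T" and B: "riso B G" and disj: "rV A \<inter> rV B = {}"
    and U: "rV U = rV A \<union> rV B" "rroots U = rroots A @ rroots B"
      "\<And>x y. x \<in> rV U \<Longrightarrow> y \<in> rV U \<Longrightarrow> {x, y} \<in> rE U \<longleftrightarrow>  {x, y} \<in> rE A \<union> rE B"
  shows "riso U (djoin T G)"
proof -
  let ?s = "(+) (join_shift T)"
  obtain f where f: "bij_betw f (rV A) (rV T)"
    "\<forall>x\<in>rV A. \<forall>y\<in>rV A. {x, y} \<in> rE A \<longleftrightarrow> {f x, f y} \<in> rE T" "map f (rroots A) = rroots T"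
    using A unfolding riso_def by auto
  obtain g where g: "bij_betw g (rV B) (rV G)"
    "\<forall>x\<in>rV B. \<forall>y\<in>rV B. {x, y} \<in> rE B \<longleftrightarrow> {g x, g y} \<in> rE G" "map g (rroots B) = rroots G"
    using B unfolding riso_def by auto
  define h where "h x = (if x \<in> rV A then f x else ?s (g x))" for x
  have hA: "h x = f x" if "x \<in> rV A" for x using that h_def by simp
  have hB: "h x = ?s (g x)" if "x \<in> rV B" for x using that disj h_def by auto
  have fV: "f x \<in> rV T" if "x \<in> rV A" for x using that f(1) bij_betwE by blast
  have gV: "g x \<in> rV G" if "x \<in> rV B" for x using that g(1) bij_betwE by blast
  have lt: "f x < join_shift T" if "x \<in> rV A" for x using fV that join_shift_gt wf by blast
  have rET: "{a, b} \<in> rE T \<Longrightarrow> a < join_shift T \<and> b < join_shift T" for a b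
    using wf_rgraph_edge[OF wf(1)] join_shift_gt[OF wf(1)] by blast
  have eT: "{a, b} \<in> rE (djoin T G) \<longleftrightarrow> {a, b} \<in> rE T"
    if "a < join_shift T" for a b
  proof -
    have "a \<notin> ?s ` e" for e using that by auto
    then have "{a, b} \<notin> (`) ?s ` rE G" by (metis (no_types, lifting) imageE insertI1)
    then show ?thesis by (simp add: djoin_def)
  qed
  have eG: "{?s a, ?s b} \<in> rE (djoin T G) \<longleftrightarrow> {a, b} \<in> rE G" for a b
  proof -
    have "{?s a, ?s b} \<notin> rE T" using rET by fastforce
    moreover have "{?s a, ?s b} \<in> (`) ?s ` rE G \<longleftrightarrow> {a, b} \<in> rE G"
    proof -
      have "inj ?s" by simp
      then have "inj ((`) ?s)" by (simp add: inj_def inj_image_eq_iff)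
      moreover have "{?s a, ?s b} = ?s ` {a, b}" by simp
      ultimately show ?thesis by (metis inj_image_mem_iff)
    qed
    ultimately show ?thesis by (simp add: djoin_def)
  qed
  have cross: "{x, y} \<notin> rE A \<union> rE B" if "x \<in> rV A" "y \<in> rV B" for x y
    using that disj wf_rgraph_edge[OF wf(3), of x y] wf_rgraph_edge[OF wf(4), of x y] by auto
  have crossJ: "{h x, h y} \<notin> rE (djoin T G)" if "x \<in> rV A" "y \<in> rV B" for x y
  proof -
    have "h x < join_shift T" "\<not> h y < join_shift T" using hA hB lt that by auto
    then show ?thesis using eT rET by blast
  qed
  have b1: "bij_betw h (rV A) (rV T)" using f(1) bij_betw_cong[of "rV A" h f] hA by simp
  have "bij_betw ?s (rV G) (?s ` rV G)" by (simp add: bij_betw_def)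
  from bij_betw_trans[OF g(1) this] have b2: "bij_betw h (rV B) (?s ` rV G)"
    using bij_betw_cong[of "rV B" h "?s \<circ> g"] hB by simp
  have bij: "bij_betw h (rV U) (rV (djoin T G))"
    unfolding U djoin_def using bij_betw_combine[OF b1 b2] join_shift_gt[OF wf(1)] by fastforce
  have edges: "{x, y} \<in> rE U \<longleftrightarrow> {h x, h y} \<in> rE (djoin T G)" if xyU: "x \<in> rV U" "y \<in> rV U" for x y
  proof -
    consider "x \<in> rV A" "y \<in> rV A" | "x \<in> rV B" "y \<in> rV B"
      | "x \<in> rV A" "y \<in> rV B" | "x \<in> rV B" "y \<in> rV A" using xyU U(1) by auto
    then show ?thesis
    proof cases
      case 1
      then have "{x, y} \<notin> rE B" using disj wf_rgraph_edge[OF wf(4), of x y] by auto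
      then show ?thesis using U(3)[OF xyU] f(2) 1 by (simp add: hA eT lt)
    next
      case 2
      then have "{x, y} \<notin> rE A" using disj wf_rgraph_edge[OF wf(3), of x y] by auto
      then show ?thesis using U(3)[OF xyU] g(2) 2 eG[of "g x" "g y"] by (simp add: hB)
    next
      case 3 then show ?thesis using U(3)[OF xyU] cross crossJ by blast
    next
      case 4 then show ?thesis using U(3)[OF xyU] cross[of y x] crossJ[of y x] by (simp only: insert_commute)
    qed
  qed
  have "map h (rroots A) = map f (rroots A)" using wf(3) hA unfolding wf_rgraph_def by auto
  moreover have "map h (rroots B) = map (?s \<circ> g) (rroots B)"
    using wf(4) hB unfolding wf_rgraph_def by auto
  ultimately have "map h (rroots U) = rroots (djoin T G)"
    unfolding U djoin_def using f(3) g(3) by (metis map_append map_map rgraph.select_convs(3))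
  then show ?thesis using bij edges unfolding riso_def by blast
qed

text \<open>If the two neighbourhoods met, \<open>v\<close> would be within \<open>2 * l\<close> of
  the tuple, and an edge between them would bring it within \<open>2 * l + 1\<close>; this is the
  origin of the radius in \<open>far\<close>.\<close>

lemma riso_nbhd_djoin:
  assumes sg: "sgraph n E" and us: "set us \<subseteq> {0..<n}" and v: "v < n"
    and far: "v \<notin> balls E (2 * l + 1) (set us)"
    and wf: "wf_rgraph T" "wf_rgraph G"
    and T: "riso (nbhd E l us) T" and G: "riso (nbhd E l [v]) G"
  shows "riso (nbhd E l (us @ [v])) (djoin T G)"
proof (rule riso_djoin[OF wf _ _ T G])
  have sep: "x \<noteq> y \<and> {x, y} \<notin> E" if xy: "x \<in> balls E l (set us)" "y \<in> balls E l {v}" for x y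
  proof -
    obtain u where u: "u \<in> set us" "x \<in> ball E l u" using xy unfolding balls_def by auto
    have y: "v \<in> ball E l y" using xy ball_sym unfolding balls_def by auto
    have nv: "v \<notin> ball E (2 * l + 1) u" using far u unfolding balls_def by auto
    have "v \<in> ball E (l + l) u" if "x = y" using ball_trans[OF u(2)] y that by blast
    moreover have "v \<in> ball E (Suc l + l) u" if "{x, y} \<in> E"
      using ball_trans[OF ball_step[OF u(2) that] y] .
    ultimately show ?thesis using nv ball_mono[of "l + l" "2 * l + 1" E u] by (auto simp: mult_2)
  qed
  then show "rV (nbhd E l us) \<inter> rV (nbhd E l [v]) = {}" by (auto simp: nbhd_simps)
  show "wf_rgraph (nbhd E l us)" "wf_rgraph (nbhd E l [v])" using wf_nbhd[OF sg] us v by auto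
  show V: "rV (nbhd E l (us @ [v])) = rV (nbhd E l us) \<union> rV (nbhd E l [v])"
    by (auto simp: nbhd_simps balls_def)
  show "rroots (nbhd E l (us @ [v])) = rroots (nbhd E l us) @ rroots (nbhd E l [v])"
    by (simp add: nbhd_simps)
  fix x y assume xy: "x \<in> rV (nbhd E l (us @ [v]))" "y \<in> rV (nbhd E l (us @ [v]))"
  then show "{x, y} \<in> rE (nbhd E l (us @ [v])) \<longleftrightarrow> {x, y} \<in> rE (nbhd E l us) \<union> rE (nbhd E l [v])"
    using sep[of x y] sep[of y x] V xy unfolding nbhd_simps by (auto simp: insert_commute)
qed

section \<open>Convergence of type frequencies\<close>

abbreviation pE :: "'s pmf \<Rightarrow> ('s \<Rightarrow> real) \<Rightarrow> real" where
  "pE M f \<equiv> measure_pmf.expectation M f"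

lemma pE_mono:
  assumes "finite (set_pmf M)" "\<And>s. s \<in> set_pmf M \<Longrightarrow> f s \<le> g s" shows "pE M f \<le> pE M g"
  by (rule integral_mono_AE) (use assms in \<open>auto simp: integrable_measure_pmf_finite AE_measure_pmf_iff\<close>)

lemma pE_cong: "(\<And>s. s \<in> set_pmf M \<Longrightarrow> f s = g s) \<Longrightarrow> pE M f = pE M g"
  by (rule integral_cong_AE) (auto simp: AE_measure_pmf_iff)

lemma pE_nonneg: "(\<And>s. s \<in> set_pmf M \<Longrightarrow> 0 \<le> f s) \<Longrightarrow> 0 \<le> pE M f"
  by (rule integral_nonneg_AE) (auto simp: AE_measure_pmf_iff)

lemma pE_le_const: "finite (set_pmf M) \<Longrightarrow> (\<And>s. s \<in> set_pmf M \<Longrightarrow> f s \<le> c) \<Longrightarrow> pE M f \<le> c"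
  using pE_mono[of M f "\<lambda>_. c"] by simp

lemma pE_add: "finite (set_pmf M) \<Longrightarrow> pE M (\<lambda>s. f s + g s) = pE M f + pE M g"
  by (intro Bochner_Integration.integral_add integrable_measure_pmf_finite)

lemma pE_diff: "finite (set_pmf M) \<Longrightarrow> pE M (\<lambda>s. f s - g s) = pE M f - pE M g"
  by (intro Bochner_Integration.integral_diff integrable_measure_pmf_finite)

lemma pE_sum: "finite (set_pmf M) \<Longrightarrow> pE M (\<lambda>s. \<Sum>i\<in>I. f i s) = (\<Sum>i\<in>I. pE M (f i))"
  by (intro Bochner_Integration.integral_sum integrable_measure_pmf_finite)

lemma pE_indicator: "pE M (\<lambda>s. if P s then 1 else 0) = measure_pmf.prob M {s. P s}"
proof -
  have "(\<lambda>s. if P s then 1 else 0) = (indicator {s. P s} :: _ \<Rightarrow> real)" by (auto simp: fun_eq_iff)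
  then show ?thesis by simp
qed

lemma pE_bind:
  assumes "finite (set_pmf p)" "\<And>x. x \<in> set_pmf p \<Longrightarrow> finite (set_pmf (f x))"
  shows "pE (bind_pmf p f) h = pE p (\<lambda>x. pE (f x) h)"
  using assms by (simp add: pmf_expectation_bind[of "set_pmf p"] integral_measure_pmf[of "set_pmf p"])

lemma prob_Un_le:
  assumes "\<And>s. s \<in> set_pmf M \<Longrightarrow> R s \<Longrightarrow> P s \<or> Q s"
  shows "measure_pmf.prob M {s. R s} \<le> measure_pmf.prob M {s. P s} + measure_pmf.prob M {s. Q s}"
proof -
  have "measure_pmf.prob M {s. R s} \<le> measure_pmf.prob M ({s. P s} \<union> {s. Q s})"
    by (rule measure_pmf.finite_measure_mono_AE) (use assms in \<open>auto simp: AE_measure_pmf_iff\<close>)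
  also have "\<dots> \<le> measure_pmf.prob M {s. P s} + measure_pmf.prob M {s. Q s}"
    by (rule measure_Un_le) auto
  finally show ?thesis .
qed

lemma prob_mono_pmf:
  assumes "\<And>s. s \<in> set_pmf M \<Longrightarrow> R s \<Longrightarrow> P s"
  shows "measure_pmf.prob M {s. R s} \<le> measure_pmf.prob M {s. P s}"
  using prob_Un_le[of M R P "\<lambda>_. False"] assms by simp

lemma prob_not: "measure_pmf.prob M {s. P s} = 1 - measure_pmf.prob M {s. \<not> P s}"
  using measure_pmf.prob_compl[of "{s. \<not> P s}" M] by (simp add: Compl_eq_Diff_UNIV[symmetric] Collect_neg_eq[symmetric])

lemma markov_pmf:
  assumes "finite (set_pmf M)" "\<And>s. s \<in> set_pmf M \<Longrightarrow> 0 \<le> f s" "c > 0"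
  shows "measure_pmf.prob M {s. f s \<ge> c} \<le> pE M f / c"
  using integral_Markov_inequality_measure[of M f "{}" c] assms
  by (simp add: integrable_measure_pmf_finite AE_measure_pmf_iff)

text \<open>The limit is a constant, so the distributions for different \<open>n\<close> need no
  common probability space. Markov's inequality turns this mode of convergence into the required
  statement in probability.\<close>

definition L1conv :: "(nat \<Rightarrow> 's pmf) \<Rightarrow> (nat \<Rightarrow> 's \<Rightarrow> real) \<Rightarrow> real \<Rightarrow> bool" where
  "L1conv S f x \<longleftrightarrow> (\<lambda>n. pE (S n) (\<lambda>s. \<bar>f n s - x\<bar>)) \<longlonglongrightarrow> 0"

locale fin_pmfs =
  fixes S :: "nat \<Rightarrow> 's pmf"
  assumes fin: "finite (set_pmf (S n))"
begin

lemma L1conv_bound: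
  assumes "\<forall>\<^sub>F n in sequentially. pE (S n) (\<lambda>s. \<bar>f n s - x\<bar>) \<le> b n" "b \<longlonglongrightarrow> 0"
  shows "L1conv S f x"
  unfolding L1conv_def
  by (rule tendsto_sandwich[OF _ assms(1) tendsto_const assms(2)]) (auto intro!: always_eventually pE_nonneg)

lemma L1conv_cong:
  assumes "L1conv S f x" "\<forall>\<^sub>F n in sequentially. \<forall>s\<in>set_pmf (S n). f n s = g n s"
  shows "L1conv S g x"
proof (rule L1conv_bound)
  show "(\<lambda>n. pE (S n) (\<lambda>s. \<bar>f n s - x\<bar>)) \<longlonglongrightarrow> 0" using assms(1) by (simp add: L1conv_def)
  show "\<forall>\<^sub>F n in sequentially. pE (S n) (\<lambda>s. \<bar>g n s - x\<bar>) \<le> pE (S n) (\<lambda>s. \<bar>f n s - x\<bar>)"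
    using assms(2) by eventually_elim (auto intro!: pE_mono fin)
qed

lemma L1conv_const: "c \<longlonglongrightarrow> x \<Longrightarrow> L1conv S (\<lambda>n s. c n) x"
  unfolding L1conv_def by (simp add: tendsto_rabs_zero_iff LIM_zero_iff)

lemma L1conv_add:
  assumes "L1conv S f x" "L1conv S g y" shows "L1conv S (\<lambda>n s. f n s + g n s) (x + y)"
proof (rule L1conv_bound)
  show "(\<lambda>n. pE (S n) (\<lambda>s. \<bar>f n s - x\<bar>) + pE (S n) (\<lambda>s. \<bar>g n s - y\<bar>)) \<longlonglongrightarrow> 0"
    using tendsto_add[OF assms[unfolded L1conv_def]] by simp
  show "\<forall>\<^sub>F n in sequentially. pE (S n) (\<lambda>s. \<bar>f n s + g n s - (x + y)\<bar>)
     \<le> pE (S n) (\<lambda>s. \<bar>f n s - x\<bar>) + pE (S n) (\<lambda>s. \<bar>g n s - y\<bar>)"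
    by (auto simp: pE_add[symmetric] fin intro!: always_eventually pE_mono)
qed

lemma L1conv_sum:
  assumes "finite I" "\<And>i. i \<in> I \<Longrightarrow> L1conv S (f i) (x i)"
  shows "L1conv S (\<lambda>n s. \<Sum>i\<in>I. f i n s) (\<Sum>i\<in>I. x i)"
  using assms by (induction I rule: finite_induct) (auto intro!: L1conv_add L1conv_const)

lemma L1conv_mult:
  assumes c: "c \<longlonglongrightarrow> a" and f: "L1conv S f x"
  shows "L1conv S (\<lambda>n s. c n * f n s) (a * x)"
proof (rule L1conv_bound)
  show "\<forall>\<^sub>F n in sequentially. pE (S n) (\<lambda>s. \<bar>c n * f n s - a * x\<bar>)
     \<le> \<bar>c n\<bar> * pE (S n) (\<lambda>s. \<bar>f n s - x\<bar>) + \<bar>c n - a\<bar> * \<bar>x\<bar>"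
  proof (rule always_eventually, rule allI)
    fix n
    have "pE (S n) (\<lambda>s. \<bar>c n * f n s - a * x\<bar>)
        \<le> pE (S n) (\<lambda>s. \<bar>c n\<bar> * \<bar>f n s - x\<bar> + \<bar>c n - a\<bar> * \<bar>x\<bar>)"
    proof (rule pE_mono[OF fin])
      fix s
      have "c n * f n s - a * x = c n * (f n s - x) + (c n - a) * x" by (simp add: algebra_simps)
      then show "\<bar>c n * f n s - a * x\<bar> \<le> \<bar>c n\<bar> * \<bar>f n s - x\<bar> + \<bar>c n - a\<bar> * \<bar>x\<bar>"
        by (metis abs_mult abs_triangle_ineq)
    qed
    then show "pE (S n) (\<lambda>s. \<bar>c n * f n s - a * x\<bar>)
     \<le> \<bar>c n\<bar> * pE (S n) (\<lambda>s. \<bar>f n s - x\<bar>) + \<bar>c n - a\<bar> * \<bar>x\<bar>"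
      by (simp add: pE_add fin)
  qed
  have "(\<lambda>n. \<bar>c n\<bar> * pE (S n) (\<lambda>s. \<bar>f n s - x\<bar>) + \<bar>c n - a\<bar> * \<bar>x\<bar>) \<longlonglongrightarrow> \<bar>a\<bar> * 0 + \<bar>a - a\<bar> * \<bar>x\<bar>"
    by (intro tendsto_intros c f[unfolded L1conv_def])
  then show "(\<lambda>n. \<bar>c n\<bar> * pE (S n) (\<lambda>s. \<bar>f n s - x\<bar>) + \<bar>c n - a\<bar> * \<bar>x\<bar>) \<longlonglongrightarrow> 0" by simp
qed

lemma L1conv_ge:
  assumes "L1conv S f x" "\<forall>\<^sub>F n in sequentially. pE (S n) (f n) \<ge> c"
  shows "x \<ge> c"
proof -
  have "\<forall>\<^sub>F n in sequentially. c - x \<le> pE (S n) (\<lambda>s. \<bar>f n s - x\<bar>)"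
    using assms(2)
  proof eventually_elim
    case (elim n)
    have "pE (S n) (\<lambda>s. f n s - x) \<le> pE (S n) (\<lambda>s. \<bar>f n s - x\<bar>)" by (intro pE_mono fin) auto
    then show ?case using elim by (simp add: pE_diff fin)
  qed
  then have "c - x \<le> 0"
    by (intro tendsto_lowerbound[OF assms(1)[unfolded L1conv_def]]) simp_all
  then show ?thesis by simp
qed

lemma L1conv_le:
  assumes "L1conv S f x" "\<forall>\<^sub>F n in sequentially. pE (S n) (f n) \<le> c"
  shows "x \<le> c"
proof -
  have "L1conv S (\<lambda>n s. (-1) * f n s) ((-1) * x)" by (intro L1conv_mult assms tendsto_const)
  then have "- x \<ge> - c" by (intro L1conv_ge[of "\<lambda>n s. - f n s" "- x"]) (use assms in auto)
  then show ?thesis by simp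
qed

lemma L1conv_prob:
  assumes "L1conv S f x" "\<epsilon> > 0" "\<theta> > 0"
  shows "\<forall>\<^sub>F n in sequentially. measure_pmf.prob (S n) {s. \<bar>f n s - x\<bar> \<ge> \<epsilon>} \<le> \<theta>"
proof -
  have "\<forall>\<^sub>F n in sequentially. pE (S n) (\<lambda>s. \<bar>f n s - x\<bar>) < \<epsilon> * \<theta>"
    using assms by (intro order_tendstoD(2)[OF assms(1)[unfolded L1conv_def]]) auto
  then show ?thesis
  proof eventually_elim
    case (elim n)
    have "measure_pmf.prob (S n) {s. \<bar>f n s - x\<bar> \<ge> \<epsilon>} \<le> pE (S n) (\<lambda>s. \<bar>f n s - x\<bar>) / \<epsilon>"
      by (rule markov_pmf) (use fin assms in auto)
    also have "\<dots> \<le> \<theta>" using elim assms by (simp add: field_simps)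
    finally show ?case .
  qed
qed

end

text \<open>The set of types is left abstract: Erdos-Renyi vertices get a labelled graph as type,
  attachment vertices a pattern with indegrees, and the limit argument is shared.\<close>

definition freq :: "(nat \<Rightarrow> 's \<Rightarrow> nat \<Rightarrow> 't) \<Rightarrow> 't set \<Rightarrow> nat \<Rightarrow> 's \<Rightarrow> real" where
  "freq \<tau> A n s = real (card {v\<in>{0..<n}. \<tau> n s v \<in> A}) / real n"

lemma freq_nonneg: "freq \<tau> A n s \<ge> 0" by (simp add: freq_def)

lemma freq_UNIV: "n > 0 \<Longrightarrow> freq \<tau> UNIV n s = 1" by (simp add: freq_def)

lemma freq_Un:
  assumes "A \<inter> B = {}" shows "freq \<tau> (A \<union> B) n s = freq \<tau> A n s + freq \<tau> B n s"
proof -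
  have "{v\<in>{0..<n}. \<tau> n s v \<in> A \<union> B} = {v\<in>{0..<n}. \<tau> n s v \<in> A} \<union> {v\<in>{0..<n}. \<tau> n s v \<in> B}" by auto
  moreover have "card ({v\<in>{0..<n}. \<tau> n s v \<in> A} \<union> {v\<in>{0..<n}. \<tau> n s v \<in> B})
     = card {v\<in>{0..<n}. \<tau> n s v \<in> A} + card {v\<in>{0..<n}. \<tau> n s v \<in> B}"
    by (rule card_Un_disjoint) (use assms in auto)
  ultimately show ?thesis by (simp add: freq_def add_divide_distrib)
qed

lemma freq_mono: "A \<subseteq> B \<Longrightarrow> freq \<tau> A n s \<le> freq \<tau> B n s"
  unfolding freq_def by (intro divide_right_mono of_nat_mono card_mono) auto

lemma freq_sum:
  assumes "finite F" shows "freq \<tau> F n s = (\<Sum>\<sigma>\<in>F. freq \<tau> {\<sigma>} n s)"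
  using assms
proof (induction F rule: finite_induct)
  case (insert x F)
  then have "freq \<tau> (insert x F) n s = freq \<tau> {x} n s + freq \<tau> F n s"
    using freq_Un[of "{x}" F \<tau> n s] by simp
  then show ?case using insert by simp
qed (simp add: freq_def)

text \<open>Transfers a sum in the sense of \<open>has_sum\<close> to the integral over the counting
  measure on which \<open>embed_pmf\<close> is based.\<close>

lemma pmf_of_has_sum:
  fixes p :: "'t \<Rightarrow> real"
  assumes "\<And>x. p x \<ge> 0" "(p has_sum 1) UNIV"
  obtains P where "\<And>x. pmf P x = p x"
proof -
  have "Infinite_Sum.abs_summable_on p UNIV"
    using assms(2) has_sum_imp_summable summable_on_iff_abs_summable_on_real by blast
  then have a: "Infinite_Set_Sum.abs_summable_on p UNIV" using abs_summable_equivalent[of p UNIV] by blast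
  have "nn_integral (count_space UNIV) p = ennreal (infsetsum p UNIV)"
    using nn_integral_conv_infsetsum[OF a] assms(1) by simp
  also have "infsetsum p UNIV = 1" using infsetsum_infsum[OF a] infsumI[OF assms(2)] by simp
  finally have "pmf (embed_pmf p) x = p x" for x using pmf_embed_pmf[of p] assms(1) by simp
  then show ?thesis using that by blast
qed

lemma has_sum_pmf:
  assumes "set_pmf P \<subseteq> A" shows "(pmf P has_sum 1) A"
proof -
  have "infsum (pmf P) A = 1" using infsetsum_pmf_eq_1[OF assms] infsetsum_infsum[of "pmf P" A] by (simp add: pmf_abs_summable)
  moreover have "pmf P summable_on A"
    using pmf_abs_summable[of P A] abs_summable_equivalent summable_on_iff_abs_summable_on_real by blast
  ultimately show ?thesis by (metis has_sum_infsum)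
qed

text \<open>Scheffe's argument: the pointwise limits of the type frequencies have total mass 1
  because tightness prevents mass from escaping, and then convergence extends from single types to
  every set \<open>A\<close>, finite or not.\<close>

lemma (in fin_pmfs) freq_scheffe:
  fixes \<tau> :: "nat \<Rightarrow> 's \<Rightarrow> nat \<Rightarrow> 't"
  assumes conv: "\<And>\<sigma>. \<exists>x. L1conv S (freq \<tau> {\<sigma>}) x"
    and tight: "\<And>\<epsilon>::real. \<epsilon> > 0 \<Longrightarrow> \<exists>F. finite F \<and> (\<forall>\<^sub>F n in sequentially. pE (S n) (freq \<tau> (- F) n) \<le> \<epsilon>)"
  obtains P :: "'t pmf" where "\<And>A. L1conv S (freq \<tau> A) (measure_pmf.prob P A)"
proof -
  obtain p where p: "\<And>\<sigma>. L1conv S (freq \<tau> {\<sigma>}) (p \<sigma>)" using conv by metis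
  have F: "L1conv S (freq \<tau> F) (sum p F)" if "finite F" for F
    by (rule L1conv_cong[OF L1conv_sum[OF that]], rule p) (simp add: freq_sum[OF that])
  have p0: "p \<sigma> \<ge> 0" for \<sigma>
    by (rule L1conv_ge[OF p]) (auto intro!: always_eventually pE_nonneg freq_nonneg)
  have n0: "\<forall>\<^sub>F n::nat in sequentially. n > 0" by (rule eventually_gt_at_top)
  have le1: "sum p F \<le> 1" if "finite F" for F
  proof (rule L1conv_le[OF F[OF that]], use n0 in eventually_elim)
    fix n :: nat assume "n > 0"
    then have "freq \<tau> F n s \<le> 1" for s
      using freq_mono[of F UNIV \<tau> n s] freq_UNIV[of n \<tau> s] by simp
    then show "pE (S n) (freq \<tau> F n) \<le> 1" by (intro pE_le_const fin) auto
  qed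
  have ge1: "\<exists>F. finite F \<and> sum p F \<ge> 1 - \<epsilon> \<and> (\<forall>\<^sub>F n in sequentially. pE (S n) (freq \<tau> (- F) n) \<le> \<epsilon>)"
    if \<epsilon>: "\<epsilon> > 0" for \<epsilon>
  proof -
    obtain G where G: "finite G" "\<forall>\<^sub>F n in sequentially. pE (S n) (freq \<tau> (- G) n) \<le> \<epsilon>" using tight[OF \<epsilon>] by blast
    have "sum p G \<ge> 1 - \<epsilon>"
    proof (rule L1conv_ge[OF F[OF G(1)]])
      show "\<forall>\<^sub>F n in sequentially. 1 - \<epsilon> \<le> pE (S n) (freq \<tau> G n)"
        using G(2) n0
      proof eventually_elim
        case (elim n)
        have "freq \<tau> G n s = 1 - freq \<tau> (- G) n s" for s
          using freq_Un[of G "- G" \<tau> n s] freq_UNIV[OF elim(2), of \<tau> s] by simp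
        then have "freq \<tau> G n = (\<lambda>s. 1 - freq \<tau> (- G) n s)" by (rule ext)
        then have "pE (S n) (freq \<tau> G n) = 1 - pE (S n) (freq \<tau> (- G) n)"
          by (simp add: pE_diff fin)
        then show ?case using elim by simp
      qed
    qed
    then show ?thesis using G by blast
  qed
  have "(p has_sum 1) UNIV"
    unfolding has_sum_def tendsto_iff eventually_finite_subsets_at_top
  proof (intro allI impI)
    fix e :: real assume e: "e > 0"
    obtain G where G: "finite G" "sum p G \<ge> 1 - e / 2" using ge1[of "e / 2"] e by auto
    show "\<exists>X. finite X \<and> X \<subseteq> UNIV \<and> (\<forall>Y. finite Y \<and> X \<subseteq> Y \<and> Y \<subseteq> UNIV \<longrightarrow> dist (sum p Y) 1 < e)"
    proof (intro exI[of _ G] conjI allI impI)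
      fix Y assume Y: "finite Y \<and> G \<subseteq> Y \<and> Y \<subseteq> UNIV"
      have "sum p G \<le> sum p Y" using Y p0 by (intro sum_mono2) auto
      then show "dist (sum p Y) 1 < e" using le1[of Y] Y G e by (simp add: dist_real_def)
    qed (use G in auto)
  qed
  then obtain P where P: "\<And>x. pmf P x = p x" using pmf_of_has_sum[of p] p0 by blast
  have PF: "measure_pmf.prob P F = sum p F" if "finite F" for F
    using that by (simp add: measure_measure_pmf_finite P)
  have "L1conv S (freq \<tau> A) (measure_pmf.prob P A)" for A
    unfolding L1conv_def
  proof (rule metric_LIMSEQ_I)
    fix e :: real assume e: "e > 0"
    \<comment> \<open>Three quarters of \<open>e\<close> are spent: on the finite part inside
      \<open>G\<close>, on the empirical mass outside \<open>G\<close>, and on the limiting mass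
      outside \<open>G\<close>.\<close>
    obtain G where G: "finite G" "sum p G \<ge> 1 - e / 4"
      "\<forall>\<^sub>F n in sequentially. pE (S n) (freq \<tau> (- G) n) \<le> e / 4" using ge1[of "e / 4"] e by auto
    have tail: "measure_pmf.prob P (- G) \<le> e / 4"
      using measure_pmf.prob_compl[of G P] PF[OF G(1)] G(2) by (simp add: Compl_eq_Diff_UNIV)
    have "\<forall>\<^sub>F n in sequentially. pE (S n) (\<lambda>s. \<bar>freq \<tau> (A \<inter> G) n s - sum p (A \<inter> G)\<bar>) < e / 4"
      using F[of "A \<inter> G"] G(1) e unfolding L1conv_def by (intro order_tendstoD(2)) auto
    then have "\<forall>\<^sub>F n in sequentially. dist (pE (S n) (\<lambda>s. \<bar>freq \<tau> A n s - measure_pmf.prob P A\<bar>)) 0 < e"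
      using G(3)
    proof eventually_elim
      case (elim n)
      have "pE (S n) (\<lambda>s. \<bar>freq \<tau> A n s - measure_pmf.prob P A\<bar>)
        \<le> pE (S n) (\<lambda>s. \<bar>freq \<tau> (A \<inter> G) n s - sum p (A \<inter> G)\<bar> + freq \<tau> (- G) n s + e / 4)"
      proof (rule pE_mono[OF fin])
        fix s
        have A: "A = (A \<inter> G) \<union> (A - G)" by auto
        have "freq \<tau> A n s = freq \<tau> (A \<inter> G) n s + freq \<tau> (A - G) n s"
          by (subst A, rule freq_Un) auto
        moreover have "freq \<tau> (A - G) n s \<le> freq \<tau> (- G) n s" by (rule freq_mono) auto
        moreover have "measure_pmf.prob P A = sum p (A \<inter> G) + measure_pmf.prob P (A - G)"
          using PF[of "A \<inter> G"] G(1) measure_pmf.finite_measure_Union[of "A \<inter> G" P "A - G"] A by auto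
        moreover have "measure_pmf.prob P (A - G) \<le> measure_pmf.prob P (- G)"
          by (intro measure_pmf.finite_measure_mono) auto
        ultimately show "\<bar>freq \<tau> A n s - measure_pmf.prob P A\<bar>
          \<le> \<bar>freq \<tau> (A \<inter> G) n s - sum p (A \<inter> G)\<bar> + freq \<tau> (- G) n s + e / 4"
          using tail freq_nonneg[of \<tau> "A - G" n s] measure_nonneg[of P "A - G"] by linarith
      qed
      also have "\<dots> = pE (S n) (\<lambda>s. \<bar>freq \<tau> (A \<inter> G) n s - sum p (A \<inter> G)\<bar>) + pE (S n) (freq \<tau> (- G) n) + e / 4"
        by (simp add: pE_add fin)
      finally have "pE (S n) (\<lambda>s. \<bar>freq \<tau> A n s - measure_pmf.prob P A\<bar>) < e" using elim e by linarith
      moreover have "0 \<le> pE (S n) (\<lambda>s. \<bar>freq \<tau> A n s - measure_pmf.prob P A\<bar>)" by (intro pE_nonneg) auto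
      ultimately show ?case by (simp add: dist_real_def)
    qed
    then show "\<exists>no. \<forall>n\<ge>no. dist (pE (S n) (\<lambda>s. \<bar>freq \<tau> A n s - measure_pmf.prob P A\<bar>)) 0 < e"
      by (simp add: eventually_sequentially)
  qed
  then show ?thesis using that by blast
qed

section \<open>Expansion and extension counts\<close>

text \<open>The moment of order 3/2, taken for an arbitrary function \<open>d\<close> because in the
  attachment model an upper bound of the degrees is controlled rather than the degrees
  themselves.\<close>

definition dmom :: "nat \<Rightarrow> (nat \<Rightarrow> nat) \<Rightarrow> real" where
  "dmom n d = (\<Sum>v<n. real (d v) * sqrt (real (d v)))"

lemma dmom_mono: "(\<And>v. v < n \<Longrightarrow> d v \<le> d' v) \<Longrightarrow> dmom n d \<le> dmom n d'"
  unfolding dmom_def by (intro sum_mono mult_mono) auto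

lemma dmom_nonneg: "dmom n d \<ge> 0"
  unfolding dmom_def by (intro sum_nonneg) auto

lemma card_high_le_dmom:
  fixes K :: nat and d :: "nat \<Rightarrow> nat"
  shows "real (card {v\<in>{0..<n}. d v > K}) * real K \<le> dmom n d"
proof -
  have le: "real K \<le> real (d v) * sqrt (real (d v))" if "K < d v" for v
  proof -
    have "1 \<le> sqrt (real (d v))" using that by simp
    then have "real (d v) * 1 \<le> real (d v) * sqrt (real (d v))" by (intro mult_left_mono) auto
    moreover have "real K \<le> real (d v)" using that by simp
    ultimately show ?thesis by linarith
  qed
  have "real (card {v\<in>{0..<n}. d v > K}) * real K = (\<Sum>v | v \<in> {0..<n} \<and> d v > K. real K)" by simp
  also have "\<dots> \<le> (\<Sum>v | v \<in> {0..<n} \<and> d v > K. real (d v) * sqrt (real (d v)))"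
    by (intro sum_mono le) auto
  also have "\<dots> \<le> dmom n d" unfolding dmom_def by (intro sum_mono2) auto
  finally show ?thesis .
qed

text \<open>Every degree that exceeds \<open>K\<close> supplies an additional factor
  \<open>sqrt K\<close>: this is how a moment of order above 1 makes the tail small for large
  \<open>K\<close>, uniformly in \<open>n\<close>.\<close>

lemma dtail_le_dmom:
  assumes "K > 0" shows "real (dtail n E K) * sqrt K \<le> dmom n (dg E)"
proof -
  have "real (dtail n E K) * sqrt K = (\<Sum>v | v < n \<and> dg E v > K. real (dg E v) * sqrt K)"
    by (simp add: dtail_def sum_distrib_right)
  also have "\<dots> \<le> (\<Sum>v | v < n \<and> dg E v > K. real (dg E v) * sqrt (real (dg E v)))"
    by (intro sum_mono mult_left_mono) auto
  also have "\<dots> \<le> dmom n (dg E)" unfolding dmom_def by (intro sum_mono2) auto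
  finally show ?thesis .
qed

definition extension_law :: "(nat \<Rightarrow> nat set set pmf) \<Rightarrow> rgraph \<Rightarrow> nat \<Rightarrow> bool" where
  "extension_law M T l \<longleftrightarrow> (\<exists>q :: rgraph set \<Rightarrow> real.
     (\<forall>C \<in> Ext T. q C \<in> {0..1} \<and>
        (\<forall>\<epsilon>>0. \<forall>\<theta>>0. \<exists>N. \<forall>n\<ge>N.
           measure_pmf.prob (M n)
             {E. \<forall>us. length us = length (rroots T) \<and> set us \<subseteq> {0..<n}
                    \<and> riso (nbhd E l us) T \<longrightarrow>
                  \<bar>real (card {v \<in> {0..<n}. nbhd E l (us @ [v]) \<in> C}) / real n - q C\<bar> < \<epsilon>}
           \<ge> 1 - \<theta>))
     \<and> (q has_sum 1) (Ext T))"

text \<open>What the geometric argument needs from a model. The function \<open>d\<close> may exceed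
  the degree: in the attachment model it is \<open>m\<close> plus the indegree with multiplicity,
  which controls both the degree and the numbers recorded in a pattern. \<open>UI\<close> yields
  uniform integrability of the degrees.\<close>

locale graph_seq = fin_pmfs S for S :: "nat \<Rightarrow> 's pmf" +
  fixes g :: "nat \<Rightarrow> 's \<Rightarrow> nat set set" and d :: "nat \<Rightarrow> 's \<Rightarrow> nat \<Rightarrow> nat" and C :: real
  assumes sg: "\<forall>\<^sub>F n in sequentially. \<forall>s\<in>set_pmf (S n). sgraph n (g n s)"
    and dg_le: "\<forall>\<^sub>F n in sequentially. \<forall>s\<in>set_pmf (S n). \<forall>v<n. dg (g n s) v \<le> d n s v"
    and UI: "\<forall>\<^sub>F n in sequentially. pE (S n) (\<lambda>s. dmom n (d n s)) \<le> C * n"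
begin

lemma dtail_small:
  fixes \<epsilon> \<theta> :: real
  assumes "\<epsilon> > 0" "\<theta> > 0"
  obtains K where "\<forall>\<^sub>F n in sequentially. measure_pmf.prob (S n) {s. real (dtail n (g n s) K) \<ge> \<epsilon> * n} \<le> \<theta>"
proof -
  \<comment> \<open>Markov's inequality bounds the probability by
    \<open>C / (\<epsilon> * sqrt K)\<close>, hence the square. \<open>max C 0\<close> covers a
    negative \<open>C\<close>, and the added 1 makes \<open>K\<close> positive.\<close>
  obtain K where K: "real K \<ge> (max C 0 / (\<epsilon> * \<theta>))\<^sup>2 + 1" using real_arch_simple by blast
  have K0: "K > 0" using K by (smt (verit) of_nat_0_less_iff zero_le_power2)
  have "max C 0 / (\<epsilon> * \<theta>) \<le> sqrt K" using K by (intro real_le_rsqrt) simp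
  then have CK: "C \<le> \<theta> * (\<epsilon> * sqrt K)" using assms by (simp add: field_simps)
  have "\<forall>\<^sub>F n in sequentially. measure_pmf.prob (S n) {s. real (dtail n (g n s) K) \<ge> \<epsilon> * n} \<le> \<theta>"
    using UI dg_le eventually_gt_at_top[of 0]
  proof eventually_elim
    case (elim n)
    have "measure_pmf.prob (S n) {s. real (dtail n (g n s) K) \<ge> \<epsilon> * n}
      \<le> measure_pmf.prob (S n) {s. dmom n (d n s) \<ge> \<epsilon> * n * sqrt K}"
    proof (rule prob_mono_pmf)
      fix s assume s: "s \<in> set_pmf (S n)" "real (dtail n (g n s) K) \<ge> \<epsilon> * n"
      then have "\<epsilon> * n * sqrt K \<le> real (dtail n (g n s) K) * sqrt K" by (intro mult_right_mono) auto
      also have "\<dots> \<le> dmom n (dg (g n s))" by (rule dtail_le_dmom[OF K0])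
      also have "\<dots> \<le> dmom n (d n s)" by (rule dmom_mono) (use elim s in auto)
      finally show "dmom n (d n s) \<ge> \<epsilon> * n * sqrt K" .
    qed
    also have "\<dots> \<le> pE (S n) (\<lambda>s. dmom n (d n s)) / (\<epsilon> * n * sqrt K)"
      by (rule markov_pmf) (use fin assms K0 elim dmom_nonneg in auto)
    also have "\<dots> \<le> C * n / (\<epsilon> * n * sqrt K)" using elim assms by (intro divide_right_mono) auto
    also have "\<dots> \<le> \<theta>" using CK K0 elim assms by (simp add: field_simps)
    finally show ?case .
  qed
  then show ?thesis using that by blast
qed

lemma expansion1:
  fixes \<epsilon> \<theta> :: real
  assumes "\<epsilon> > 0" "\<theta> > 0"
  shows "\<exists>\<delta>::real. \<delta> > 0 \<and> (\<forall>\<^sub>F n in sequentially. measure_pmf.prob (S n)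
    {s. \<exists>U\<subseteq>{0..<n}. real (card U) \<le> \<delta> * real n \<and> real (card (balls (g n s) 1 U)) > \<epsilon> * n} \<le> \<theta>)"
proof -
  obtain K where K: "\<forall>\<^sub>F n in sequentially. measure_pmf.prob (S n) {s. real (dtail n (g n s) K) \<ge> \<epsilon> / 2 * n} \<le> \<theta>"
    using dtail_small[of "\<epsilon> / 2" \<theta>] assms by auto
  \<comment> \<open>Vertices of small degree contribute at most
    \<open>(K + 1) * \<delta> * n\<close>, which is half of the budget
    \<open>\<epsilon> * n\<close>; the other half is left for the tail.\<close>
  define \<delta> where "\<delta> = \<epsilon> / (2 * (K + 1))"
  have d0: "\<delta> > 0" using assms by (simp add: \<delta>_def)
  have "\<forall>\<^sub>F n in sequentially. measure_pmf.prob (S n)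
    {s. \<exists>U\<subseteq>{0..<n}. real (card U) \<le> \<delta> * real n \<and> real (card (balls (g n s) 1 U)) > \<epsilon> * n} \<le> \<theta>"
    using K sg
  proof eventually_elim
    case (elim n)
    have "measure_pmf.prob (S n)
        {s. \<exists>U\<subseteq>{0..<n}. real (card U) \<le> \<delta> * real n \<and> real (card (balls (g n s) 1 U)) > \<epsilon> * n}
      \<le> measure_pmf.prob (S n) {s. real (dtail n (g n s) K) \<ge> \<epsilon> / 2 * n}"
    proof (rule prob_mono_pmf)
      fix s assume s: "s \<in> set_pmf (S n)"
        "\<exists>U\<subseteq>{0..<n}. real (card U) \<le> \<delta> * real n \<and> real (card (balls (g n s) 1 U)) > \<epsilon> * n"
      then obtain U where U: "U \<subseteq> {0..<n}" "card U \<le> \<delta> * n" "real (card (balls (g n s) 1 U)) > \<epsilon> * n" by auto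
      have "real (card (balls (g n s) 1 U)) \<le> real ((K + 1) * card U + dtail n (g n s) K)"
        using card_balls_1[OF _ U(1), of "g n s" K] elim s(1) of_nat_mono by blast
      also have "\<dots> = real (K + 1) * card U + dtail n (g n s) K" by (simp add: algebra_simps)
      also have "real (K + 1) * card U \<le> real (K + 1) * (\<delta> * n)" using U(2) by (intro mult_left_mono) auto
      also have "real (K + 1) * (\<delta> * n) = \<epsilon> / 2 * n" by (simp add: \<delta>_def field_simps)
      finally show "real (dtail n (g n s) K) \<ge> \<epsilon> / 2 * n" using U(3) by simp
    qed
    then show ?case using elim(1) by simp
  qed
  then show ?thesis using d0 by blast
qed

text \<open>One step of expansion is iterated, halving \<open>\<theta>\<close> each time. The
  quantifier over \<open>U\<close> stands inside the event, so the next step may be applied to the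
  random set \<open>balls (g n s) l U\<close>, and later to all tuples of roots
  simultaneously.\<close>

lemma expansion:
  fixes \<epsilon> \<theta> :: real
  assumes "\<epsilon> > 0" "\<theta> > 0"
  shows "\<exists>\<delta>::real. \<delta> > 0 \<and> (\<forall>\<^sub>F n in sequentially. measure_pmf.prob (S n)
    {s. \<exists>U\<subseteq>{0..<n}. real (card U) \<le> \<delta> * real n \<and> real (card (balls (g n s) l U)) > \<epsilon> * n} \<le> \<theta>)"
  using assms
proof (induction l arbitrary: \<epsilon> \<theta>)
  case 0
  have "measure_pmf.prob (S n)
    {s. \<exists>U\<subseteq>{0..<n}. real (card U) \<le> \<epsilon> * real n \<and> real (card (balls (g n s) 0 U)) > \<epsilon> * n} \<le> \<theta>" for n
  proof -
    have "{s. \<exists>U\<subseteq>{0..<n}. real (card U) \<le> \<epsilon> * real n \<and> real (card (balls (g n s) 0 U)) > \<epsilon> * n} = {}"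
      by (auto simp: balls_def)
    then show ?thesis using 0 by (simp only: measure_empty)
  qed
  then have "\<forall>\<^sub>F n in sequentially. measure_pmf.prob (S n)
    {s. \<exists>U\<subseteq>{0..<n}. real (card U) \<le> \<epsilon> * real n \<and> real (card (balls (g n s) 0 U)) > \<epsilon> * n} \<le> \<theta>"
    by (intro always_eventually allI)
  then show ?case using 0(1) by blast
next
  case (Suc l)
  obtain \<delta>' :: real where \<delta>': "\<delta>' > 0" "\<forall>\<^sub>F n in sequentially. measure_pmf.prob (S n)
    {s. \<exists>U\<subseteq>{0..<n}. real (card U) \<le> \<delta>' * real n \<and> real (card (balls (g n s) 1 U)) > \<epsilon> * n} \<le> \<theta> / 2"
    using expansion1[of \<epsilon> "\<theta> / 2"] Suc.prems by auto
  obtain \<delta> :: real where \<delta>: "\<delta> > 0" "\<forall>\<^sub>F n in sequentially. measure_pmf.prob (S n)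
    {s. \<exists>U\<subseteq>{0..<n}. real (card U) \<le> \<delta> * real n \<and> real (card (balls (g n s) l U)) > \<delta>' * n} \<le> \<theta> / 2"
    using Suc.IH[of \<delta>' "\<theta> / 2"] Suc.prems \<delta>' by auto
  have "\<forall>\<^sub>F n in sequentially. measure_pmf.prob (S n)
    {s. \<exists>U\<subseteq>{0..<n}. real (card U) \<le> \<delta> * real n \<and> real (card (balls (g n s) (Suc l) U)) > \<epsilon> * n} \<le> \<theta>"
    using \<delta>'(2) \<delta>(2) sg
  proof eventually_elim
    case (elim n)
    have "measure_pmf.prob (S n)
        {s. \<exists>U\<subseteq>{0..<n}. real (card U) \<le> \<delta> * real n \<and> real (card (balls (g n s) (Suc l) U)) > \<epsilon> * n}
      \<le> measure_pmf.prob (S n)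
    {s. \<exists>U\<subseteq>{0..<n}. real (card U) \<le> \<delta>' * real n \<and> real (card (balls (g n s) 1 U)) > \<epsilon> * n} + measure_pmf.prob (S n)
    {s. \<exists>U\<subseteq>{0..<n}. real (card U) \<le> \<delta> * real n \<and> real (card (balls (g n s) l U)) > \<delta>' * n}"
    proof (rule prob_Un_le)
      fix s assume s: "s \<in> set_pmf (S n)"
        "\<exists>U\<subseteq>{0..<n}. real (card U) \<le> \<delta> * real n \<and> real (card (balls (g n s) (Suc l) U)) > \<epsilon> * n"
      then obtain U where U: "U \<subseteq> {0..<n}" "card U \<le> \<delta> * n" "real (card (balls (g n s) (Suc l) U)) > \<epsilon> * n" by auto
      have "sgraph n (g n s)" using elim(3) s(1) by simp
      then have sub: "balls (g n s) l U \<subseteq> {0..<n}" by (rule balls_subset[OF _ U(1)])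
      show "(\<exists>U\<subseteq>{0..<n}. real (card U) \<le> \<delta>' * real n \<and> real (card (balls (g n s) 1 U)) > \<epsilon> * n) \<or>
        (\<exists>U\<subseteq>{0..<n}. real (card U) \<le> \<delta> * real n \<and> real (card (balls (g n s) l U)) > \<delta>' * n)"
      proof (cases "real (card (balls (g n s) l U)) > \<delta>' * n")
        case True
        then show ?thesis using U(1,2) by (intro disjI2 exI[of _ U] conjI)
      next
        case False
        then have "real (card (balls (g n s) l U)) \<le> \<delta>' * real n" by simp
        moreover have "real (card (balls (g n s) 1 (balls (g n s) l U))) > \<epsilon> * n"
          using U(3) balls_Suc[of "g n s" l U] by simp
        ultimately show ?thesis using sub by (intro disjI1 exI[of _ "balls (g n s) l U"] conjI)
      qed
    qed
    then show ?case using elim(1,2) by simp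
  qed
  then show ?case using \<delta>(1) by blast
qed

lemma balls_small:
  fixes \<epsilon> \<theta> :: real
  assumes "\<epsilon> > 0" "\<theta> > 0"
  shows "\<forall>\<^sub>F n in sequentially. measure_pmf.prob (S n)
    {s. \<exists>U\<subseteq>{0..<n}. card U \<le> k \<and> real (card (balls (g n s) l U)) > \<epsilon> * n} \<le> \<theta>"
proof -
  obtain \<delta> :: real where \<delta>: "\<delta> > 0" "\<forall>\<^sub>F n in sequentially. measure_pmf.prob (S n)
    {s. \<exists>U\<subseteq>{0..<n}. real (card U) \<le> \<delta> * real n \<and> real (card (balls (g n s) l U)) > \<epsilon> * n} \<le> \<theta>"
    using expansion[OF assms, of l] by (elim exE conjE) (rule that)
  have "\<forall>\<^sub>F n in sequentially. real k \<le> \<delta> * n"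
    using eventually_ge_at_top[of "nat \<lceil>real k / \<delta>\<rceil>"]
  proof eventually_elim
    case (elim n)
    then have "real k / \<delta> \<le> n" by linarith
    then show ?case using \<delta>(1) by (simp add: field_simps)
  qed
  with \<delta>(2) show ?thesis
  proof eventually_elim
    case (elim n)
    have "measure_pmf.prob (S n) {s. \<exists>U\<subseteq>{0..<n}. card U \<le> k \<and> real (card (balls (g n s) l U)) > \<epsilon> * n}
      \<le> measure_pmf.prob (S n) {s. \<exists>U\<subseteq>{0..<n}. real (card U) \<le> \<delta> * real n \<and> real (card (balls (g n s) l U)) > \<epsilon> * n}"
    proof (rule prob_mono_pmf)
      fix s assume "\<exists>U\<subseteq>{0..<n}. card U \<le> k \<and> real (card (balls (g n s) l U)) > \<epsilon> * n"
      then obtain U where U: "U \<subseteq> {0..<n}" "card U \<le> k" "real (card (balls (g n s) l U)) > \<epsilon> * n" by auto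
      have "real (card U) \<le> real k" using U(2) by simp
      then have "real (card U) \<le> \<delta> * n" using elim(2) by linarith
      then show "\<exists>U\<subseteq>{0..<n}. real (card U) \<le> \<delta> * real n \<and> real (card (balls (g n s) l U)) > \<epsilon> * n" using U(1,3) by (intro exI[of _ U] conjI)
    qed
    then show ?case using elim(1) by simp
  qed
qed

text \<open>By symmetry of distance, a vertex close to one with \<open>d > D\<close> lies in the
  ball around the set of all such vertices. Markov's inequality makes that set small, and
  \<open>expansion\<close> makes its ball small. The lemma yields tightness of types, since bounded
  values of \<open>d\<close> leave only finitely many types.\<close>

lemma tight_degrees:
  fixes \<epsilon> :: real
  assumes "\<epsilon> > 0"
  shows "\<exists>D. \<forall>\<^sub>F n in sequentially.
    pE (S n) (\<lambda>s. real (card {v\<in>{0..<n}. \<exists>w\<in>ball (g n s) l v. d n s w > D}) / n) \<le> \<epsilon>"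
proof -
  obtain \<delta> :: real where \<delta>: "\<delta> > 0" "\<forall>\<^sub>F n in sequentially. measure_pmf.prob (S n)
    {s. \<exists>U\<subseteq>{0..<n}. real (card U) \<le> \<delta> * real n \<and> real (card (balls (g n s) l U)) > \<epsilon> / 3 * n} \<le> \<epsilon> / 3"
    using expansion[of "\<epsilon> / 3" "\<epsilon> / 3"] assms by auto
  \<comment> \<open>By \<open>card_high_le_dmom\<close>, more than \<open>\<delta> * n\<close>
    vertices above \<open>D\<close> force a moment of at least \<open>\<delta> * n * D\<close>; this
    \<open>D\<close> makes the probability of that at most \<open>\<epsilon> / 3\<close>.\<close>
  obtain D where D: "real D \<ge> \<bar>C\<bar> / (\<delta> * (\<epsilon> / 3)) + 1" using real_arch_simple by blast
  have "0 \<le> \<bar>C\<bar> / (\<delta> * (\<epsilon> / 3))" using \<delta>(1) assms by simp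
  then have D0: "real D > 0" using D by linarith
  have "\<bar>C\<bar> / (\<delta> * (\<epsilon> / 3)) \<le> D" using D by simp
  then have CD: "C \<le> \<delta> * D * (\<epsilon> / 3)" using \<delta>(1) assms by (simp add: field_simps)
  have "\<forall>\<^sub>F n in sequentially.
    pE (S n) (\<lambda>s. real (card {v\<in>{0..<n}. \<exists>w\<in>ball (g n s) l v. d n s w > D}) / n) \<le> \<epsilon>"
    using \<delta>(2) UI sg eventually_gt_at_top[of 0]
  proof eventually_elim
    case (elim n)
    let ?N = "\<lambda>s. card {v\<in>{0..<n}. \<exists>w\<in>ball (g n s) l v. d n s w > D}"
    let ?big = "\<lambda>s. \<exists>U\<subseteq>{0..<n}. real (card U) \<le> \<delta> * real n \<and> real (card (balls (g n s) l U)) > \<epsilon> / 3 * n"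
    let ?many = "\<lambda>s. dmom n (d n s) \<ge> \<delta> * n * D"
    have "measure_pmf.prob (S n) {s. ?many s} \<le> pE (S n) (\<lambda>s. dmom n (d n s)) / (\<delta> * n * D)"
      by (rule markov_pmf) (use fin \<delta>(1) D0 elim dmom_nonneg in auto)
    also have "\<dots> \<le> C * n / (\<delta> * n * D)" using elim \<delta>(1) by (intro divide_right_mono) auto
    also have "\<dots> \<le> \<epsilon> / 3" using CD D0 elim \<delta>(1) by (simp add: field_simps)
    finally have many: "measure_pmf.prob (S n) {s. ?many s} \<le> \<epsilon> / 3" .
    have bound: "real (?N s) / n \<le> \<epsilon> / 3 + (if ?big s then 1 else 0) + (if ?many s then 1 else 0)"
      if s: "s \<in> set_pmf (S n)" for s
    proof -
      have "?N s \<le> card {0..<n}" by (intro card_mono) auto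
      then have le1: "real (?N s) / n \<le> 1" using elim(4) by simp
      show ?thesis
      proof (cases "?big s \<or> ?many s")
        case True
        then show ?thesis using le1 assms by auto
      next
        case False
        define U where "U = {v\<in>{0..<n}. d n s v > D}"
        have sgs: "sgraph n (g n s)" using elim(3) s by simp
        have "real (card U) * D < \<delta> * n * D"
          using card_high_le_dmom[where d = "d n s" and K = D and n = n] False unfolding U_def by linarith
        then have "real (card U) \<le> \<delta> * n" using D0 by simp
        moreover have Us: "U \<subseteq> {0..<n}" by (auto simp: U_def)
        ultimately have c: "real (card (balls (g n s) l U)) \<le> \<epsilon> / 3 * n" using False by (meson not_less)
        have "{v\<in>{0..<n}. \<exists>w\<in>ball (g n s) l v. d n s w > D} \<subseteq> balls (g n s) l U"
        proof
          fix v assume "v \<in> {v\<in>{0..<n}. \<exists>w\<in>ball (g n s) l v. d n s w > D}"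
          then obtain w where w: "v < n" "w \<in> ball (g n s) l v" "d n s w > D" by auto
          then have "w \<in> U" using ball_subset[OF sgs w(1), of l] by (auto simp: U_def)
          then show "v \<in> balls (g n s) l U" using ball_sym[OF w(2)] by (auto simp: balls_def)
        qed
        then have "?N s \<le> card (balls (g n s) l U)"
          using finite_subset[OF balls_subset[OF sgs Us, of l]] by (intro card_mono) auto
        then have "real (?N s) \<le> \<epsilon> / 3 * n" using c by linarith
        then show ?thesis using elim(4) False by (simp add: field_simps)
      qed
    qed
    have "pE (S n) (\<lambda>s. real (?N s) / n)
      \<le> pE (S n) (\<lambda>s. \<epsilon> / 3 + (if ?big s then 1 else 0) + (if ?many s then 1 else 0))"
      by (rule pE_mono[OF fin bound])
    also have "\<dots> = \<epsilon> / 3 + measure_pmf.prob (S n) {s. ?big s} + measure_pmf.prob (S n) {s. ?many s}"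
      by (simp add: pE_add fin pE_indicator)
    finally show ?case using many elim(1) by linarith
  qed
  then show ?thesis by blast
qed

text \<open>Outside the ball of radius \<open>2 * l + 1\<close> around the tuple, the class of the
  joint neighbourhood is a function \<open>cl\<close> of the type of \<open>v\<close> alone. So the
  count for \<open>us\<close> differs from a count of types, in which \<open>us\<close> does not
  occur, by at most the size of that ball; this is where uniformity in \<open>us\<close> comes
  from.\<close>

lemma extension_counts:
  fixes \<tau> :: "nat \<Rightarrow> 's \<Rightarrow> nat \<Rightarrow> 't" and R :: "'t \<Rightarrow> rgraph" and P :: "'t pmf"
  assumes wfT: "wf_rgraph T"
    and P: "\<And>A. L1conv S (freq \<tau> A) (measure_pmf.prob P A)"
    and R: "\<forall>\<^sub>F n in sequentially. \<forall>s\<in>set_pmf (S n). \<forall>v<n. wf_rgraph (R (\<tau> n s v))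
       \<and> riso (nbhd (g n s) l [v]) (R (\<tau> n s v))"
    and M: "\<And>n. M n = map_pmf (g n) (S n)"
  shows "extension_law M T l"
proof -
  \<comment> \<open>\<open>R\<close> may send types that never occur to something that is not a
    graph with one root. Replacing these values by a single vertex makes every \<open>cl t\<close>
    an element of \<open>Ext T\<close>, so \<open>Q\<close> is supported there whatever
    \<open>P\<close> is.\<close>
  define R' where "R' t = (if wf_rgraph (R t) \<and> length (rroots (R t)) = 1 then R t
      else \<lparr>rV = {0}, rE = {}, rroots = [0]\<rparr>)" for t
  have R'wf: "wf_rgraph (R' t)" "length (rroots (R' t)) = 1" for t
    by (auto simp: R'_def wf_rgraph_def)
  have R': "riso (nbhd (g n s) l [v]) (R' (\<tau> n s v))"
    if "wf_rgraph (R (\<tau> n s v))" "riso (nbhd (g n s) l [v]) (R (\<tau> n s v))" for n s v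
  proof -
    have "length (rroots (R (\<tau> n s v))) = length (rroots (nbhd (g n s) l [v]))"
      using that(2) unfolding riso_def by (metis length_map)
    then show ?thesis using that by (simp add: R'_def nbhd_simps)
  qed
  define cl where "cl t = iso_class (djoin T (R' t))" for t
  define Q where "Q = map_pmf cl P"
  have setQ: "set_pmf Q \<subseteq> Ext T"
    using extends_djoin[OF wfT R'wf] by (auto simp: Q_def cl_def Ext_def)
  have main: "\<exists>N. \<forall>n\<ge>N. measure_pmf.prob (M n)
             {E. \<forall>us. length us = length (rroots T) \<and> set us \<subseteq> {0..<n}
                    \<and> riso (nbhd E l us) T \<longrightarrow>
                  \<bar>real (card {v \<in> {0..<n}. nbhd E l (us @ [v]) \<in> Cl}) / real n - pmf Q Cl\<bar> < \<epsilon>}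
           \<ge> 1 - \<theta>" if Cl: "Cl \<in> Ext T" and e: "\<epsilon> > 0" "\<theta> > 0" for Cl and \<epsilon> \<theta> :: real
  proof -
    define A where "A = {t. cl t = Cl}"
    have PA: "measure_pmf.prob P A = pmf Q Cl"
      by (simp add: Q_def pmf_map A_def vimage_def)
    define k where "k = length (rroots T)"
    \<comment> \<open>Error budget: \<open>\<epsilon> / 2\<close> for the type frequency and
      \<open>\<epsilon> / 4\<close> for the vertices near the tuple.\<close>
    have ev1: "\<forall>\<^sub>F n in sequentially. measure_pmf.prob (S n) {s. \<bar>freq \<tau> A n s - pmf Q Cl\<bar> \<ge> \<epsilon> / 2} \<le> \<theta> / 2"
      using L1conv_prob[OF P[of A], of "\<epsilon> / 2" "\<theta> / 2"] e PA by simp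
    have ev2: "\<forall>\<^sub>F n in sequentially. measure_pmf.prob (S n)
       {s. \<exists>U\<subseteq>{0..<n}. card U \<le> k \<and> real (card (balls (g n s) (2 * l + 1) U)) > \<epsilon> / 4 * n} \<le> \<theta> / 2"
      using balls_small[of "\<epsilon> / 4" "\<theta> / 2"] e by simp
    have "\<forall>\<^sub>F n in sequentially. measure_pmf.prob (M n)
             {E. \<forall>us. length us = length (rroots T) \<and> set us \<subseteq> {0..<n}
                    \<and> riso (nbhd E l us) T \<longrightarrow>
                  \<bar>real (card {v \<in> {0..<n}. nbhd E l (us @ [v]) \<in> Cl}) / real n - pmf Q Cl\<bar> < \<epsilon>}
           \<ge> 1 - \<theta>"
      using ev1 ev2 R sg eventually_gt_at_top[of 0]
    proof eventually_elim
      case (elim n)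
      define good where "good E \<longleftrightarrow> (\<forall>us. length us = length (rroots T) \<and> set us \<subseteq> {0..<n}
                    \<and> riso (nbhd E l us) T \<longrightarrow>
                  \<bar>real (card {v \<in> {0..<n}. nbhd E l (us @ [v]) \<in> Cl}) / real n - pmf Q Cl\<bar> < \<epsilon>)" for E
      have "measure_pmf.prob (S n) {s. \<not> good (g n s)}
        \<le> measure_pmf.prob (S n) {s. \<bar>freq \<tau> A n s - pmf Q Cl\<bar> \<ge> \<epsilon> / 2}
         + measure_pmf.prob (S n)
       {s. \<exists>U\<subseteq>{0..<n}. card U \<le> k \<and> real (card (balls (g n s) (2 * l + 1) U)) > \<epsilon> / 4 * n}"
      proof (rule prob_Un_le, rule ccontr)
        fix s assume s: "s \<in> set_pmf (S n)" "\<not> good (g n s)" and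
          neg: "\<not> (\<bar>freq \<tau> A n s - pmf Q Cl\<bar> \<ge> \<epsilon> / 2 \<or>
           (\<exists>U\<subseteq>{0..<n}. card U \<le> k \<and> real (card (balls (g n s) (2 * l + 1) U)) > \<epsilon> / 4 * n))"
        define E where "E = g n s"
        have sgE: "sgraph n E" using elim(4) s(1) by (simp add: E_def)
        have "good E" unfolding good_def
        proof (intro allI impI, elim conjE)
          fix us assume us: "length us = length (rroots T)" "set us \<subseteq> {0..<n}" "riso (nbhd E l us) T"
          define B where "B = balls E (2 * l + 1) (set us)"
          have Bsub: "B \<subseteq> {0..<n}" unfolding B_def using balls_subset[OF sgE us(2)] .
          have "card (set us) \<le> k" using card_length[of us] us(1) by (simp add: k_def)
          then have cB: "real (card B) \<le> \<epsilon> / 4 * n" using neg us(2) unfolding B_def E_def by (meson not_less)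
          have eqv: "nbhd E l (us @ [v]) \<in> Cl \<longleftrightarrow> \<tau> n s v \<in> A" if v: "v < n" "v \<notin> B" for v
          proof -
            have wfN: "wf_rgraph (nbhd E l (us @ [v]))" using wf_nbhd[OF sgE] us(2) v by simp
            have "riso (nbhd E l [v]) (R' (\<tau> n s v))"
              unfolding E_def using R'[of n s v] elim(3) s(1) v by blast
            then have "riso (nbhd E l (us @ [v])) (djoin T (R' (\<tau> n s v)))"
              using riso_nbhd_djoin[OF sgE us(2) v(1) _ wfT R'wf(1) us(3)] v(2) B_def by blast
            then have eq: "iso_class (nbhd E l (us @ [v])) = cl (\<tau> n s v)"
              using iso_class_eq[OF wfN wf_djoin[OF wfT R'wf(1)]] by (simp add: cl_def)
            obtain T' where T': "wf_rgraph T'" "Cl = iso_class T'"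
              using Cl by (auto simp: Ext_def extends_def)
            show ?thesis using mem_iso_class[OF wfN T'(1)] T'(2) eq by (auto simp: A_def)
          qed
          define X where "X = {v \<in> {0..<n}. nbhd E l (us @ [v]) \<in> Cl}"
          define Y where "Y = {v \<in> {0..<n}. \<tau> n s v \<in> A}"
          have fin': "finite X" "finite Y" "finite B" using Bsub finite_subset by (auto simp: X_def Y_def)
          have "card X \<le> card (Y \<union> B)" using fin' eqv by (intro card_mono) (auto simp: X_def Y_def)
          then have XY: "card X \<le> card Y + card B" using card_Un_le[of Y B] by linarith
          have "card Y \<le> card (X \<union> B)" using fin' eqv by (intro card_mono) (auto simp: X_def Y_def)
          then have YX: "card Y \<le> card X + card B" using card_Un_le[of X B] by linarith
          have "\<bar>real (card X) - real (card Y)\<bar> \<le> \<epsilon> / 4 * n" using XY YX cB by linarith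
          then have "\<bar>real (card X) / n - real (card Y) / n\<bar> \<le> \<epsilon> / 4"
            using elim(5) by (simp add: diff_divide_distrib[symmetric] field_simps)
          moreover have "\<bar>real (card Y) / n - pmf Q Cl\<bar> < \<epsilon> / 2" using neg by (simp add: freq_def Y_def)
          ultimately show "\<bar>real (card {v \<in> {0..<n}. nbhd E l (us @ [v]) \<in> Cl}) / real n - pmf Q Cl\<bar> < \<epsilon>"
            using e unfolding X_def[symmetric] by linarith
        qed
        then show False using s(2) by (simp add: E_def)
      qed
      then have "measure_pmf.prob (S n) {s. \<not> good (g n s)} \<le> \<theta>" using elim(1,2) by linarith
      then have "measure_pmf.prob (S n) {s. good (g n s)} \<ge> 1 - \<theta>" by (subst prob_not) simp
      moreover have "measure_pmf.prob (M n) {E. good E} = measure_pmf.prob (S n) {s. good (g n s)}"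
        by (simp add: M vimage_def)
      ultimately show ?case unfolding good_def by simp
    qed
    then show ?thesis by (simp add: eventually_sequentially)
  qed
  show ?thesis
    unfolding extension_law_def
    by (rule exI[of _ "pmf Q"]) (use main has_sum_pmf[OF setQ] in \<open>auto simp: pmf_le_1\<close>)
qed

end

section \<open>Ranks\<close>

text \<open>Vertices are numbers, so a set \<open>W\<close> has a canonical labelling by increasing
  order. Induced structures are compared after this relabelling, which removes any choice of
  isomorphism from the counting.\<close>

definition rnk :: "nat set \<Rightarrow> nat \<Rightarrow> nat" where
  "rnk W v = card {w\<in>W. w < v}"

abbreviation sl :: "nat set \<Rightarrow> nat list" where
  "sl W \<equiv> sorted_list_of_set W"

lemma sl_nth_less_iff:
  assumes "i < card W" "j < card W" shows "sl W ! i < sl W ! j \<longleftrightarrow> i < j"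
proof -
  have s: "sorted_wrt (<) (sl W)" by (rule strict_sorted_list_of_set)
  have "sl W ! a < sl W ! b" if "a < b" "b < card W" for a b
    using sorted_wrt_nth_less[OF s, of a b] that by simp
  then show ?thesis using assms by (metis less_asym linorder_neqE_nat)
qed

lemma sl_nth_mem: "finite W \<Longrightarrow> i < card W \<Longrightarrow> sl W ! i \<in> W"
  by (metis length_sorted_list_of_set nth_mem set_sorted_list_of_set)

lemma rnk_nth:
  assumes "finite W" "i < card W" shows "rnk W (sl W ! i) = i"
proof -
  have "{w\<in>W. w < sl W ! i} = (!) (sl W) ` {0..<i}"
  proof safe
    fix w assume w: "w \<in> W" "w < sl W ! i"
    then obtain j where j: "j < card W" "w = sl W ! j"
      using assms(1) by (metis in_set_conv_nth length_sorted_list_of_set set_sorted_list_of_set)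
    then show "w \<in> (!) (sl W) ` {0..<i}" using w sl_nth_less_iff[OF j(1) assms(2)] by auto
  next
    fix j assume "j \<in> {0..<i}"
    then show "sl W ! j \<in> W" "sl W ! j < sl W ! i"
      using sl_nth_mem[OF assms(1)] sl_nth_less_iff[of j W i] assms by auto
  qed
  moreover have "inj_on ((!) (sl W)) {0..<i}"
    by (rule inj_on_nth) (use assms in auto)
  ultimately show ?thesis by (simp add: rnk_def card_image)
qed

lemma nth_rnk:
  assumes "finite W" "v \<in> W" shows "rnk W v < card W" "sl W ! rnk W v = v"
proof -
  obtain j where j: "j < card W" "v = sl W ! j"
    using assms by (metis in_set_conv_nth length_sorted_list_of_set set_sorted_list_of_set)
  then show "rnk W v < card W" "sl W ! rnk W v = v" using rnk_nth[OF assms(1)] by auto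
qed

lemma bij_sl: "finite W \<Longrightarrow> bij_betw ((!) (sl W)) {0..<card W} W"
  using bij_betw_nth[of "sl W" "{0..<card W}" W] by (simp add: atLeast0LessThan)

lemma riso_ranks:
  assumes sg: "sgraph n E" and v: "v < n" and W: "W = ball E l v"
    and F: "\<And>i j. i < card W \<Longrightarrow> j < card W \<Longrightarrow> {sl W ! i, sl W ! j} \<in> E \<longleftrightarrow> {i, j} \<in> F"
  shows "riso (nbhd E l [v]) \<lparr>rV = {0..<card W}, rE = F, rroots = [rnk W v]\<rparr>"
proof -
  have fW: "finite W" using finite_ball[OF sg v] W by simp
  have rV: "rV (nbhd E l [v]) = W" by (simp add: nbhd_simps balls_def W)
  have lt: "rnk W x < card W" if "x \<in> W" for x using nth_rnk[OF fW that] by simp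
  have "bij_betw (rnk W) W {0..<card W}"
    by (rule bij_betw_byWitness[where f' = "(!) (sl W)"])
      (use fW nth_rnk rnk_nth sl_nth_mem in auto)
  moreover have "{x, y} \<in> rE (nbhd E l [v]) \<longleftrightarrow> {rnk W x, rnk W y} \<in> F" if xy: "x \<in> W" "y \<in> W" for x y
  proof -
    have "{x, y} \<in> rE (nbhd E l [v]) \<longleftrightarrow> {x, y} \<in> E"
      using xy by (auto simp: nbhd_simps balls_def W)
    also have "\<dots> \<longleftrightarrow> {rnk W x, rnk W y} \<in> F"
      using F[OF lt[OF xy(1)] lt[OF xy(2)]] nth_rnk(2)[OF fW xy(1)] nth_rnk(2)[OF fW xy(2)] by simp
    finally show ?thesis .
  qed
  ultimately show ?thesis unfolding riso_def rV by (intro exI[of _ "rnk W"]) (simp add: nbhd_simps)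
qed

text \<open>Jensen's inequality, obtained from the nonnegativity of the variance of
  \<open>\<bar>f n s - x\<bar>\<close>; \<open>a\<close> is its mean.\<close>

lemma (in fin_pmfs) L1conv_of_L2:
  assumes "(\<lambda>n. pE (S n) (\<lambda>s. (f n s - x)\<^sup>2)) \<longlonglongrightarrow> 0"
  shows "L1conv S f x"
proof (rule L1conv_bound)
  show "\<forall>\<^sub>F n in sequentially. pE (S n) (\<lambda>s. \<bar>f n s - x\<bar>) \<le> sqrt (pE (S n) (\<lambda>s. (f n s - x)\<^sup>2))"
  proof (rule always_eventually, rule allI)
    fix n
    define a where "a = pE (S n) (\<lambda>s. \<bar>f n s - x\<bar>)"
    have "0 \<le> pE (S n) (\<lambda>s. (\<bar>f n s - x\<bar> - a)\<^sup>2)" by (rule pE_nonneg) simp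
    also have "\<dots> = pE (S n) (\<lambda>s. (f n s - x)\<^sup>2 + (a\<^sup>2 - 2 * a * \<bar>f n s - x\<bar>))"
      by (rule pE_cong) (simp add: power2_eq_square algebra_simps abs_mult_self_eq)
    also have "\<dots> = pE (S n) (\<lambda>s. (f n s - x)\<^sup>2) - a\<^sup>2"
      by (simp add: pE_add pE_diff fin a_def[symmetric] power2_eq_square)
    finally have "a\<^sup>2 \<le> pE (S n) (\<lambda>s. (f n s - x)\<^sup>2)" by simp
    then show "a \<le> sqrt (pE (S n) (\<lambda>s. (f n s - x)\<^sup>2))" by (rule real_le_rsqrt)
  qed
  show "(\<lambda>n. sqrt (pE (S n) (\<lambda>s. (f n s - x)\<^sup>2))) \<longlonglongrightarrow> 0" using tendsto_real_sqrt[OF assms] by simp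
qed

section \<open>Erdos-Renyi graphs\<close>

definition allE :: "nat \<Rightarrow> nat set set" where
  "allE n = {{i, j} | i j. i < j \<and> j < n}"

lemma finite_allE: "finite (allE n)"
proof -
  have "allE n \<subseteq> Pow {0..<n}" by (auto simp: allE_def)
  then show ?thesis by (rule finite_subset) simp
qed

lemma mem_allE: "{x, y} \<in> allE n \<longleftrightarrow> x < n \<and> y < n \<and> x \<noteq> y"
  by (auto simp: allE_def doubleton_eq_iff) (metis linorder_neqE_nat)

lemma sgraph_allE: "E \<subseteq> allE n \<Longrightarrow> sgraph n E"
  unfolding sgraph_def allE_def by (force simp: card_insert_if)

lemma set_er: "E \<in> set_pmf (er n p) \<Longrightarrow> E \<subseteq> allE n"
  unfolding er_def allE_def by auto

lemma finite_er: "finite (set_pmf (er n p))"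
  by (rule finite_subset[of _ "Pow (allE n)"]) (use set_er finite_allE in auto)

text \<open>Each pair of vertices is an independent coordinate: it contributes \<open>p\<close> if
  prescribed as an edge, \<open>1 - p\<close> if prescribed as a non-edge, and 1 otherwise. All
  probabilities for this model are read off from this formula.\<close>

lemma prob_er:
  assumes p: "0 \<le> p" "p \<le> 1" and AB: "A \<subseteq> allE n" "B \<subseteq> allE n" "A \<inter> B = {}"
  shows "measure_pmf.prob (er n p) {E. A \<subseteq> E \<and> B \<inter> E = {}} = p ^ card A * (1 - p) ^ card B"
proof -
  define S where "S = {(i, j). i < j \<and> j < n}"
  define e where "e = (\<lambda>(i, j). {i, j :: nat})"
  have "S \<subseteq> {0..<n} \<times> {0..<n}" by (auto simp: S_def)
  then have fS: "finite S" by (rule finite_subset) simp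
  have inj: "inj_on e S" by (auto simp: inj_on_def S_def e_def doubleton_eq_iff)
  have allS: "allE n = e ` S" by (force simp: allE_def e_def S_def)
  define A' where "A' = {x\<in>S. e x \<in> A}"
  define B' where "B' = {x\<in>S. e x \<in> B}"
  have eA: "e ` A' = A" "e ` B' = B" using AB allS by (auto simp: A'_def B'_def)
  have "inj_on e A'" "inj_on e B'" by (auto intro!: inj_on_subset[OF inj] simp: A'_def B'_def)
  then have cA: "card A' = card A" "card B' = card B" using card_image eA by metis+
  define g where "g f = {{i, j} | i j. i < j \<and> j < n \<and> f (i, j)}" for f :: "nat \<times> nat \<Rightarrow> bool"
  have g: "g f = e ` {x\<in>S. f x}" for f by (force simp: g_def e_def S_def)
  have mem: "e x \<in> g f \<longleftrightarrow> f x" if "x \<in> S" for x f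
    unfolding g using inj_on_image_mem_iff[OF inj that, of "{x\<in>S. f x}"] that by auto
  \<comment> \<open>The event becomes a product set: \<open>D x\<close> is the set of values allowed
    at the pair \<open>x\<close>.\<close>
  define D where "D x = (if x \<in> A' then {True} else if x \<in> B' then {False} else UNIV)" for x
  have ev: "(A \<subseteq> g f \<and> B \<inter> g f = {}) \<longleftrightarrow> f \<in> Pi S D" for f
  proof -
    have "A \<subseteq> g f \<longleftrightarrow> (\<forall>x\<in>A'. f x)" using mem unfolding eA(1)[symmetric] by (auto simp: A'_def)
    moreover have "B \<inter> g f = {} \<longleftrightarrow> (\<forall>x\<in>B'. \<not> f x)" using mem unfolding eA(2)[symmetric] by (auto simp: B'_def)
    moreover have "f \<in> Pi S D \<longleftrightarrow> (\<forall>x\<in>A'. f x) \<and> (\<forall>x\<in>B'. \<not> f x)"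
      using AB(3) by (auto simp: Pi_def D_def A'_def B'_def)
    ultimately show ?thesis by simp
  qed
  have "measure_pmf.prob (er n p) {E. A \<subseteq> E \<and> B \<inter> E = {}}
     = measure_pmf.prob (Pi_pmf S False (\<lambda>_. bernoulli_pmf p)) (Pi S D)"
    using ev by (simp add: er_def S_def[symmetric] g_def[symmetric] vimage_def)
  also have "\<dots> = (\<Prod>x\<in>S. measure_pmf.prob (bernoulli_pmf p) (D x))"
    by (rule measure_Pi_pmf_Pi[OF fS])
  also have "\<dots> = (\<Prod>x\<in>S. (if x \<in> A' then p else 1) * (if x \<in> B' then 1 - p else 1))"
  proof (rule prod.cong[OF refl])
    fix x assume "x \<in> S"
    have "x \<notin> A' \<or> x \<notin> B'" using AB(3) by (auto simp: A'_def B'_def)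
    then show "measure_pmf.prob (bernoulli_pmf p) (D x) = (if x \<in> A' then p else 1) * (if x \<in> B' then 1 - p else 1)"
      using p by (auto simp: D_def measure_pmf_single)
  qed
  also have "\<dots> = (\<Prod>x\<in>S. if x \<in> A' then p else 1) * (\<Prod>x\<in>S. if x \<in> B' then 1 - p else 1)"
    by (rule prod.distrib)
  also have "(\<Prod>x\<in>S. if x \<in> A' then p else 1) = p ^ card A'"
    using fS by (simp add: prod.inter_filter[symmetric] A'_def)
  also have "(\<Prod>x\<in>S. if x \<in> B' then 1 - p else 1) = (1 - p) ^ card B'"
    using fS by (simp add: prod.inter_filter[symmetric] B'_def)
  finally show ?thesis using cA by simp
qed

text \<open>The moment is dominated by the second one, which counts ordered pairs
  \<open>(y, z)\<close> of neighbours of \<open>v\<close>: the diagonal gives probability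
  \<open>p\<close>, distinct neighbours give \<open>p\<^sup>2\<close>. With \<open>p = K / n\<close>
  the bound is linear in \<open>n\<close>.\<close>

lemma er_degree_moment:
  assumes p: "0 \<le> p" "p \<le> 1"
  shows "pE (er n p) (\<lambda>E. dmom n (dg E)) \<le> n * (n * p + (n * p)\<^sup>2)"
proof -
  let ?S = "er n p"
  have fy: "{y. {v, y} \<in> E} \<subseteq> {0..<n}" if "E \<in> set_pmf ?S" for E v
    using sgraph_edge[OF sgraph_allE[OF set_er[OF that]]] by auto
  have dsum: "real (dg E v) = (\<Sum>y<n. if {v, y} \<in> E then 1 else 0)" if E: "E \<in> set_pmf ?S" for E v
  proof -
    have "{y. {v, y} \<in> E} = {y\<in>{..<n}. {v, y} \<in> E}" using fy[OF E, of v] by auto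
    then show ?thesis by (simp add: dg_def sum.inter_filter[symmetric])
  qed
  have pr: "measure_pmf.prob ?S {E. {v, y} \<in> E \<and> {v, z} \<in> E} \<le> (if y = z then p else p\<^sup>2)" if "v < n" for v y z
  proof (cases "{v, y} \<in> allE n \<and> {v, z} \<in> allE n")
    case True
    have "measure_pmf.prob ?S {E. {v, y} \<in> E \<and> {v, z} \<in> E} = p ^ card {{v, y}, {v, z}}"
      using prob_er[OF p, of "{{v, y}, {v, z}}" n "{}"] True by simp
    then show ?thesis by (auto simp: doubleton_eq_iff power2_eq_square)
  next
    case False
    then have "measure_pmf.prob ?S {E. {v, y} \<in> E \<and> {v, z} \<in> E} \<le> measure_pmf.prob ?S {E. False}"
      using set_er by (intro prob_mono_pmf) blast
    then show ?thesis using p by (auto intro: order_trans)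
  qed
  have "pE ?S (\<lambda>E. dmom n (dg E)) \<le> pE ?S (\<lambda>E. \<Sum>v<n. \<Sum>y<n. \<Sum>z<n. if {v, y} \<in> E \<and> {v, z} \<in> E then 1 else 0)"
  proof (rule pE_mono[OF finite_er])
    fix E assume E: "E \<in> set_pmf ?S"
    have le: "real d * sqrt (real d) \<le> real d * real d" for d :: nat
    proof (cases "d = 0")
      case False
      then have "sqrt (real d) \<le> real d" by (intro real_le_lsqrt) (auto simp: power2_eq_square)
      then show ?thesis by (intro mult_left_mono) auto
    qed simp
    have "dmom n (dg E) \<le> (\<Sum>v<n. real (dg E v) * real (dg E v))"
      unfolding dmom_def by (intro sum_mono le)
    also have "\<dots> = (\<Sum>v<n. \<Sum>y<n. \<Sum>z<n. if {v, y} \<in> E \<and> {v, z} \<in> E then 1 else 0)"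
      unfolding dsum[OF E] sum_product by (intro sum.cong refl) auto
    finally show "dmom n (dg E) \<le> (\<Sum>v<n. \<Sum>y<n. \<Sum>z<n. if {v, y} \<in> E \<and> {v, z} \<in> E then 1 else 0)" .
  qed
  also have "\<dots> = (\<Sum>v<n. \<Sum>y<n. \<Sum>z<n. measure_pmf.prob ?S {E. {v, y} \<in> E \<and> {v, z} \<in> E})"
    by (simp add: pE_sum finite_er pE_indicator)
  also have "\<dots> \<le> (\<Sum>v<n. \<Sum>y<n. \<Sum>z<n. (if y = z then p else 0) + p\<^sup>2)"
  proof (intro sum_mono)
    fix v y z :: nat assume v: "v \<in> {..<n}"
    have "(if y = z then p else p\<^sup>2) \<le> (if y = z then p else 0) + p\<^sup>2" by simp
    then show "measure_pmf.prob ?S {E. {v, y} \<in> E \<and> {v, z} \<in> E} \<le> (if y = z then p else 0) + p\<^sup>2"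
      using pr[of v y z] v by simp
  qed
  also have "\<dots> = n * (n * p + (n * p)\<^sup>2)"
    by (simp add: sum.distrib power2_eq_square algebra_simps)
  finally show ?thesis .
qed

section \<open>Neighbourhood types of Erdos-Renyi graphs\<close>

definition relG :: "nat set \<Rightarrow> nat set set \<Rightarrow> (nat \<times> nat) set" where
  "relG W E = {(i, j). i < j \<and> j < card W \<and> {sl W ! i, sl W ! j} \<in> E}"

definition dbl :: "(nat \<times> nat) set \<Rightarrow> nat set set" where
  "dbl F = (\<lambda>(i, j). {i, j}) ` F"

definition ertype :: "nat \<Rightarrow> nat set set \<Rightarrow> nat \<Rightarrow> nat \<times> (nat \<times> nat) set \<times> nat" where
  "ertype l E v = (let W = ball E l v in (card W, relG W E, rnk W v))"

definition ergraph :: "nat \<times> (nat \<times> nat) set \<times> nat \<Rightarrow> rgraph" where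
  "ergraph = (\<lambda>(h, F, r). \<lparr>rV = {0..<h}, rE = dbl F, rroots = [r]\<rparr>)"

definition prs :: "nat \<Rightarrow> (nat \<times> nat) set" where
  "prs h = {(i, j). i < j \<and> j < h}"

lemma finite_prs: "finite (prs h)"
  by (rule finite_subset[of _ "{0..<h} \<times> {0..<h}"]) (auto simp: prs_def)

lemma mem_dbl: "{i, j} \<in> dbl F \<longleftrightarrow> (i, j) \<in> F \<or> (j, i) \<in> F"
  by (force simp: dbl_def doubleton_eq_iff)

lemma dbl_relG:
  assumes "sgraph n E" "i < card W" "j < card W"
  shows "{sl W ! i, sl W ! j} \<in> E \<longleftrightarrow> {i, j} \<in> dbl (relG W E)"
proof -
  have "i \<noteq> j" if "{sl W ! i, sl W ! j} \<in> E" using sgraph_edge[OF assms(1) that] by auto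
  then show ?thesis unfolding mem_dbl relG_def using assms(2,3)
    by (auto simp: insert_commute elim!: linorder_neqE_nat)
qed

lemma relG_prs: "relG W E \<subseteq> prs (card W)"
  by (auto simp: relG_def prs_def)

lemma ergraph_ertype:
  assumes sg: "sgraph n E" and v: "v < n"
  shows "wf_rgraph (ergraph (ertype l E v))" "riso (nbhd E l [v]) (ergraph (ertype l E v))"
proof -
  define W where "W = ball E l v"
  have fW: "finite W" using finite_ball[OF sg v] W_def by simp
  have "v \<in> W" by (simp add: W_def)
  then have r: "rnk W v < card W" using nth_rnk[OF fW] by simp
  have "\<forall>e\<in>dbl (relG W E). e \<subseteq> {0..<card W} \<and> card e = 2"
    using relG_prs[of W E] by (auto simp: dbl_def prs_def card_insert_if)
  then show "wf_rgraph (ergraph (ertype l E v))"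
    using r by (simp add: wf_rgraph_def ergraph_def ertype_def Let_def W_def[symmetric])
  show "riso (nbhd E l [v]) (ergraph (ertype l E v))"
    using riso_ranks[OF sg v W_def dbl_relG[OF sg]]
    by (simp add: ergraph_def ertype_def Let_def W_def[symmetric])
qed

text \<open>The triples that can be types: a graph on the ranks that is its own
  \<open>l\<close>-ball around the root \<open>r\<close>, see \<open>ertype_shape\<close>.\<close>

locale er_shape =
  fixes l h :: nat and F :: "(nat \<times> nat) set" and r :: nat
  assumes r: "r < h" and F: "F \<subseteq> prs h" and conn: "ball (dbl F) l r = {0..<h}"
begin

text \<open>Ranks at distance less than \<open>l\<close> from the root. Their edges must all stay
  inside the set, whereas a vertex at distance exactly \<open>l\<close> may have any neighbours
  outside.\<close>

definition "I = {i. \<exists>j<l. i \<in> ball (dbl F) j r}"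

lemma I_sub: "I \<subseteq> {0..<h}"
proof
  fix i assume "i \<in> I"
  then obtain j where "j < l" "i \<in> ball (dbl F) j r" by (auto simp: I_def)
  then have "i \<in> ball (dbl F) l r" using ball_mono[of j l "dbl F" r] by auto
  then show "i \<in> {0..<h}" using conn by simp
qed

definition occ :: "nat \<Rightarrow> nat set set \<Rightarrow> nat set \<Rightarrow> bool" where
  "occ n E W \<longleftrightarrow> W \<subseteq> {0..<n} \<and> card W = h \<and> relG W E = F
      \<and> (\<forall>i\<in>I. \<forall>y. {sl W ! i, y} \<in> E \<longrightarrow> y \<in> W)"

lemma dblF: "{i, j} \<in> dbl F \<Longrightarrow> i < h \<and> j < h"
  using F by (auto simp: mem_dbl prs_def)

lemma occ_ball:
  assumes sg: "sgraph n E" and o: "occ n E W"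
  shows "ball E l (sl W ! r) = W"
proof -
  have fW: "finite W" and len: "card W = h" using o finite_subset by (auto simp: occ_def)
  have "ball E l (sl W ! r) = set (sl W) \<longleftrightarrow> ball (dbl F) l r = {0..<length (sl W)}
      \<and> (\<forall>j<l. \<forall>i\<in>ball (dbl F) j r. \<forall>y. {sl W ! i, y} \<in> E \<longrightarrow> y \<in> set (sl W))"
    by (rule ball_transfer) (use dbl_relG[OF sg] o r dblF len in \<open>auto simp: occ_def\<close>)
  then show ?thesis using o fW conn by (auto simp: occ_def I_def)
qed

lemma type_occ:
  assumes sg: "sgraph n E" and v: "v < n" and t: "ertype l E v = (h, F, r)"
  shows "occ n E (ball E l v)" "sl (ball E l v) ! r = v"
proof -
  define W where "W = ball E l v"
  have fW: "finite W" using finite_ball[OF sg v] W_def by simp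
  have t': "card W = h" "relG W E = F" "rnk W v = r" using t by (auto simp: ertype_def Let_def W_def)
  have vW: "v \<in> W" by (simp add: W_def)
  show v': "sl (ball E l v) ! r = v" using nth_rnk[OF fW vW] t' by (simp add: W_def)
  have "ball E l (sl W ! r) = set (sl W) \<longleftrightarrow> ball (dbl F) l r = {0..<length (sl W)}
      \<and> (\<forall>j<l. \<forall>i\<in>ball (dbl F) j r. \<forall>y. {sl W ! i, y} \<in> E \<longrightarrow> y \<in> set (sl W))"
    by (rule ball_transfer) (use dbl_relG[OF sg] t' r dblF in auto)
  moreover have "ball E l (sl W ! r) = set (sl W)" using v' fW by (simp add: W_def)
  ultimately have "\<forall>i\<in>I. \<forall>y. {sl W ! i, y} \<in> E \<longrightarrow> y \<in> W" using fW by (auto simp: I_def)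
  then show "occ n E (ball E l v)"
    using t' ball_subset[OF sg v, of l] by (auto simp: occ_def W_def)
qed

text \<open>A vertex of this type determines the set, namely its ball, and the set determines the
  vertex as its member of rank \<open>r\<close>. So the frequency becomes a sum of indicators over
  \<open>h\<close>-element sets, each a matter of prescribed edges and non-edges.\<close>

lemma card_type:
  assumes sg: "sgraph n E"
  shows "card {v\<in>{0..<n}. ertype l E v = (h, F, r)} = card {W. occ n E W}"
proof (rule bij_betw_same_card[of "ball E l"], rule bij_betw_byWitness[where f' = "\<lambda>W. sl W ! r"])
  show "\<forall>v\<in>{v \<in> {0..<n}. ertype l E v = (h, F, r)}. sl (ball E l v) ! r = v"
    using type_occ[OF sg] by auto
  show "\<forall>W\<in>{W. occ n E W}. ball E l (sl W ! r) = W" using occ_ball[OF sg] by auto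
  show "ball E l ` {v \<in> {0..<n}. ertype l E v = (h, F, r)} \<subseteq> {W. occ n E W}"
    using type_occ[OF sg] by auto
  show "(\<lambda>W. sl W ! r) ` {W. occ n E W} \<subseteq> {v \<in> {0..<n}. ertype l E v = (h, F, r)}"
  proof
    fix v assume "v \<in> (\<lambda>W. sl W ! r) ` {W. occ n E W}"
    then obtain W where W: "occ n E W" "v = sl W ! r" by auto
    have fW: "finite W" and c: "card W = h" "relG W E = F" "W \<subseteq> {0..<n}"
      using W(1) finite_subset by (auto simp: occ_def)
    have "v \<in> W" using sl_nth_mem[OF fW] W r c by simp
    then show "v \<in> {v \<in> {0..<n}. ertype l E v = (h, F, r)}"
      using occ_ball[OF sg W(1)] W(2) c rnk_nth[OF fW] r by (auto simp: ertype_def Let_def)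
  qed
qed

text \<open>\<open>inn\<close> collects pairs inside \<open>W\<close>, given by ranks, and
  \<open>out\<close> pairs from interior vertices to \<open>Y\<close>. In the exponents below,
  \<open>e\<close> counts prescribed edges, \<open>b\<close> prescribed non-edges inside
  \<open>W\<close>, and \<open>s\<close> interior vertices, each with \<open>n - h\<close> non-edges
  to the outside.\<close>

definition "inn W X = (\<lambda>(i, j). {sl W ! i, sl W ! j}) ` X" for X :: "(nat \<times> nat) set"
definition "out W Y = (\<lambda>(i, y). {sl W ! i, y}) ` (I \<times> Y)" for Y :: "nat set"
abbreviation "b \<equiv> card (prs h - F)"
abbreviation "s \<equiv> card I"
abbreviation "e \<equiv> card F"

text \<open>Ranks preserve the order, so an unordered pair of vertices reveals which end has the
  smaller rank.\<close>

lemma inj_inn: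
  assumes W: "finite W" "card W = h"
  shows "inj_on (\<lambda>(i, j). {sl W ! i, sl W ! j}) (prs h)"
proof (rule inj_onI, clarify)
  fix i j i' j' assume p: "(i, j) \<in> prs h" "(i', j') \<in> prs h"
    and eq: "{sl W ! i, sl W ! j} = {sl W ! i', sl W ! j'}"
  have lt: "i < j" "j < card W" "i' < j'" "j' < card W" using p W by (auto simp: prs_def)
  then have "sl W ! i < sl W ! j" "sl W ! i' < sl W ! j'" using sl_nth_less_iff[of _ W] by auto
  then have "sl W ! i = sl W ! i'" "sl W ! j = sl W ! j'" using eq by (auto simp: doubleton_eq_iff)
  then have "rnk W (sl W ! i) = rnk W (sl W ! i')" "rnk W (sl W ! j) = rnk W (sl W ! j')" by auto
  then show "i = i' \<and> j = j'" using rnk_nth[OF W(1)] lt by auto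
qed

lemma card_inn: "finite W \<Longrightarrow> card W = h \<Longrightarrow> X \<subseteq> prs h \<Longrightarrow> card (inn W X) = card X"
  unfolding inn_def by (intro card_image inj_on_subset[OF inj_inn])

lemma inn_sub: "finite W \<Longrightarrow> card W = h \<Longrightarrow> X \<subseteq> prs h \<Longrightarrow> u \<in> inn W X \<Longrightarrow> u \<subseteq> W"
  unfolding inn_def prs_def using sl_nth_mem by fastforce

lemma inn_disj: "finite W \<Longrightarrow> card W = h \<Longrightarrow> inn W F \<inter> inn W (prs h - F) = {}"
  unfolding inn_def using inj_on_image_Int[OF inj_inn, of W F "prs h - F"] F by (simp add: Int_Diff)

lemma inn_allE:
  assumes "W \<subseteq> {0..<n}" "card W = h" "X \<subseteq> prs h" shows "inn W X \<subseteq> allE n"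
proof
  fix u assume "u \<in> inn W X"
  then obtain i j where u: "(i, j) \<in> X" "u = {sl W ! i, sl W ! j}" by (auto simp: inn_def)
  have fW: "finite W" using assms finite_subset by blast
  have lt: "i < j" "j < card W" using u assms by (auto simp: prs_def)
  then have "sl W ! i < sl W ! j" "sl W ! j \<in> W"
    using sl_nth_less_iff[of i W j] sl_nth_mem[OF fW] by auto
  then show "u \<in> allE n" using assms(1) u(2) by (auto simp: mem_allE)
qed

lemma out_elem:
  assumes "finite W" "card W = h" "u \<in> out W Y"
  obtains x y where "x \<in> W" "y \<in> Y" "u = {x, y}"
proof -
  obtain i y where "i \<in> I" "y \<in> Y" "u = {sl W ! i, y}" using assms by (auto simp: out_def)
  then show ?thesis using that[of "sl W ! i" y] sl_nth_mem[OF assms(1), of i] I_sub assms(2) by auto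
qed

lemma card_out:
  assumes "finite W" "card W = h" "Y \<inter> W = {}"
  shows "card (out W Y) = s * card Y"
proof -
  have "inj_on (\<lambda>(i, y). {sl W ! i, y}) (I \<times> Y)"
  proof (rule inj_onI, clarify)
    fix i y i' y' assume a: "i \<in> I" "y \<in> Y" "i' \<in> I" "y' \<in> Y" "{sl W ! i, y} = {sl W ! i', y'}"
    have lt: "i < card W" "i' < card W" using a I_sub assms by auto
    then have "sl W ! i \<in> W" "sl W ! i' \<in> W" using sl_nth_mem[OF assms(1)] by auto
    then have "sl W ! i = sl W ! i'" "y = y'" using a assms(3) by (auto simp: doubleton_eq_iff)
    then have "rnk W (sl W ! i) = rnk W (sl W ! i')" by simp
    then show "i = i' \<and> y = y'" using rnk_nth[OF assms(1)] lt \<open>y = y'\<close> by simp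
  qed
  then show ?thesis unfolding out_def by (simp add: card_image card_cartesian_product)
qed

lemma out_allE:
  assumes "W \<subseteq> {0..<n}" "card W = h" "Y \<inter> W = {}" "Y \<subseteq> {0..<n}" shows "out W Y \<subseteq> allE n"
proof
  fix u assume "u \<in> out W Y"
  moreover have fW: "finite W" using assms finite_subset by blast
  ultimately obtain x y where "x \<in> W" "y \<in> Y" "u = {x, y}" using out_elem[OF fW assms(2)] by metis
  then show "u \<in> allE n" using assms by (auto simp: mem_allE)
qed

lemma out_inn_disj:
  assumes "finite W" "card W = h" "X \<subseteq> prs h" "Y \<inter> W = {}" "finite W'" "card W' = h"
  shows "out W' Y \<inter> inn W X = {}"
proof -
  have False if u: "u \<in> out W' Y" "u \<in> inn W X" for u
  proof -
    obtain x y where "x \<in> W'" "y \<in> Y" "u = {x, y}" using out_elem[OF assms(5,6) u(1)] by metis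
    moreover have "u \<subseteq> W" using inn_sub[OF assms(1-3) u(2)] .
    ultimately show False using assms(4) by auto
  qed
  then show ?thesis by blast
qed

lemma occ_iff:
  assumes E: "E \<subseteq> allE n"
  shows "occ n E W \<longleftrightarrow> W \<subseteq> {0..<n} \<and> card W = h \<and> inn W F \<subseteq> E
    \<and> (inn W (prs h - F) \<union> out W ({0..<n} - W)) \<inter> E = {}"
proof -
  have "(relG W E = F \<and> (\<forall>i\<in>I. \<forall>y. {sl W ! i, y} \<in> E \<longrightarrow> y \<in> W)) \<longleftrightarrow>
    inn W F \<subseteq> E \<and> (inn W (prs h - F) \<union> out W ({0..<n} - W)) \<inter> E = {}"
    if W: "W \<subseteq> {0..<n}" "card W = h"
  proof -
    have 1: "relG W E = F \<longleftrightarrow> inn W F \<subseteq> E \<and> inn W (prs h - F) \<inter> E = {}"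
    proof -
      have "relG W E = {x\<in>prs h. (\<lambda>(i, j). {sl W ! i, sl W ! j}) x \<in> E}"
        using W by (auto simp: relG_def prs_def)
      then show ?thesis using F unfolding inn_def by blast
    qed
    have 2: "(\<forall>i\<in>I. \<forall>y. {sl W ! i, y} \<in> E \<longrightarrow> y \<in> W) \<longleftrightarrow> out W ({0..<n} - W) \<inter> E = {}"
    proof -
      have "y < n" if "{x, y} \<in> E" for x y using E mem_allE that by blast
      then show ?thesis by (force simp: out_def)
    qed
    show ?thesis using 1 2 by blast
  qed
  then show ?thesis unfolding occ_def by blast
qed

lemma prob_occ:
  assumes p: "0 \<le> p" "p \<le> 1" and W: "W \<subseteq> {0..<n}" "card W = h"
  shows "measure_pmf.prob (er n p) {E. occ n E W} = p ^ e * (1 - p) ^ (b + s * (n - h))"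
proof -
  have fW: "finite W" using W finite_subset by blast
  let ?B = "inn W (prs h - F)" and ?O = "out W ({0..<n} - W)"
  have "measure_pmf.prob (er n p) {E. occ n E W} = measure_pmf.prob (er n p) {E. inn W F \<subseteq> E \<and> (?B \<union> ?O) \<inter> E = {}}"
    by (rule measure_pmf.finite_measure_eq_AE) (use W occ_iff[OF set_er] in \<open>auto simp: AE_measure_pmf_iff\<close>)
  also have "\<dots> = p ^ card (inn W F) * (1 - p) ^ card (?B \<union> ?O)"
  proof (rule prob_er[OF p])
    show "inn W F \<subseteq> allE n" by (rule inn_allE[OF W F])
    show "?B \<union> ?O \<subseteq> allE n" using inn_allE[OF W, of "prs h - F"] out_allE[OF W, of "{0..<n} - W"] by auto
    show "inn W F \<inter> (?B \<union> ?O) = {}"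
      using inn_disj[OF fW W(2)] out_inn_disj[OF fW W(2) F _ fW W(2), of "{0..<n} - W"] by blast
  qed
  also have "card (?B \<union> ?O) = b + s * (n - h)"
  proof -
    have "card (?B \<union> ?O) = card ?B + card ?O"
    proof (rule card_Un_disjoint)
      show "finite ?B" using finite_prs by (simp add: inn_def)
      show "finite ?O" using I_sub finite_subset by (auto simp: out_def intro!: finite_imageI finite_cartesian_product)
      show "?B \<inter> ?O = {}" using out_inn_disj[OF fW W(2) _ _ fW W(2), of "prs h - F" "{0..<n} - W"] by blast
    qed
    moreover have "({0..<n} - W) \<inter> W = {}" by auto
    moreover have "card ({0..<n} - W) = n - h" using W fW by (subst card_Diff_subset) auto
    ultimately show ?thesis using card_inn[OF fW W(2), of "prs h - F"] card_out[OF fW W(2), of "{0..<n} - W"]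
      by simp
  qed
  also have "card (inn W F) = e" by (rule card_inn[OF fW W(2) F])
  finally show ?thesis .
qed

text \<open>For the second set only pairs ending outside \<open>W \<union> W'\<close> are demanded
  to be non-edges. The prescribed families are then disjoint and their sizes add; an upper bound is
  all that the second moment needs.\<close>

lemma prob_occ2:
  assumes p: "0 \<le> p" "p \<le> 1" and W: "W \<subseteq> {0..<n}" "card W = h" and W': "W' \<subseteq> {0..<n}" "card W' = h"
    and d: "W \<inter> W' = {}"
  shows "measure_pmf.prob (er n p) {E. occ n E W \<and> occ n E W'}
     \<le> p ^ (2 * e) * (1 - p) ^ (2 * b + s * (n - h) + s * (n - 2 * h))"
proof -
  have fW: "finite W" "finite W'" using W W' finite_subset by auto
  let ?B = "inn W (prs h - F)" and ?O = "out W ({0..<n} - W)"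
  let ?B' = "inn W' (prs h - F)" and ?O' = "out W' ({0..<n} - (W \<union> W'))"
  have sub: "?O' \<subseteq> out W' ({0..<n} - W')" by (auto simp: out_def)
  have fin: "finite ?B" "finite ?B'" "finite ?O" "finite ?O'"
    using finite_prs I_sub finite_subset by (auto simp: inn_def out_def intro!: finite_imageI finite_cartesian_product)
  have ne: "{} \<notin> inn W' X" for X by (auto simp: inn_def)
  have ii: "inn W X \<inter> inn W' X' = {}" if "X \<subseteq> prs h" "X' \<subseteq> prs h" for X X'
  proof -
    have False if u: "u \<in> inn W X" "u \<in> inn W' X'" for u
    proof -
      have "u \<subseteq> W \<inter> W'"
        using inn_sub[OF fW(1) W(2) \<open>X \<subseteq> prs h\<close> u(1)] inn_sub[OF fW(2) W'(2) \<open>X' \<subseteq> prs h\<close> u(2)] by simp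
      then show False using d u(2) ne[of X'] by auto
    qed
    then show ?thesis by blast
  qed
  have D: "prs h - F \<subseteq> prs h" by auto
  have o1: "?O \<inter> inn W X = {}" if "X \<subseteq> prs h" for X
    by (rule out_inn_disj[OF fW(1) W(2) that _ fW(1) W(2)]) auto
  have o2: "?O' \<inter> inn W' X = {}" if "X \<subseteq> prs h" for X
    by (rule out_inn_disj[OF fW(2) W'(2) that _ fW(2) W'(2)]) auto
  have o3: "?O' \<inter> inn W X = {}" if "X \<subseteq> prs h" for X
    by (rule out_inn_disj[OF fW(1) W(2) that _ fW(2) W'(2)]) auto
  have o4: "?O \<inter> inn W' X = {}" if X: "X \<subseteq> prs h" for X
  proof -
    have False if u: "u \<in> ?O" "u \<in> inn W' X" for u
    proof -
      obtain x y where "x \<in> W" "u = {x, y}" using out_elem[OF fW(1) W(2) u(1)] by metis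
      then show False using inn_sub[OF fW(2) W'(2) X u(2)] d by auto
    qed
    then show ?thesis by blast
  qed
  have o5: "?O \<inter> ?O' = {}"
  proof -
    have False if u: "u \<in> ?O" "u \<in> ?O'" for u
    proof -
      obtain x y where xy: "x \<in> W" "u = {x, y}" using out_elem[OF fW(1) W(2) u(1)] by metis
      obtain x' y' where "x' \<in> W'" "y' \<in> {0..<n} - (W \<union> W')" "u = {x', y'}"
        using out_elem[OF fW(2) W'(2) u(2)] by metis
      then show False using xy d by (auto simp: doubleton_eq_iff)
    qed
    then show ?thesis by blast
  qed
  have "measure_pmf.prob (er n p) {E. occ n E W \<and> occ n E W'}
     \<le> measure_pmf.prob (er n p) {E. inn W F \<union> inn W' F \<subseteq> E \<and> ((?B \<union> ?B') \<union> (?O \<union> ?O')) \<inter> E = {}}"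
  proof (rule prob_mono_pmf)
    fix E assume "E \<in> set_pmf (er n p)" "occ n E W \<and> occ n E W'"
    then show "inn W F \<union> inn W' F \<subseteq> E \<and> ((?B \<union> ?B') \<union> (?O \<union> ?O')) \<inter> E = {}"
      using sub occ_iff[OF set_er] by blast
  qed
  also have "\<dots> = p ^ card (inn W F \<union> inn W' F) * (1 - p) ^ card ((?B \<union> ?B') \<union> (?O \<union> ?O'))"
  proof (rule prob_er[OF p])
    show "inn W F \<union> inn W' F \<subseteq> allE n" using inn_allE[OF W F] inn_allE[OF W' F] by simp
    show "(?B \<union> ?B') \<union> (?O \<union> ?O') \<subseteq> allE n"
      using inn_allE[OF W D] inn_allE[OF W' D] out_allE[OF W, of "{0..<n} - W"]
        out_allE[OF W', of "{0..<n} - (W \<union> W')"] by auto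
    show "(inn W F \<union> inn W' F) \<inter> ((?B \<union> ?B') \<union> (?O \<union> ?O')) = {}"
      using inn_disj[OF fW(1) W(2)] inn_disj[OF fW(2) W'(2)] ii[OF F D] ii[OF D F] o1[OF F] o2[OF F] o3[OF F] o4[OF F]
      by blast
  qed
  also have "card ((?B \<union> ?B') \<union> (?O \<union> ?O')) = (card ?B + card ?B') + (card ?O + card ?O')"
  proof -
    have "card ((?B \<union> ?B') \<union> (?O \<union> ?O')) = card (?B \<union> ?B') + card (?O \<union> ?O')"
      by (rule card_Un_disjoint) (use fin o1[OF D] o2[OF D] o3[OF D] o4[OF D] in auto)
    then show ?thesis using card_Un_disjoint[OF fin(1,2) ii[OF D D]] card_Un_disjoint[OF fin(3,4) o5] by simp
  qed
  also have "\<dots> = 2 * b + s * (n - h) + s * (n - 2 * h)"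
  proof -
    have "card (W \<union> W') = 2 * h" using card_Un_disjoint[OF fW d] W W' by simp
    then have "card ({0..<n} - (W \<union> W')) = n - 2 * h" using W W' fW by (subst card_Diff_subset) auto
    moreover have "card ({0..<n} - W) = n - h" using W fW by (subst card_Diff_subset) auto
    moreover have "({0..<n} - W) \<inter> W = {}" "({0..<n} - (W \<union> W')) \<inter> W' = {}" by auto
    ultimately show ?thesis
      using card_inn[OF fW(1) W(2) D] card_inn[OF fW(2) W'(2) D]
        card_out[OF fW(1) W(2), of "{0..<n} - W"] card_out[OF fW(2) W'(2), of "{0..<n} - (W \<union> W')"] by simp
  qed
  also have "card (inn W F \<union> inn W' F) = 2 * e"
  proof -
    have "finite F" using F finite_prs finite_subset by blast
    then have "finite (inn W F)" "finite (inn W' F)" by (auto simp: inn_def)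
    then show ?thesis using card_Un_disjoint[OF _ _ ii[OF F F]] card_inn[OF fW(1) W(2) F] card_inn[OF fW(2) W'(2) F] by simp
  qed
  finally show ?thesis .
qed

end

lemma card_ball_le:
  assumes sg: "sgraph n E" and v: "v < n" and d: "\<And>w. w \<in> ball E l v \<Longrightarrow> dg E w \<le> D"
  shows "card (ball E l v) \<le> (D + 1) ^ l"
  using d
proof (induction l)
  case (Suc l)
  let ?B = "ball E l v"
  have B: "?B \<subseteq> {0..<n}" by (rule ball_subset[OF sg v])
  have dB: "dg E w \<le> D" if "w \<in> ?B" for w using Suc.prems[of w] that by simp
  have fin1: "finite {y. {w, y} \<in> E}" for w
    by (rule finite_subset[of _ "{0..<n}"]) (auto dest: sgraph_edge[OF sg])
  have "card (ball E (Suc l) v) \<le> card (\<Union>w\<in>?B. insert w {y. {w, y} \<in> E})"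
    using fin1 finite_subset[OF B] by (intro card_mono) auto
  also have "\<dots> \<le> (\<Sum>w\<in>?B. card (insert w {y. {w, y} \<in> E}))"
    by (rule card_UN_le) (use finite_subset[OF B] in simp)
  also have "\<dots> \<le> (\<Sum>w\<in>?B. D + 1)"
  proof (rule sum_mono)
    fix w assume "w \<in> ?B"
    then have "card {y. {w, y} \<in> E} \<le> D" using dB by (simp add: dg_def)
    then show "card (insert w {y. {w, y} \<in> E}) \<le> D + 1"
      using card_insert_le_m1[of "Suc D" "{y. {w, y} \<in> E}" w] by simp
  qed
  also have "\<dots> = card ?B * (D + 1)" by simp
  also have "\<dots> \<le> (D + 1) ^ l * (D + 1)" using Suc.IH[OF dB] by (rule mult_le_mono1)
  finally show ?case by (simp add: mult.commute)
qed simp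

text \<open>With probability close to 1 all balls around single vertices have at most a small
  fraction of \<open>n\<close> vertices; in the remaining case each has at most \<open>n\<close>.
  The lemma controls the overlapping pairs in the second moment.\<close>

lemma (in graph_seq) sum_balls_small:
  "(\<lambda>n. pE (S n) (\<lambda>s. \<Sum>v<n. real (card (ball (g n s) l v))) / (real n)\<^sup>2) \<longlonglongrightarrow> 0"
proof (rule metric_LIMSEQ_I)
  fix r :: real assume r: "r > 0"
  have ev: "\<forall>\<^sub>F n in sequentially. measure_pmf.prob (S n)
    {s. \<exists>U\<subseteq>{0..<n}. card U \<le> 1 \<and> real (card (balls (g n s) l U)) > r / 4 * n} \<le> r / 4"
    using balls_small[of "r / 4" "r / 4" 1 l] r by simp
  have "\<forall>\<^sub>F n in sequentially. dist (pE (S n) (\<lambda>s. \<Sum>v<n. real (card (ball (g n s) l v))) / (real n)\<^sup>2) 0 < r"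
    using ev sg eventually_gt_at_top[of 0]
  proof eventually_elim
    case (elim n)
    let ?big = "\<lambda>s. \<exists>U\<subseteq>{0..<n}. card U \<le> 1 \<and> real (card (balls (g n s) l U)) > r / 4 * n"
    have "pE (S n) (\<lambda>s. \<Sum>v<n. real (card (ball (g n s) l v)))
      \<le> pE (S n) (\<lambda>s. (real n)\<^sup>2 * (r / 4 + (if ?big s then 1 else 0)))"
    proof (rule pE_mono[OF fin])
      fix s assume s: "s \<in> set_pmf (S n)"
      have sgs: "sgraph n (g n s)" using elim(2) s by simp
      have "(\<Sum>v<n. real (card (ball (g n s) l v))) \<le> (\<Sum>v<n. real n * (r / 4 + (if ?big s then 1 else 0)))"
      proof (rule sum_mono)
        fix v assume v: "v \<in> {..<n}"
        have "card (ball (g n s) l v) \<le> card {0..<n}"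
          by (intro card_mono ball_subset[OF sgs]) (use v in auto)
        then have le: "real (card (ball (g n s) l v)) \<le> n" by simp
        show "real (card (ball (g n s) l v)) \<le> real n * (r / 4 + (if ?big s then 1 else 0))"
        proof (cases "?big s")
          case True
          have "real n * 1 \<le> real n * (r / 4 + 1)" by (intro mult_left_mono) (use r in auto)
          then show ?thesis using True le by simp
        next
          case False
          moreover have "{v} \<subseteq> {0..<n}" "card {v} \<le> 1" using v by auto
          ultimately have "\<not> real (card (balls (g n s) l {v})) > r / 4 * n" by metis
          then show ?thesis using False by (simp add: balls_def algebra_simps)
        qed
      qed
      then show "(\<Sum>v<n. real (card (ball (g n s) l v))) \<le> (real n)\<^sup>2 * (r / 4 + (if ?big s then 1 else 0))"
        by (simp add: power2_eq_square algebra_simps)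
    qed
    also have "\<dots> = (real n)\<^sup>2 * (r / 4 + measure_pmf.prob (S n) {s. ?big s})"
      by (simp add: pE_add fin pE_indicator)
    also have "\<dots> \<le> (real n)\<^sup>2 * (r / 4 + r / 4)" using elim(1) by (intro mult_left_mono add_left_mono) auto
    finally have "pE (S n) (\<lambda>s. \<Sum>v<n. real (card (ball (g n s) l v))) / (real n)\<^sup>2 \<le> r / 2"
      using elim(3) by (simp add: field_simps)
    moreover have "0 \<le> pE (S n) (\<lambda>s. \<Sum>v<n. real (card (ball (g n s) l v))) / (real n)\<^sup>2"
      by (intro divide_nonneg_nonneg pE_nonneg sum_nonneg) auto
    ultimately show ?case using r by (simp only: dist_real_def)
  qed
  then show "\<exists>no. \<forall>n\<ge>no. dist (pE (S n) (\<lambda>s. \<Sum>v<n. real (card (ball (g n s) l v))) / (real n)\<^sup>2) 0 < r"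
    by (simp add: eventually_sequentially)
qed

lemma er_graph_seq:
  assumes K: "K > 0"
  shows "graph_seq (\<lambda>n. er n (K / real n)) (\<lambda>n s. s) (\<lambda>n s. dg s) (K + K\<^sup>2)"
proof (standard, goal_cases)
  case 1 show ?case by (rule finite_er)
next
  case 2 show ?case using sgraph_allE[OF set_er] by (auto intro: always_eventually)
next
  case 3 show ?case by simp
next
  case 4 show ?case
    using eventually_ge_at_top[of "nat \<lceil>K\<rceil>"] eventually_gt_at_top[of 0]
  proof eventually_elim
    case (elim n)
    then have "K \<le> n" by linarith
    then have "0 \<le> K / n" "K / n \<le> 1" using K elim by auto
    from er_degree_moment[OF this, of n] show ?case using elim by (simp add: algebra_simps)
  qed
qed

lemma ertype_shape:
  assumes sg: "sgraph n E" and v: "v < n" and t: "ertype l E v = (h, F, r)"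
  shows "er_shape l h F r"
proof -
  define W where "W = ball E l v"
  have fW: "finite W" using finite_ball[OF sg v] W_def by simp
  have t': "card W = h" "relG W E = F" "rnk W v = r" using t by (auto simp: ertype_def Let_def W_def)
  have vW: "v \<in> W" by (simp add: W_def)
  have F: "F \<subseteq> prs h" using relG_prs[of W E] t' by simp
  have "ball E l (sl W ! r) = set (sl W) \<longleftrightarrow> ball (dbl F) l r = {0..<length (sl W)}
      \<and> (\<forall>j<l. \<forall>i\<in>ball (dbl F) j r. \<forall>y. {sl W ! i, y} \<in> E \<longrightarrow> y \<in> set (sl W))"
    by (rule ball_transfer) (use dbl_relG[OF sg] t' nth_rnk(1)[OF fW vW] F in \<open>auto simp: mem_dbl prs_def\<close>)
  moreover have "ball E l (sl W ! r) = set (sl W)" using nth_rnk[OF fW vW] t' fW by (simp add: W_def)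
  ultimately show ?thesis using t' nth_rnk(1)[OF fW vW] F by unfold_locales auto
qed

section \<open>Asymptotics of the first and second moments\<close>

lemma binomial_power_limit: "(\<lambda>n. real (n choose h) / real n ^ h) \<longlonglongrightarrow> 1 / fact h"
proof -
  have "(\<lambda>n. (\<Prod>i<h. (1 - real i / real n) / real (h - i))) \<longlonglongrightarrow> (\<Prod>i<h. (1 - 0) / real (h - i))"
    by (intro tendsto_prod tendsto_divide tendsto_diff tendsto_const lim_const_over_n) auto
  moreover have "(\<Prod>i<h. (1 - 0) / real (h - i)) = 1 / fact h"
  proof -
    have "fact h = (\<Prod>i<h. real (h - i))" by (simp add: fact_prod_rev atLeast0LessThan)
    then show ?thesis by (simp add: prod_dividef)
  qed
  moreover have "\<forall>\<^sub>F n in sequentially. (\<Prod>i<h. (1 - real i / real n) / real (h - i)) = real (n choose h) / real n ^ h"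
    using eventually_ge_at_top[of h] eventually_gt_at_top[of 0]
  proof eventually_elim
    case (elim n)
    have "real (n choose h) / real n ^ h = (\<Prod>i<h. real (n - i) / real (h - i)) / (\<Prod>i<h. real n)"
      using binomial_altdef_of_nat[OF elim(1), where 'a = real] by (simp add: atLeast0LessThan)
    also have "\<dots> = (\<Prod>i<h. (real (n - i) / real (h - i)) / real n)" by (rule prod_dividef[symmetric])
    also have "\<dots> = (\<Prod>i<h. (1 - real i / real n) / real (h - i))"
      by (rule prod.cong) (use elim in \<open>auto simp: field_simps of_nat_diff\<close>)
    finally show ?case by simp
  qed
  ultimately show ?thesis using Lim_transform_eventually by force
qed

context er_shape
begin

definition "G K n = real (n choose h) * ((K / n) ^ e * (1 - K / n) ^ (b + s * (n - h)))" for K :: real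

text \<open>Each of the \<open>s\<close> interior vertices has about \<open>n\<close> non-edges,
  giving \<open>exp (- K)\<close>; the \<open>b\<close> inner pairs and the correction by
  \<open>s * h\<close> pairs contribute factors tending to 1.\<close>

lemma nonedge_limit:
  assumes K: "K > 0" shows "(\<lambda>n. (1 - K / real n) ^ (b + s * (n - h))) \<longlonglongrightarrow> exp (- K) ^ s"
proof -
  have l1: "(\<lambda>n. 1 - K / real n) \<longlonglongrightarrow> 1 - 0" by (intro tendsto_diff tendsto_const lim_const_over_n)
  have l2: "(\<lambda>n. (1 - K / real n) ^ n) \<longlonglongrightarrow> exp (- K)"
    using tendsto_exp_limit_sequentially[of "- K"] by simp
  have "(\<lambda>n. (1 - K / real n) ^ b * ((1 - K / real n) ^ n) ^ s / (1 - K / real n) ^ (s * h))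
    \<longlonglongrightarrow> (1 - 0) ^ b * exp (- K) ^ s / (1 - 0) ^ (s * h)"
    by (intro tendsto_intros l1 l2) auto
  moreover have "\<forall>\<^sub>F n in sequentially. (1 - K / real n) ^ b * ((1 - K / real n) ^ n) ^ s / (1 - K / real n) ^ (s * h)
     = (1 - K / real n) ^ (b + s * (n - h))"
    using eventually_ge_at_top[of h] eventually_gt_at_top[of "nat \<lceil>K\<rceil>"]
  proof eventually_elim
    case (elim n)
    then have "K < n" by linarith
    then have nz: "1 - K / n \<noteq> 0" using K by auto
    have ex: "b + s * (n - h) + s * h = b + s * n" using elim(1)
      by (metis add.assoc distrib_left le_add_diff_inverse2)
    then have "(1 - K / real n) ^ (b + s * (n - h)) * (1 - K / real n) ^ (s * h)
       = (1 - K / real n) ^ b * ((1 - K / real n) ^ n) ^ s"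
      by (simp only: power_add[symmetric] power_mult[symmetric] ex mult.commute[of n s])
    then show ?case by (simp only: nonzero_divide_eq_eq[OF power_not_zero[OF nz]])
  qed
  ultimately show ?thesis using Lim_transform_eventually by force
qed

text \<open>\<open>G K n / n\<close> is a sequence with positive limit times \<open>n\<close> to the
  power \<open>h - 1 - e\<close>. A power that is not positive gives convergence. A positive power
  contradicts \<open>bd\<close>, which expresses that at most \<open>n\<close> vertices share a
  type; this replaces a count of the edges of a connected graph.\<close>

lemma G_limit:
  assumes K: "K > 0" and bd: "\<forall>\<^sub>F n in sequentially. G K n / n \<le> 1"
  obtains x where "(\<lambda>n. G K n / n) \<longlonglongrightarrow> x"
proof -
  let ?a = "\<lambda>n. (real (n choose h) / real n ^ h) * K ^ e * (1 - K / real n) ^ (b + s * (n - h))"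
  have a: "?a \<longlonglongrightarrow> 1 / fact h * K ^ e * exp (- K) ^ s"
    by (intro tendsto_mult binomial_power_limit tendsto_const nonedge_limit[OF K])
  have G: "G K n / n = ?a n * (real n ^ h / real n ^ Suc e)" if "n > 0" for n
    using that by (simp add: G_def power_divide field_simps)
  show ?thesis
  proof (cases "h \<le> Suc e")
    case True
    have aux: "x / (x * y) = inverse y" if "x \<noteq> 0" for x y :: real using that by (simp add: divide_inverse)
    have "(\<lambda>n. ?a n * (inverse (real n)) ^ (Suc e - h)) \<longlonglongrightarrow> (1 / fact h * K ^ e * exp (- K) ^ s) * 0 ^ (Suc e - h)"
      by (intro tendsto_mult a tendsto_power lim_inverse_n)
    moreover have "\<forall>\<^sub>F n in sequentially. ?a n * (inverse (real n)) ^ (Suc e - h) = G K n / n"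
      using eventually_gt_at_top[of 0]
    proof eventually_elim
      case (elim n)
      have "real n ^ Suc e = real n ^ (h + (Suc e - h))" using True by simp
      then have Suce: "real n ^ Suc e = real n ^ h * real n ^ (Suc e - h)" by (simp only: power_add)
      have ratio: "real n ^ h / real n ^ Suc e = (inverse (real n)) ^ (Suc e - h)"
        unfolding power_inverse Suce by (rule aux) (use elim in simp)
      show ?case by (simp only: ratio G[OF elim])
    qed
    ultimately show ?thesis by (intro that[OF Lim_transform_eventually])
  next
    case False
    have "\<forall>\<^sub>F n in sequentially. ?a n \<le> inverse (real n)"
      using bd eventually_gt_at_top[of 0] eventually_gt_at_top[of "nat \<lceil>K\<rceil>"]
    proof eventually_elim
      case (elim n)
      have "K < n" using elim(3) by linarith
      then have a0: "?a n \<ge> 0" using K by auto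
      have "real n ^ h = real n ^ (Suc e + (h - Suc e))" using False by simp
      then have "real n ^ h = real n ^ Suc e * real n ^ (h - Suc e)" by (simp only: power_add)
      then have "real n ^ h / real n ^ Suc e = real n ^ (h - Suc e)" using elim(2) by simp
      also have "\<dots> \<ge> real n ^ 1" using False elim(2) by (intro power_increasing) auto
      finally have "?a n * real n \<le> ?a n * (real n ^ h / real n ^ Suc e)" using a0 by (intro mult_left_mono) auto
      also have "\<dots> \<le> 1" using G[OF elim(2)] elim(1) by simp
      finally show ?case using elim(2) by (simp add: field_simps)
    qed
    then have "1 / fact h * K ^ e * exp (- K) ^ s \<le> 0"
      using tendsto_le[OF _ lim_inverse_n a] by simp
    moreover have "1 / fact h * K ^ e * exp (- K) ^ s > 0" using K by simp
    ultimately show ?thesis by linarith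
  qed
qed

definition "X n E = (\<Sum>W | W \<subseteq> {0..<n} \<and> card W = h. if occ n E W then 1 else 0 :: real)"

lemma finite_sets: "finite {W. W \<subseteq> {0..<n :: nat} \<and> card W = h}"
  by (rule finite_subset[of _ "Pow {0..<n}"]) auto

lemma card_sets: "card {W. W \<subseteq> {0..<n} \<and> card W = h} = n choose h"
  using n_subsets[of "{0..<n}" h] by simp

lemma X_eq: "X n E = real (card {W. occ n E W})"
proof -
  have "{W \<in> {W. W \<subseteq> {0..<n} \<and> card W = h}. occ n E W} = {W. occ n E W}" by (auto simp: occ_def)
  then show ?thesis using finite_sets by (simp add: X_def sum.inter_filter[symmetric])
qed

lemma X_freq: "sgraph n E \<Longrightarrow> X n E / n = freq (\<lambda>n E. ertype l E) {(h, F, r)} n E"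
  by (simp only: X_eq freq_def card_type singleton_iff)

lemma pE_X:
  assumes p: "0 \<le> K / n" "K / n \<le> 1" shows "pE (er n (K / n)) (X n) = G K n"
  unfolding X_def by (simp add: pE_sum finite_er pE_indicator prob_occ[OF p] card_sets G_def)

text \<open>The vertex of rank \<open>r\<close> determines its occurrence, and two occurrences that
  meet have these vertices within distance \<open>2 * l\<close>; so overlapping pairs inject into
  pairs of vertices at that distance.\<close>

lemma overlap_le:
  assumes sg: "sgraph n E"
  shows "card {(W, W'). occ n E W \<and> occ n E W' \<and> W \<inter> W' \<noteq> {}} \<le> (\<Sum>v<n. card (ball E (2 * l) v))"
proof -
  let ?P = "{(W, W'). occ n E W \<and> occ n E W' \<and> W \<inter> W' \<noteq> {}}"
  let ?f = "\<lambda>(W, W'). (sl W ! r, sl W' ! r)"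
  have mem: "sl W ! r \<in> W" if "occ n E W" for W
    using that r finite_subset[of W "{0..<n}"] by (auto simp: occ_def intro!: sl_nth_mem)
  have "inj_on ?f ?P"
  proof (rule inj_onI, clarify)
    fix W1 W2 W1' W2' assume o: "occ n E W1" "occ n E W2" "occ n E W1'" "occ n E W2'"
      and eq: "sl W1 ! r = sl W1' ! r" "sl W2 ! r = sl W2' ! r"
    have "W1 = W1'" by (metis occ_ball[OF sg o(1)] occ_ball[OF sg o(3)] eq(1))
    moreover have "W2 = W2'" by (metis occ_ball[OF sg o(2)] occ_ball[OF sg o(4)] eq(2))
    ultimately show "W1 = W1' \<and> W2 = W2'" by simp
  qed
  moreover have "?f ` ?P \<subseteq> (SIGMA v:{..<n}. ball E (2 * l) v)"
  proof
    fix x assume "x \<in> ?f ` ?P"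
    then obtain W W' z where o: "occ n E W" "occ n E W'" and z: "z \<in> W" "z \<in> W'"
      and x: "x = (sl W ! r, sl W' ! r)" by auto
    have "z \<in> ball E l (sl W ! r)" "sl W' ! r \<in> ball E l z"
      using occ_ball[OF sg o(1)] occ_ball[OF sg o(2)] z ball_sym by auto
    then have "sl W' ! r \<in> ball E (l + l) (sl W ! r)" by (rule ball_trans)
    moreover have "sl W ! r < n" using mem[OF o(1)] o(1) by (auto simp: occ_def)
    ultimately show "x \<in> (SIGMA v:{..<n}. ball E (2 * l) v)" using x by (simp add: mult_2)
  qed
  moreover have "finite (SIGMA v:{..<n}. ball E (2 * l) v)" using finite_ball[OF sg] by auto
  ultimately have "card ?P \<le> card (SIGMA v:{..<n}. ball E (2 * l) v)" by (rule card_inj_on_le)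
  also have "\<dots> = (\<Sum>v<n. card (ball E (2 * l) v))" using finite_ball[OF sg] by (intro card_SigmaI) auto
  finally show ?thesis .
qed

text \<open>The square is split into disjoint pairs of sets, bounded by \<open>prob_occ2\<close>,
  and overlapping pairs, bounded by balls of radius \<open>2 * l\<close>. The denominator
  compensates for the \<open>s * h\<close> non-edges that are not demanded a second time; it tends
  to 1 as \<open>n\<close> grows.\<close>

lemma pE_X2:
  assumes K: "K > 0" "K < n" and n: "2 * h \<le> n"
  shows "pE (er n (K / n)) (\<lambda>E. (X n E)\<^sup>2) \<le> (G K n)\<^sup>2 / (1 - K / n) ^ (s * h)
     + pE (er n (K / n)) (\<lambda>E. \<Sum>v<n. real (card (ball E (2 * l) v)))"
proof -
  let ?M = "er n (K / n)" and ?C = "{W. W \<subseteq> {0..<n} \<and> card W = h}"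
  define p where "p = K / n"
  have p: "0 \<le> p" "p \<le> 1" and p1: "1 - p > 0" using K by (auto simp: p_def)
  define q where "q = p ^ (2 * e) * (1 - p) ^ (2 * b + s * (n - h) + s * (n - 2 * h))"
  have q0: "q \<ge> 0" using p by (simp add: q_def)
  define Z where "Z E = (\<Sum>W\<in>?C. \<Sum>W'\<in>?C. if W \<inter> W' = {} \<and> occ n E W \<and> occ n E W' then 1 else 0 :: real)" for E
  have "pE ?M (\<lambda>E. (X n E)\<^sup>2) \<le> pE ?M (\<lambda>E. Z E + (\<Sum>v<n. real (card (ball E (2 * l) v))))"
  proof (rule pE_mono[OF finite_er])
    fix E assume E: "E \<in> set_pmf ?M"
    have sg: "sgraph n E" using sgraph_allE[OF set_er[OF E]] .
    have "(X n E)\<^sup>2 = (\<Sum>W\<in>?C. \<Sum>W'\<in>?C. (if W \<inter> W' = {} \<and> occ n E W \<and> occ n E W' then 1 else 0)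
        + (if W \<inter> W' \<noteq> {} \<and> occ n E W \<and> occ n E W' then 1 else 0 :: real))"
      unfolding X_def power2_eq_square sum_product by (intro sum.cong refl) auto
    also have "\<dots> = Z E + (\<Sum>W\<in>?C. \<Sum>W'\<in>?C. if W \<inter> W' \<noteq> {} \<and> occ n E W \<and> occ n E W' then 1 else 0)"
      by (simp add: Z_def sum.distrib)
    also have "(\<Sum>W\<in>?C. \<Sum>W'\<in>?C. if W \<inter> W' \<noteq> {} \<and> occ n E W \<and> occ n E W' then 1 else 0 :: real)
      = real (card {x\<in>?C \<times> ?C. fst x \<inter> snd x \<noteq> {} \<and> occ n E (fst x) \<and> occ n E (snd x)})"
    proof -
      have "(\<Sum>W\<in>?C. \<Sum>W'\<in>?C. if W \<inter> W' \<noteq> {} \<and> occ n E W \<and> occ n E W' then 1 else 0 :: real)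
        = (\<Sum>x\<in>?C \<times> ?C. if fst x \<inter> snd x \<noteq> {} \<and> occ n E (fst x) \<and> occ n E (snd x) then 1 else 0)"
        unfolding sum.cartesian_product by (intro sum.cong refl) (simp add: case_prod_unfold)
      also have "\<dots> = (\<Sum>x\<in>{x\<in>?C \<times> ?C. fst x \<inter> snd x \<noteq> {} \<and> occ n E (fst x) \<and> occ n E (snd x)}. 1)"
        by (rule sum.inter_filter[symmetric]) (intro finite_cartesian_product finite_sets)
      finally show ?thesis by simp
    qed
    also have "{x\<in>?C \<times> ?C. fst x \<inter> snd x \<noteq> {} \<and> occ n E (fst x) \<and> occ n E (snd x)}
      = {(W, W'). occ n E W \<and> occ n E W' \<and> W \<inter> W' \<noteq> {}}"
      by (auto simp: occ_def)
    also have "real (card \<dots>) \<le> (\<Sum>v<n. real (card (ball E (2 * l) v)))"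
      using overlap_le[OF sg] by (simp only: of_nat_sum[symmetric] of_nat_le_iff)
    finally show "(X n E)\<^sup>2 \<le> Z E + (\<Sum>v<n. real (card (ball E (2 * l) v)))" by simp
  qed
  also have "\<dots> = pE ?M Z + pE ?M (\<lambda>E. \<Sum>v<n. real (card (ball E (2 * l) v)))"
    by (rule pE_add[OF finite_er])
  also have "pE ?M Z = (\<Sum>W\<in>?C. \<Sum>W'\<in>?C. measure_pmf.prob ?M {E. W \<inter> W' = {} \<and> occ n E W \<and> occ n E W'})"
    unfolding Z_def by (simp only: pE_sum finite_er pE_indicator)
  also have "\<dots> \<le> (\<Sum>W\<in>?C. \<Sum>W'\<in>?C. q)"
  proof (intro sum_mono)
    fix W W' assume W: "W \<in> ?C" "W' \<in> ?C"
    show "measure_pmf.prob ?M {E. W \<inter> W' = {} \<and> occ n E W \<and> occ n E W'} \<le> q"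
    proof (cases "W \<inter> W' = {}")
      case True
      then show ?thesis using prob_occ2[OF p, of W n W'] W by (simp add: q_def p_def)
    next
      case False
      then show ?thesis using q0 by simp
    qed
  qed
  also have "\<dots> = (real (n choose h))\<^sup>2 * q" by (simp add: card_sets power2_eq_square)
  also have "q = (p ^ e * (1 - p) ^ (b + s * (n - h)))\<^sup>2 / (1 - p) ^ (s * h)"
  proof -
    have "s * (n - 2 * h) + s * h = s * (n - h)" using n by (simp add: distrib_left[symmetric])
    then have "(2 * b + s * (n - h) + s * (n - 2 * h)) + s * h = (b + s * (n - h)) * 2" by simp
    then have "(1 - p) ^ (2 * b + s * (n - h) + s * (n - 2 * h)) * (1 - p) ^ (s * h) = ((1 - p) ^ (b + s * (n - h)))\<^sup>2"
      by (simp only: power_add[symmetric] power_mult[symmetric])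
    then have "(1 - p) ^ (2 * b + s * (n - h) + s * (n - 2 * h)) = ((1 - p) ^ (b + s * (n - h)))\<^sup>2 / (1 - p) ^ (s * h)"
      using p1 by (simp add: field_simps)
    then show ?thesis unfolding q_def by (simp add: power_mult_distrib power_mult mult.commute[of 2 e])
  qed
  finally show ?thesis by (simp add: G_def p_def power_mult_distrib)
qed

lemma type_freq_limit:
  assumes K: "K > 0"
  shows "\<exists>x. L1conv (\<lambda>n. er n (K / real n)) (freq (\<lambda>n E. ertype l E) {(h, F, r)}) x"
proof -
  interpret graph_seq "\<lambda>n. er n (K / real n)" "\<lambda>n s. s" "\<lambda>n s. dg s" "K + K\<^sup>2"
    by (rule er_graph_seq[OF K])
  let ?M = "\<lambda>n. er n (K / real n)"
  have evK: "\<forall>\<^sub>F n in sequentially. K < real n"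
    using eventually_gt_at_top[of "nat \<lceil>K\<rceil>"] by eventually_elim linarith
  have frX: "freq (\<lambda>n E. ertype l E) {(h, F, r)} n E = X n E / n" if "E \<in> set_pmf (?M n)" for E n
    using X_freq[OF sgraph_allE[OF set_er[OF that]]] by simp
  have "\<forall>\<^sub>F n in sequentially. G K n / n \<le> 1"
    using evK
  proof eventually_elim
    case (elim n)
    then have p: "0 \<le> K / n" "K / n \<le> 1" using K by auto
    have "pE (?M n) (X n) \<le> n"
    proof (rule pE_le_const[OF finite_er])
      fix E assume "E \<in> set_pmf (?M n)"
      then have "X n E / n = freq (\<lambda>n E. ertype l E) {(h, F, r)} n E" using frX by simp
      also have "\<dots> \<le> freq (\<lambda>n E. ertype l E) UNIV n E" by (rule freq_mono) simp
      also have "\<dots> = 1" using elim K by (intro freq_UNIV) linarith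
      finally show "X n E \<le> n" using elim K by (simp add: field_simps)
    qed
    then show ?case using pE_X[OF p] elim K by (simp add: field_simps)
  qed
  then obtain x where x: "(\<lambda>n. G K n / n) \<longlonglongrightarrow> x" using G_limit[OF K] by blast
  define B where "B n = pE (?M n) (\<lambda>E. \<Sum>v<n. real (card (ball E (2 * l) v))) / (real n)\<^sup>2" for n
  have B: "B \<longlonglongrightarrow> 0" unfolding B_def by (rule sum_balls_small)
  \<comment> \<open>Upper bound for the mean square of \<open>X n E / n - x\<close> with the square
    expanded; as \<open>G K n / n\<close> tends to \<open>x\<close>, the terms cancel in the
    limit.\<close>
  define D where "D n = (G K n / n)\<^sup>2 / (1 - K / n) ^ (s * h) + B n - 2 * x * (G K n / n) + x\<^sup>2" for n :: nat
  have "(\<lambda>n. 1 - K / real n) \<longlonglongrightarrow> 1 - 0" by (intro tendsto_diff tendsto_const lim_const_over_n)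
  then have "(\<lambda>n. D n) \<longlonglongrightarrow> x\<^sup>2 / (1 - 0) ^ (s * h) + 0 - 2 * x * x + x\<^sup>2"
    unfolding D_def by (intro tendsto_intros x B) auto
  then have D: "D \<longlonglongrightarrow> 0" by (simp add: power2_eq_square)
  have "L1conv ?M (\<lambda>n E. X n E / n) x"
  proof (rule L1conv_of_L2, rule tendsto_sandwich[OF _ _ tendsto_const D])
    show "\<forall>\<^sub>F n in sequentially. 0 \<le> pE (?M n) (\<lambda>E. (X n E / n - x)\<^sup>2)"
      by (intro always_eventually allI pE_nonneg) simp
    show "\<forall>\<^sub>F n in sequentially. pE (?M n) (\<lambda>E. (X n E / n - x)\<^sup>2) \<le> D n"
      using evK eventually_ge_at_top[of "2 * h"]
    proof eventually_elim
      case (elim n)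
      then have p: "0 \<le> K / n" "K / n \<le> 1" using K by auto
      have n0: "real n > 0" using elim K by linarith
      have "pE (?M n) (\<lambda>E. (X n E / n - x)\<^sup>2) = pE (?M n) (\<lambda>E. ((X n E)\<^sup>2 / n\<^sup>2 - 2 * x * (X n E / n)) + x\<^sup>2)"
        by (rule pE_cong) (simp add: power2_diff power_divide)
      also have "\<dots> = pE (?M n) (\<lambda>E. (X n E)\<^sup>2) / n\<^sup>2 - 2 * x * (G K n / n) + x\<^sup>2"
        by (simp add: pE_add pE_diff finite_er pE_X[OF p, symmetric])
      also have "pE (?M n) (\<lambda>E. (X n E)\<^sup>2) / n\<^sup>2 \<le> ((G K n)\<^sup>2 / (1 - K / n) ^ (s * h)
     + pE (?M n) (\<lambda>E. \<Sum>v<n. real (card (ball E (2 * l) v)))) / n\<^sup>2"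
        by (intro divide_right_mono pE_X2[OF K elim]) simp
      also have "\<dots> = (G K n / n)\<^sup>2 / (1 - K / n) ^ (s * h) + B n"
        by (simp add: B_def add_divide_distrib power_divide)
      finally show ?case by (simp add: D_def)
    qed
  qed
  then have "L1conv ?M (freq (\<lambda>n E. ertype l E) {(h, F, r)}) x"
    by (rule L1conv_cong) (use frX in \<open>auto intro!: always_eventually\<close>)
  then show ?thesis by blast
qed

end

theorem er_extension_counts:
  fixes K :: real
  assumes K: "K > 0" and wfT: "wf_rgraph T"
  shows "extension_law (\<lambda>n. er n (K / real n)) T l"
proof -
  let ?M = "\<lambda>n. er n (K / real n)"
  let ?\<tau> = "\<lambda>n E. ertype l E"
  interpret graph_seq ?M "\<lambda>n s. s" "\<lambda>n s. dg s" "K + K\<^sup>2"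
    by (rule er_graph_seq[OF K])
  have conv: "\<exists>x. L1conv ?M (freq ?\<tau> {\<sigma>}) x" for \<sigma>
  proof -
    obtain h F r where \<sigma>: "\<sigma> = (h, F, r)" by (metis prod.exhaust)
    show ?thesis
    proof (cases "er_shape l h F r")
      case True
      then show ?thesis using er_shape.type_freq_limit[OF True K] \<sigma> by simp
    next
      case False
      have z: "freq ?\<tau> {\<sigma>} n E = 0" if "E \<in> set_pmf (?M n)" for n E
      proof -
        have "{v\<in>{0..<n}. ertype l E v \<in> {\<sigma>}} = {}"
          using ertype_shape[OF sgraph_allE[OF set_er[OF that]]] False \<sigma> by auto
        then show ?thesis by (simp only: freq_def) simp
      qed
      have "L1conv ?M (\<lambda>n s. 0) 0" by (rule L1conv_const) simp
      then have "L1conv ?M (freq ?\<tau> {\<sigma>}) 0"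
        by (rule L1conv_cong) (use z in \<open>auto intro!: always_eventually\<close>)
      then show ?thesis by blast
    qed
  qed
  have tight: "\<exists>Fs. finite Fs \<and> (\<forall>\<^sub>F n in sequentially. pE (?M n) (freq ?\<tau> (- Fs) n) \<le> \<epsilon>)" if \<epsilon>: "\<epsilon> > 0" for \<epsilon> :: real
  proof -
    obtain D where D: "\<forall>\<^sub>F n in sequentially.
      pE (?M n) (\<lambda>s. real (card {v\<in>{0..<n}. \<exists>w\<in>ball s l v. dg s w > D}) / n) \<le> \<epsilon>"
      using tight_degrees[OF \<epsilon>, of l] by (elim exE) (rule that)
    \<comment> \<open>Degrees at most \<open>D\<close> within the ball bound its size by this power,
      which leaves finitely many labelled graphs.\<close>
    define H where "H = (D + 1) ^ l"
    define Fs where "Fs = {0..H} \<times> Pow ({0..<H} \<times> {0..<H}) \<times> {0..H}"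
    have "\<forall>\<^sub>F n in sequentially. pE (?M n) (freq ?\<tau> (- Fs) n) \<le> \<epsilon>"
      using D
    proof eventually_elim
      case (elim n)
      have "pE (?M n) (freq ?\<tau> (- Fs) n)
        \<le> pE (?M n) (\<lambda>s. real (card {v\<in>{0..<n}. \<exists>w\<in>ball s l v. dg s w > D}) / n)"
      proof (rule pE_mono[OF finite_er])
        fix E assume E: "E \<in> set_pmf (?M n)"
        have sgE: "sgraph n E" using sgraph_allE[OF set_er[OF E]] .
        have "{v\<in>{0..<n}. ertype l E v \<in> - Fs} \<subseteq> {v\<in>{0..<n}. \<exists>w\<in>ball E l v. dg E w > D}"
        proof clarify
          fix v assume v: "v \<in> {0..<n}" "ertype l E v \<notin> Fs"
          show "\<exists>w\<in>ball E l v. dg E w > D"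
          proof (rule ccontr)
            assume "\<not> (\<exists>w\<in>ball E l v. dg E w > D)"
            then have c: "card (ball E l v) \<le> H"
              unfolding H_def using v(1) by (intro card_ball_le[OF sgE]) (auto simp: not_less)
            have "rnk (ball E l v) v < card (ball E l v)"
              using v(1) by (intro nth_rnk finite_ball[OF sgE]) auto
            then have "ertype l E v \<in> Fs"
              using c relG_prs[of "ball E l v" E] by (force simp: ertype_def Let_def Fs_def prs_def)
            then show False using v(2) by simp
          qed
        qed
        then have "card {v\<in>{0..<n}. ertype l E v \<in> - Fs} \<le> card {v\<in>{0..<n}. \<exists>w\<in>ball E l v. dg E w > D}"
          by (intro card_mono) auto
        then show "freq ?\<tau> (- Fs) n E \<le> real (card {v\<in>{0..<n}. \<exists>w\<in>ball E l v. dg E w > D}) / n"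
          unfolding freq_def by (intro divide_right_mono) auto
      qed
      then show ?case using elim by linarith
    qed
    moreover have "finite Fs" by (simp add: Fs_def)
    ultimately show ?thesis by blast
  qed
  obtain P where P: "\<And>A. L1conv ?M (freq ?\<tau> A) (measure_pmf.prob P A)"
    using freq_scheffe[of ?\<tau>, OF conv tight] by blast
  show ?thesis
  proof (rule extension_counts[OF wfT P, where R = ergraph])
    show "\<forall>\<^sub>F n in sequentially. \<forall>s\<in>set_pmf (?M n). \<forall>v<n. wf_rgraph (ergraph (ertype l s v))
       \<and> riso (nbhd s l [v]) (ergraph (ertype l s v))"
      using ergraph_ertype[OF sgraph_allE[OF set_er]] by (auto intro!: always_eventually)
  qed simp
qed

section \<open>Stochastic approximation\<close>

lemma nonneg_not_summable_at_top:
  fixes f :: "nat \<Rightarrow> real"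
  assumes f: "\<And>i. f i \<ge> 0" and ns: "\<not> summable f"
  shows "filterlim (\<lambda>k. sum f {..<k}) at_top sequentially"
  unfolding filterlim_at_top
proof
  fix Z :: real
  obtain k where k: "\<not> sum f {..<k} \<le> Z" using summableI_nonneg_bounded[of f Z] f ns by auto
  have "Z \<le> sum f {..<j}" if "j \<ge> k" for j
  proof -
    have "sum f {..<k} \<le> sum f {..<j}" using that f by (intro sum_mono2) auto
    then show ?thesis using k by linarith
  qed
  then show "\<forall>\<^sub>F k in sequentially. Z \<le> sum f {..<k}" by (auto simp: eventually_sequentially)
qed

text \<open>The part of \<open>u\<close> above a level \<open>d > 0\<close> contracts by
  \<open>1 - s / n\<close> as soon as \<open>\<eta> n < s * d\<close>, and the product of these
  factors tends to 0 because the harmonic series diverges.\<close>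

lemma contraction_limit:
  fixes u \<eta> :: "nat \<Rightarrow> real" and s :: real
  assumes s: "s > 0" and u0: "\<And>n. u n \<ge> 0" and \<eta>: "\<eta> \<longlonglongrightarrow> 0"
    and rec: "\<forall>\<^sub>F n in sequentially. u (Suc n) \<le> (1 - s / n) * u n + \<eta> n / n"
  shows "u \<longlonglongrightarrow> 0"
proof (rule order_tendstoI)
  fix a :: real assume "a < 0"
  then have "a < u n" for n using u0[of n] by linarith
  then show "\<forall>\<^sub>F n in sequentially. a < u n" by simp
next
  fix a :: real assume a: "0 < a"
  define d where "d = a / 2"
  have d: "d > 0" using a by (simp add: d_def)
  have "\<forall>\<^sub>F n in sequentially. \<eta> n < s * d" using order_tendstoD(2)[OF \<eta>, of "s * d"] s d by simp
  then have "\<forall>\<^sub>F n in sequentially. u (Suc n) \<le> (1 - s / n) * u n + \<eta> n / n \<and> \<eta> n < s * d \<and> s < n \<and> n > 0"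
    using rec eventually_gt_at_top[of 0] eventually_gt_at_top[of "nat \<lceil>s\<rceil>"]
    by eventually_elim linarith
  then obtain N where N: "\<And>n. n \<ge> N \<Longrightarrow> u (Suc n) \<le> (1 - s / n) * u n + \<eta> n / n \<and> \<eta> n < s * d \<and> s < n \<and> n > 0"
    by (auto simp: eventually_sequentially)
  define v where "v n = max 0 (u n - d)" for n
  have v0: "v n \<ge> 0" for n by (simp add: v_def)
  have vrec: "v (Suc n) \<le> (1 - s / n) * v n" if "n \<ge> N" for n
  proof -
    note n = N[OF that]
    have f: "1 - s / n \<ge> 0" using n by simp
    have "\<eta> n / n \<le> s * d / n" using n by (intro divide_right_mono) auto
    then have "u (Suc n) - d \<le> (1 - s / n) * (u n - d)" using n by (simp add: algebra_simps diff_divide_distrib)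
    also have "\<dots> \<le> (1 - s / n) * v n" using f by (intro mult_left_mono) (auto simp: v_def)
    finally show ?thesis using f v0[of n] by (simp add: v_def)
  qed
  have vexp: "v (N + k) \<le> v N * exp (- s * (\<Sum>i<k. 1 / real (N + i)))" for k
  proof (induction k)
    case (Suc k)
    have "v (N + Suc k) \<le> (1 - s / (N + k)) * v (N + k)" using vrec[of "N + k"] by simp
    also have "\<dots> \<le> exp (- s / (N + k)) * v (N + k)"
      using exp_ge_add_one_self[of "- s / (N + k)"] v0 by (intro mult_right_mono) (auto simp: add_divide_distrib)
    also have "\<dots> \<le> exp (- s / (N + k)) * (v N * exp (- s * (\<Sum>i<k. 1 / real (N + i))))"
      using Suc by (intro mult_left_mono) auto
    also have "\<dots> = v N * exp (- s * (\<Sum>i<Suc k. 1 / real (N + i)))"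
      by (simp add: exp_add[symmetric] algebra_simps)
    finally show ?case .
  qed simp
  have "\<not> summable (\<lambda>i. 1 / real (N + i))"
  proof
    assume "summable (\<lambda>i. 1 / real (N + i))"
    then have "summable (\<lambda>i. inverse (real (i + N)))" by (simp add: inverse_eq_divide add.commute)
    then have "summable (\<lambda>i. inverse (real i))" by (subst (asm) summable_iff_shift)
    then show False using not_summable_harmonic[where 'a = real] by simp
  qed
  then have "filterlim (\<lambda>k. \<Sum>i<k. 1 / real (N + i)) at_top sequentially"
    using nonneg_not_summable_at_top[of "\<lambda>i. 1 / real (N + i)"] by simp
  then have "filterlim (\<lambda>k. - s * (\<Sum>i<k. 1 / real (N + i))) at_bot sequentially"
    by (rule filterlim_tendsto_neg_mult_at_bot[OF tendsto_const, rotated]) (use s in simp)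
  then have lim: "(\<lambda>k. v N * exp (- s * (\<Sum>i<k. 1 / real (N + i)))) \<longlonglongrightarrow> v N * 0"
    by (intro tendsto_mult tendsto_const filterlim_compose[OF exp_at_bot])
  have "(\<lambda>k. v (N + k)) \<longlonglongrightarrow> 0"
  proof (rule tendsto_sandwich)
    show "\<forall>\<^sub>F k in sequentially. 0 \<le> v (N + k)" using v0 by simp
    show "\<forall>\<^sub>F k in sequentially. v (N + k) \<le> v N * exp (- s * (\<Sum>i<k. 1 / real (N + i)))"
      using vexp by (intro always_eventually allI)
    show "(\<lambda>k. v N * exp (- s * (\<Sum>i<k. 1 / real (N + i)))) \<longlonglongrightarrow> 0" using lim by simp
  qed simp
  then have "(\<lambda>k. v (k + N)) \<longlonglongrightarrow> 0" by (simp add: add.commute)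
  then have "v \<longlonglongrightarrow> 0" by (rule LIMSEQ_offset)
  then have "\<forall>\<^sub>F n in sequentially. v n < d" using order_tendstoD(2) d by blast
  then show "\<forall>\<^sub>F n in sequentially. u n < a"
  proof eventually_elim
    case (elim n)
    then have "u n - d < d" by (simp add: v_def)
    then show ?case by (simp add: d_def)
  qed
qed

text \<open>Passing from \<open>n ^ c\<close> to \<open>Suc n ^ c\<close> multiplies a scaled
  quantity by about \<open>1 - c / n\<close>; this is the source of \<open>c\<close> in the limit
  \<open>b / (a + c)\<close> below.\<close>

lemma ratio_power_limit: "(\<lambda>n. real n * (1 - (real n / real (Suc n)) ^ c)) \<longlonglongrightarrow> real c"
proof (induction c)
  case (Suc c)
  have r: "(\<lambda>n. real n / real (Suc n)) \<longlonglongrightarrow> 1" by (rule LIMSEQ_n_over_Suc_n)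
  have "(\<lambda>n. real n / real (Suc n) + real n / real (Suc n) * (real n * (1 - (real n / real (Suc n)) ^ c))) \<longlonglongrightarrow> 1 + 1 * real c"
    by (intro tendsto_add tendsto_mult r Suc)
  moreover have "real n / real (Suc n) + real n / real (Suc n) * (real n * (1 - (real n / real (Suc n)) ^ c))
     = real n * (1 - (real n / real (Suc n)) ^ Suc c)" for n
  proof -
    define q where "q = real n / real (Suc n)"
    have "real n * (1 - q) = q" by (simp add: q_def field_simps)
    then have "real n * (1 - q ^ Suc c) = q + q * (real n * (1 - q ^ c))" by (simp add: algebra_simps)
    then show ?thesis by (simp only: q_def)
  qed
  ultimately show ?case by simp
qed simp

text \<open>Two effects of order \<open>1 / n\<close>: the jump itself, and the change of the
  normalization, bounded by Bernoulli's inequality.\<close>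

lemma scaled_increment:
  fixes x y C :: real
  assumes n: "n > 0" and c: "c > 0" and x: "\<bar>x\<bar> \<le> C * real n ^ c" and d: "\<bar>y - x\<bar> \<le> C * real n ^ (c - 1)"
  shows "\<bar>y / real (Suc n) ^ c - x / real n ^ c\<bar> \<le> C * (1 + c) / n"
proof -
  have C0: "C \<ge> 0" using x n by (metis abs_ge_zero dual_order.trans of_nat_0_less_iff zero_le_mult_iff zero_less_power not_le)
  have p: "real n ^ c \<le> real (Suc n) ^ c" by (intro power_mono) auto
  have nc: "real n ^ c = real n * real n ^ (c - 1)" using c by (metis Suc_pred' power_Suc)
  define q where "q = real n / real (Suc n)"
  have q: "0 \<le> q" "q \<le> 1" by (auto simp: q_def)
  have bern: "1 - q ^ c \<le> c / n"
  proof -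
    have "1 - q ^ c \<le> c * (1 - q)"
      using Bernoulli_inequality[of "q - 1" c] q by (simp add: algebra_simps)
    also have "1 - q \<le> 1 / n" using n by (simp add: q_def field_simps)
    finally show ?thesis by (simp add: mult_left_mono)
  qed
  have "y / real (Suc n) ^ c - x / real n ^ c = (y - x) / real (Suc n) ^ c - x / real n ^ c * (1 - q ^ c)"
    using n by (simp add: q_def power_divide field_simps)
  also have "\<bar>\<dots>\<bar> \<le> \<bar>(y - x) / real (Suc n) ^ c\<bar> + \<bar>x / real n ^ c * (1 - q ^ c)\<bar>" by (rule abs_triangle_ineq4)
  also have "\<bar>(y - x) / real (Suc n) ^ c\<bar> \<le> C / n"
  proof -
    have "\<bar>(y - x) / real (Suc n) ^ c\<bar> = \<bar>y - x\<bar> / real (Suc n) ^ c" by simp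
    also have "\<dots> \<le> C * real n ^ (c - 1) / real n ^ c" using d p n C0 by (intro frac_le) auto
    also have "\<dots> = C / n" using n unfolding nc by simp
    finally show ?thesis .
  qed
  also have "\<bar>x / real n ^ c * (1 - q ^ c)\<bar> \<le> C * (c / n)"
  proof -
    have "\<bar>x / real n ^ c\<bar> \<le> C" using x n by (simp add: field_simps)
    moreover have "\<bar>1 - q ^ c\<bar> \<le> c / n" using bern q power_le_one[of q c] by simp
    ultimately show ?thesis unfolding abs_mult using C0 by (intro mult_mono) auto
  qed
  finally show ?thesis using n by (simp add: field_simps)
qed

text \<open>At scaled value \<open>w\<close> the process moves by about
  \<open>(b - (a + c) * w) / n\<close> on average, so \<open>b / (a + c)\<close> is the attracting
  rest point. The mean square deviation contracts at rate about \<open>2 * (a + c) / n\<close>. The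
  error of \<open>B\<close> enters as \<open>1 / n\<close> times a null sequence, because the
  deviation is bounded, and the squared jumps enter with \<open>1 / n\<^sup>2\<close>; so
  \<open>contraction_limit\<close> applies.\<close>

lemma (in fin_pmfs) stochastic_approximation:
  fixes X B :: "nat \<Rightarrow> 's \<Rightarrow> real" and A :: "nat \<Rightarrow> real" and \<kappa> :: "nat \<Rightarrow> 's \<Rightarrow> 's pmf"
  assumes step: "\<And>n. S (Suc n) = bind_pmf (S n) (\<kappa> n)"
    and fink: "\<And>n s. s \<in> set_pmf (S n) \<Longrightarrow> finite (set_pmf (\<kappa> n s))"
    and c: "c > 0"
    and bd: "\<And>n s. n > 0 \<Longrightarrow> s \<in> set_pmf (S n) \<Longrightarrow> \<bar>X n s\<bar> \<le> C * real n ^ c"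
    and jump: "\<And>n s s'. n > 0 \<Longrightarrow> s \<in> set_pmf (S n) \<Longrightarrow> s' \<in> set_pmf (\<kappa> n s)
       \<Longrightarrow> \<bar>X (Suc n) s' - X n s\<bar> \<le> C * real n ^ (c - 1)"
    and drift: "\<And>n s. n > 0 \<Longrightarrow> s \<in> set_pmf (S n)
       \<Longrightarrow> pE (\<kappa> n s) (\<lambda>s'. X (Suc n) s' - X n s) = - A n * X n s + B n s"
    and A: "(\<lambda>n. real n * A n) \<longlonglongrightarrow> a" and a0: "a \<ge> 0"
    and B: "L1conv S (\<lambda>n s. B n s / real n ^ (c - 1)) b"
  shows "L1conv S (\<lambda>n s. X n s / real n ^ c) (b / (a + c))"
proof (rule L1conv_of_L2)
  define \<sigma> where "\<sigma> = a + c"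
  have \<sigma>0: "\<sigma> > 0" using a0 c by (simp add: \<sigma>_def)
  define x where "x = b / \<sigma>"
  have bx: "b = \<sigma> * x" using \<sigma>0 by (simp add: x_def)
  define r where "r n = (real n / real (Suc n)) ^ c" for n
  have r: "r \<longlonglongrightarrow> 1"
    unfolding r_def using tendsto_power[OF LIMSEQ_n_over_Suc_n, where n = c] by simp
  \<comment> \<open>Effective contraction rate of the scaled process: it combines the drift
    \<open>A\<close> with the change of normalization.\<close>
  define \<sigma>' where "\<sigma>' n = real n * (1 - r n * (1 - A n))" for n
  have "(\<lambda>n. real n * (1 - r n) + r n * (real n * A n)) \<longlonglongrightarrow> c + 1 * a"
    by (intro tendsto_add tendsto_mult r A ratio_power_limit[of c, folded r_def])
  then have \<sigma>': "\<sigma>' \<longlonglongrightarrow> \<sigma>" unfolding \<sigma>'_def \<sigma>_def by (simp add: algebra_simps)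
  define z where "z n s = X n s / real n ^ c - x" for n s
  define \<beta> where "\<beta> n s = B n s / real n ^ (c - 1)" for n s
  define \<epsilon> where "\<epsilon> n = pE (S n) (\<lambda>s. \<bar>r n * \<beta> n s - \<sigma>' n * x\<bar>)" for n
  have \<epsilon>: "\<epsilon> \<longlonglongrightarrow> 0"
  proof -
    have "L1conv S (\<lambda>n s. r n * \<beta> n s + - (\<sigma>' n * x)) (1 * b + - (\<sigma> * x))"
      by (intro L1conv_add L1conv_mult r B[folded \<beta>_def] L1conv_const tendsto_minus tendsto_mult \<sigma>' tendsto_const)
    then show ?thesis by (simp add: L1conv_def \<epsilon>_def[abs_def] bx)
  qed
  define Z where "Z = \<bar>C\<bar> + \<bar>x\<bar>"
  define C' where "C' = C * (1 + c)"
  have zZ: "\<bar>z n s\<bar> \<le> Z" if "n > 0" "s \<in> set_pmf (S n)" for n s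
  proof -
    have "\<bar>X n s / real n ^ c\<bar> \<le> C" using bd[OF that] that by (simp add: field_simps)
    then show ?thesis unfolding z_def Z_def by linarith
  qed
  define u where "u n = pE (S n) (\<lambda>s. (z n s)\<^sup>2)" for n
  have "u \<longlonglongrightarrow> 0"
  proof (rule contraction_limit[OF \<sigma>0])
    show "u n \<ge> 0" for n unfolding u_def by (intro pE_nonneg) simp
    have "(\<lambda>n. 2 * Z * \<epsilon> n + C'\<^sup>2 / real n) \<longlonglongrightarrow> 2 * Z * 0 + 0"
      by (intro tendsto_intros \<epsilon> lim_const_over_n)
    then show "(\<lambda>n. 2 * Z * \<epsilon> n + C'\<^sup>2 / real n) \<longlonglongrightarrow> 0" by simp
    have "\<forall>\<^sub>F n in sequentially. \<sigma>' n > \<sigma> / 2" using order_tendstoD(1)[OF \<sigma>', of "\<sigma> / 2"] \<sigma>0 by simp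
    then show "\<forall>\<^sub>F n in sequentially. u (Suc n) \<le> (1 - \<sigma> / n) * u n + (2 * Z * \<epsilon> n + C'\<^sup>2 / real n) / n"
      using eventually_gt_at_top[of 0]
    proof eventually_elim
      case (elim n)
      note n = elim(2)
      have inner: "pE (\<kappa> n s) (\<lambda>s'. (z (Suc n) s')\<^sup>2)
         \<le> (z n s)\<^sup>2 - 2 * \<sigma>' n / n * (z n s)\<^sup>2 + 2 * Z / n * \<bar>r n * \<beta> n s - \<sigma>' n * x\<bar> + C'\<^sup>2 / n / n"
        if s: "s \<in> set_pmf (S n)" for s
      proof -
        note f = fink[OF s]
        define \<Delta> where "\<Delta> s' = X (Suc n) s' / real (Suc n) ^ c - X n s / real n ^ c" for s'
        have D1: "pE (\<kappa> n s) \<Delta> = (- \<sigma>' n * (X n s / real n ^ c) + r n * \<beta> n s) / n"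
        proof -
          have nc: "real n ^ c = real n * real n ^ (c - 1)" using c by (metis Suc_pred' power_Suc)
          have "pE (\<kappa> n s) \<Delta> = pE (\<kappa> n s) (\<lambda>s'. (X (Suc n) s' - X n s) / real (Suc n) ^ c
             + (X n s / real (Suc n) ^ c - X n s / real n ^ c))"
            by (rule pE_cong) (simp add: \<Delta>_def diff_divide_distrib)
          also have "\<dots> = (- A n * X n s + B n s) / real (Suc n) ^ c + (X n s / real (Suc n) ^ c - X n s / real n ^ c)"
            by (simp add: pE_add[OF f] drift[OF n s])
          also have "\<dots> = r n * ((1 - A n) * (X n s / real n ^ c) + B n s / real n ^ c) - X n s / real n ^ c"
          proof -
            have "r n = real n ^ c / real (Suc n) ^ c" by (simp add: r_def power_divide)
            moreover have "(- a * y + d) / q + (y / q - y / p) = p / q * ((1 - a) * (y / p) + d / p) - y / p"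
              if "p \<noteq> 0" "q \<noteq> 0" for a y d p q :: real using that by (simp add: field_simps)
            moreover have "real n ^ c \<noteq> 0" "real (Suc n) ^ c \<noteq> 0" using n by simp_all
            ultimately show ?thesis by metis
          qed
          also have "B n s / real n ^ c = \<beta> n s / n" by (simp add: \<beta>_def nc)
          also have "r n * ((1 - A n) * (X n s / real n ^ c) + \<beta> n s / n) - X n s / real n ^ c
             = (- \<sigma>' n * (X n s / real n ^ c) + r n * \<beta> n s) / n"
          proof -
            have "q * ((1 - a) * w + d / m) - w = (- (m * (1 - q * (1 - a))) * w + q * d) / m"
              if "m \<noteq> 0" for q a w d m :: real using that by (simp add: field_simps)
            then show ?thesis unfolding \<sigma>'_def using n by (metis of_nat_0_eq_iff not_gr_zero)
          qed
          finally show ?thesis .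
        qed
        have D2: "\<bar>\<Delta> s'\<bar> \<le> C' / n" if "s' \<in> set_pmf (\<kappa> n s)" for s'
          unfolding \<Delta>_def C'_def by (rule scaled_increment[OF n c bd[OF n s] jump[OF n s that]])
        have "pE (\<kappa> n s) (\<lambda>s'. (z (Suc n) s')\<^sup>2)
          \<le> pE (\<kappa> n s) (\<lambda>s'. ((z n s)\<^sup>2 + C'\<^sup>2 / n / n) + 2 * z n s * \<Delta> s')"
        proof (rule pE_mono[OF f])
          fix s' assume s': "s' \<in> set_pmf (\<kappa> n s)"
          have "z (Suc n) s' = z n s + \<Delta> s'" by (simp add: z_def \<Delta>_def)
          then have "(z (Suc n) s')\<^sup>2 = (z n s)\<^sup>2 + (\<Delta> s')\<^sup>2 + 2 * z n s * \<Delta> s'" by (simp add: power2_sum)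
          moreover have "(\<Delta> s')\<^sup>2 \<le> (C' / n)\<^sup>2" using power_mono[OF D2[OF s'], of 2] by simp
          ultimately show "(z (Suc n) s')\<^sup>2 \<le> ((z n s)\<^sup>2 + C'\<^sup>2 / n / n) + 2 * z n s * \<Delta> s'"
            by (simp add: power_divide power2_eq_square)
        qed
        also have "\<dots> = (z n s)\<^sup>2 + C'\<^sup>2 / n / n + 2 * z n s * pE (\<kappa> n s) \<Delta>"
          by (simp add: pE_add[OF f])
        also have "2 * z n s * pE (\<kappa> n s) \<Delta>
          = - (2 * \<sigma>' n / n * (z n s)\<^sup>2) + 2 / n * (z n s * (r n * \<beta> n s - \<sigma>' n * x))"
        proof -
          have "X n s / real n ^ c = z n s + x" by (simp add: z_def)
          then show ?thesis unfolding D1 using n by (simp add: field_simps power2_eq_square)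
        qed
        also have "z n s * (r n * \<beta> n s - \<sigma>' n * x) \<le> Z * \<bar>r n * \<beta> n s - \<sigma>' n * x\<bar>"
        proof -
          have "z n s * (r n * \<beta> n s - \<sigma>' n * x) \<le> \<bar>z n s\<bar> * \<bar>r n * \<beta> n s - \<sigma>' n * x\<bar>"
            by (metis abs_ge_self abs_mult)
          also have "\<dots> \<le> Z * \<bar>r n * \<beta> n s - \<sigma>' n * x\<bar>" by (rule mult_right_mono[OF zZ[OF n s]]) simp
          finally show ?thesis .
        qed
        finally have "pE (\<kappa> n s) (\<lambda>s'. (z (Suc n) s')\<^sup>2) \<le> (z n s)\<^sup>2 + C'\<^sup>2 / n / n
          + (- (2 * \<sigma>' n / n * (z n s)\<^sup>2) + 2 / n * (Z * \<bar>r n * \<beta> n s - \<sigma>' n * x\<bar>))"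
          by (simp add: divide_right_mono mult_left_mono)
        then show ?thesis by (simp add: mult.assoc)
      qed
      have "u (Suc n) = pE (S n) (\<lambda>s. pE (\<kappa> n s) (\<lambda>s'. (z (Suc n) s')\<^sup>2))"
        unfolding u_def step by (rule pE_bind[OF fin fink])
      also have "\<dots> \<le> pE (S n) (\<lambda>s. (z n s)\<^sup>2 - 2 * \<sigma>' n / n * (z n s)\<^sup>2
          + 2 * Z / n * \<bar>r n * \<beta> n s - \<sigma>' n * x\<bar> + C'\<^sup>2 / n / n)"
        by (rule pE_mono[OF fin inner])
      also have "\<dots> = u n - 2 * \<sigma>' n / n * u n + 2 * Z / n * \<epsilon> n + C'\<^sup>2 / n / n"
        by (simp add: pE_add pE_diff fin u_def \<epsilon>_def)
      \<comment> \<open>Half of the rate is given away, so it is enough that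
        \<open>\<sigma>' n\<close> exceeds half of its limit \<open>\<sigma>\<close>, which holds
        eventually.\<close>
      also have "\<dots> \<le> u n - \<sigma> / n * u n + 2 * Z / n * \<epsilon> n + C'\<^sup>2 / n / n"
      proof -
        have "u n \<ge> 0" unfolding u_def by (intro pE_nonneg) simp
        moreover have "\<sigma> / n \<le> 2 * \<sigma>' n / n" using elim(1) by (intro divide_right_mono) auto
        ultimately have "\<sigma> / n * u n \<le> 2 * \<sigma>' n / n * u n" by (intro mult_right_mono)
        then show ?thesis by simp
      qed
      also have "\<dots> = (1 - \<sigma> / n) * u n + (2 * Z * \<epsilon> n + C'\<^sup>2 / real n) / n"
        by (simp add: algebra_simps add_divide_distrib)
      finally show ?case .
    qed
  qed
  then show "(\<lambda>n. pE (S n) (\<lambda>s. (X n s / real n ^ c - b / (a + c))\<^sup>2)) \<longlonglongrightarrow> 0"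
    by (simp add: u_def[abs_def] z_def x_def \<sigma>_def)
qed

section \<open>The merged preferential attachment process\<close>

text \<open>Half-edges after merging. The sources of past edges are known from their positions;
  \<open>Suc\<close> includes the source of the edge being added, which provides the option of a
  loop.\<close>

definition urn_mset :: "nat \<Rightarrow> nat list \<Rightarrow> nat multiset" where
  "urn_mset m bs = mset (map (\<lambda>i. i div m) [0..<Suc (length bs)]) + mset bs"

definition urn :: "nat \<Rightarrow> nat list \<Rightarrow> nat pmf" where
  "urn m bs = pmf_of_multiset (urn_mset m bs)"

text \<open>Only the merged target of each edge is recorded: entry \<open>i\<close> is the target of edge \<open>i\<close>, whose
  source is block \<open>i div m\<close>.\<close>
fun bam :: "nat \<Rightarrow> nat \<Rightarrow> nat list pmf" where
  "bam m 0 = return_pmf []"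
| "bam m (Suc t) = bind_pmf (bam m t) (\<lambda>bs. map_pmf (\<lambda>x. bs @ [x]) (urn m bs))"

definition bagraph :: "nat \<Rightarrow> nat list \<Rightarrow> nat set set" where
  "bagraph m bs = {{i div m, bs ! i} | i. i < length bs \<and> i div m \<noteq> bs ! i}"

lemma urn_mset_ne: "urn_mset m bs \<noteq> {#}"
  by (simp add: urn_mset_def)

lemma size_urn_mset: "size (urn_mset m bs) = 2 * length bs + 1"
  by (simp add: urn_mset_def)

lemma finite_urn: "finite (set_pmf (urn m bs))"
  by (simp add: urn_def urn_mset_ne)

text \<open>Merging vertices is not injective; multiplicities of merged vertices add up, so a merged
  urn is again an urn.\<close>

lemma map_pmf_of_multiset:
  assumes "A \<noteq> {#}" shows "map_pmf f (pmf_of_multiset A) = pmf_of_multiset (image_mset f A)"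
proof (rule pmf_eqI)
  fix y
  have "pmf (map_pmf f (pmf_of_multiset A)) y = measure_pmf.prob (pmf_of_multiset A) (f -` {y} \<inter> set_pmf (pmf_of_multiset A))"
    by (simp add: pmf_map measure_Int_set_pmf)
  also have "\<dots> = (\<Sum>x\<in>f -` {y} \<inter> set_mset A. real (count A x) / real (size A))"
    using assms by (subst measure_measure_pmf_finite) auto
  also have "\<dots> = real (count (image_mset f A) y) / real (size A)"
    by (simp add: count_image_mset sum_divide_distrib)
  finally show "pmf (map_pmf f (pmf_of_multiset A)) y = pmf (pmf_of_multiset (image_mset f A)) y"
    using assms by simp
qed

lemma ba1_sources: "es \<in> set_pmf (ba1 t) \<Longrightarrow> map fst es = [0..<t]"
  by (induction t arbitrary: es) auto

lemma endpoints_eq: "endpoints es = mset (map fst es) + mset (map snd es)"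
  by (induction es) (auto simp: endpoints_def)

text \<open>Edge number \<open>i\<close> always has source \<open>i\<close>, and the law of the next
  merged target depends on the past only through merged half-edges. Hence merging commutes with
  every step of the process.\<close>

lemma bam_ba1: "bam m t = map_pmf (map (\<lambda>(a, b). b div m)) (ba1 t)"
proof (induction t)
  case (Suc t)
  let ?f = "map (\<lambda>(a, b). b div m) :: (nat \<times> nat) list \<Rightarrow> nat list"
  have "map_pmf ?f (ba1 (Suc t)) = bind_pmf (ba1 t) (\<lambda>es. map_pmf (\<lambda>x. ?f es @ [x])
     (map_pmf (\<lambda>x. x div m) (pmf_of_multiset (add_mset t (endpoints es)))))"
    by (simp add: map_bind_pmf map_pmf_comp)
  also have "\<dots> = bind_pmf (ba1 t) (\<lambda>es. map_pmf (\<lambda>x. ?f es @ [x]) (urn m (?f es)))"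
  proof (rule bind_pmf_cong[OF refl])
    fix es assume es: "es \<in> set_pmf (ba1 t)"
    note src = ba1_sources[OF es]
    have len: "length es = t" using arg_cong[OF src, of length] by simp
    have "image_mset (\<lambda>x. x div m) (add_mset t (endpoints es)) = urn_mset m (?f es)"
      unfolding endpoints_eq src urn_mset_def by (simp add: len case_prod_unfold comp_def multiset.map_comp)
    then have "map_pmf (\<lambda>x. x div m) (pmf_of_multiset (add_mset t (endpoints es))) = urn m (?f es)"
      by (simp add: map_pmf_of_multiset urn_def)
    then show "map_pmf (\<lambda>x. ?f es @ [x]) (map_pmf (\<lambda>x. x div m) (pmf_of_multiset (add_mset t (endpoints es))))
       = map_pmf (\<lambda>x. ?f es @ [x]) (urn m (?f es))" by simp
  qed
  also have "\<dots> = bam m (Suc t)" by (simp add: Suc bind_map_pmf)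
  finally show ?case by simp
qed simp

lemma ba_bam: "ba n m = map_pmf (bagraph m) (bam m (n * m))"
proof -
  have "map_pmf (bagraph m) (bam m (n * m)) = map_pmf (\<lambda>es. bagraph m (map (\<lambda>(a, b). b div m) es)) (ba1 (n * m))"
    by (simp add: bam_ba1 map_pmf_comp)
  also have "\<dots> = ba n m"
    unfolding ba_def
  proof (rule map_pmf_cong[OF refl])
    fix es assume es: "es \<in> set_pmf (ba1 (n * m))"
    note src = ba1_sources[OF es]
    have len: "length es = n * m" using arg_cong[OF src, of length] by simp
    have fst: "fst (es ! i) = i" if "i < length es" for i
      using arg_cong[OF src, of "\<lambda>l. l ! i"] that len by simp
    show "bagraph m (map (\<lambda>(a, b). b div m) es)
      = {{a div m, b div m} | a b. (a, b) \<in> set es \<and> a div m \<noteq> b div m}" (is "?L = ?R")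
    proof
      show "?L \<subseteq> ?R"
      proof
        fix x assume "x \<in> ?L"
        then obtain i where i: "i < length es" "x = {i div m, snd (es ! i) div m}" "i div m \<noteq> snd (es ! i) div m"
          by (auto simp: bagraph_def case_prod_unfold)
        have "(i, snd (es ! i)) = es ! i" using fst[OF i(1)] by (metis prod.collapse)
        then have "(i, snd (es ! i)) \<in> set es" using i(1) by simp
        then show "x \<in> ?R" using i by blast
      qed
      show "?R \<subseteq> ?L"
      proof
        fix x assume "x \<in> ?R"
        then obtain a b where ab: "(a, b) \<in> set es" "x = {a div m, b div m}" "a div m \<noteq> b div m" by auto
        then obtain i where i: "i < length es" "es ! i = (a, b)" by (auto simp: in_set_conv_nth)
        then have "a = i" using fst[OF i(1)] by simp
        then show "x \<in> ?L" using ab i unfolding bagraph_def by (auto intro!: exI[of _ i])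
      qed
    qed
  qed
  finally show ?thesis by simp
qed

text \<open>One time step of the stochastic approximation is the attachment of a whole merged node,
  that is, of \<open>m\<close> edges. Their law is kept conditional on the past \<open>bs\<close>,
  and earlier targets \<open>ys\<close> of the same block already change the urn.\<close>

fun block :: "nat \<Rightarrow> nat list \<Rightarrow> nat \<Rightarrow> nat list pmf" where
  "block m bs 0 = return_pmf []"
| "block m bs (Suc j) = bind_pmf (block m bs j) (\<lambda>ys. map_pmf (\<lambda>x. ys @ [x]) (urn m (bs @ ys)))"

lemma bam_add: "bam m (t + j) = bind_pmf (bam m t) (\<lambda>bs. map_pmf ((@) bs) (block m bs j))"
proof (induction j)
  case 0
  show ?case by (simp add: map_pmf_def[symmetric])
next
  case (Suc j)
  have "bam m (t + Suc j) = bind_pmf (bam m (t + j)) (\<lambda>bs. map_pmf (\<lambda>x. bs @ [x]) (urn m bs))" by simp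
  then show ?case
    unfolding Suc by (simp add: bind_assoc_pmf map_bind_pmf bind_map_pmf map_pmf_comp)
qed

lemma finite_block: "finite (set_pmf (block m bs j))"
  by (induction j) (auto simp: finite_urn)

lemma finite_bam: "finite (set_pmf (bam m t))"
  by (induction t) (auto simp: finite_urn)

lemma length_block: "ys \<in> set_pmf (block m bs j) \<Longrightarrow> length ys = j"
  by (induction j arbitrary: ys) auto

definition valid :: "nat \<Rightarrow> nat \<Rightarrow> nat list \<Rightarrow> bool" where
  "valid m n bs \<longleftrightarrow> length bs = n * m \<and> set bs \<subseteq> {0..<n} \<and> (\<forall>i<length bs. bs ! i \<le> i div m)"

lemma set_urn_mset: "m > 0 \<Longrightarrow> set_mset (urn_mset m bs) = {0..length bs div m} \<union> set bs"
proof -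
  assume m: "m > 0"
  have "(\<lambda>i. i div m) ` {0..<Suc (length bs)} = {0..length bs div m}"
  proof
    show "(\<lambda>i. i div m) ` {0..<Suc (length bs)} \<subseteq> {0..length bs div m}" by (auto intro!: div_le_mono)
    show "{0..length bs div m} \<subseteq> (\<lambda>i. i div m) ` {0..<Suc (length bs)}"
    proof
      fix k assume k: "k \<in> {0..length bs div m}"
      then have "k * m \<le> length bs" by (metis atLeastAtMost_iff div_times_less_eq_dividend le_trans mult_le_mono1)
      then show "k \<in> (\<lambda>i. i div m) ` {0..<Suc (length bs)}" using m by (intro image_eqI[of _ _ "k * m"]) auto
    qed
  qed
  then show ?thesis by (simp only: urn_mset_def set_mset_union set_mset_mset set_map set_upt)
qed

lemma block_bound:
  assumes m: "m > 0" and v: "valid m n bs"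
  shows "j \<le> m \<Longrightarrow> ys \<in> set_pmf (block m bs j) \<Longrightarrow> set ys \<subseteq> {0..n}"
proof (induction j arbitrary: ys)
  case (Suc j)
  then obtain ys' x where ys: "ys' \<in> set_pmf (block m bs j)" "x \<in> set_pmf (urn m (bs @ ys'))" "ys = ys' @ [x]" by auto
  have "(n * m + j) div m = n" using m Suc.prems(1) by (simp add: div_mult_self3)
  moreover have "length (bs @ ys') = n * m + j" using v length_block[OF ys(1)] by (simp add: valid_def)
  ultimately have "x \<in> {0..n} \<union> set bs \<union> set ys'"
    using ys(2) by (simp add: urn_def urn_mset_ne set_urn_mset[OF m] del: length_append)
  then show ?case using Suc.IH[OF _ ys(1)] Suc.prems(1) v ys(3) by (auto simp: valid_def)
qed simp

lemma valid_append:
  assumes m: "m > 0" and v: "valid m n bs" and ys: "ys \<in> set_pmf (block m bs m)"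
  shows "valid m (Suc n) (bs @ ys)"
  unfolding valid_def
proof (intro conjI allI impI)
  note len = length_block[OF ys] and bd = block_bound[OF m v order_refl ys]
  show "length (bs @ ys) = Suc n * m" using len v by (simp add: valid_def)
  show "set (bs @ ys) \<subseteq> {0..<Suc n}" using bd v by (fastforce simp: valid_def)
  fix i assume i: "i < length (bs @ ys)"
  show "(bs @ ys) ! i \<le> i div m"
  proof (cases "i < length bs")
    case True
    then show ?thesis using v by (simp add: valid_def nth_append)
  next
    case False
    then have "ys ! (i - length bs) \<in> set ys" using i by simp
    then have "ys ! (i - length bs) \<le> n" using bd by auto
    moreover have "n \<le> i div m" using False v m by (simp add: valid_def less_eq_div_iff_mult_less_eq)
    ultimately show ?thesis using False by (simp add: nth_append)
  qed
qed

lemma bam_Suc_block: "bam m (Suc n * m) = bind_pmf (bam m (n * m)) (\<lambda>bs. map_pmf ((@) bs) (block m bs m))"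
  using bam_add[of m "n * m" m] by (simp add: add.commute)

lemma valid_bam:
  assumes m: "m > 0" shows "bs \<in> set_pmf (bam m (n * m)) \<Longrightarrow> valid m n bs"
proof (induction n arbitrary: bs)
  case 0
  then show ?case by (simp add: valid_def)
next
  case (Suc n)
  then obtain bs' ys where "bs' \<in> set_pmf (bam m (n * m))" "ys \<in> set_pmf (block m bs' m)" "bs = bs' @ ys"
    unfolding bam_Suc_block by auto
  then show ?case using valid_append[OF m Suc.IH] by blast
qed

lemma count_sources:
  assumes m: "m > 0" and j: "j < m"
  shows "count (mset (map (\<lambda>i. i div m) [0..<Suc (n * m + j)])) x = (if x < n then m else if x = n then Suc j else 0)"
proof -
  have "count (mset (map (\<lambda>i. i div m) [0..<Suc (n * m + j)])) x = card {i\<in>{0..<Suc (n * m + j)}. i div m = x}"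
    by (simp only: mset_map mset_upt count_image_mset)
      (simp add: vimage_def Int_def conj_commute del: upt_Suc)
  also have "{i\<in>{0..<Suc (n * m + j)}. i div m = x}
     = (if x < n then {x * m..<x * m + m} else if x = n then {n * m..<Suc (n * m + j)} else {})"
  proof -
    have a: "i div m = x \<longleftrightarrow> x * m \<le> i \<and> i < x * m + m" for i
      using m by (metis add.commute div_nat_eqI dividend_less_div_times div_times_less_eq_dividend mult.commute mult_Suc_right)
    have b: "x * m + m \<le> n * m" if "x < n" using that mult_le_mono1[of "Suc x" n m] by simp
    have c: "n * m + j < x * m" if "x > n" using that j mult_le_mono1[of "Suc n" x m] by simp
    show ?thesis using b c j unfolding a by (cases x n rule: linorder_cases) auto
  qed
  also have "card \<dots> = (if x < n then m else if x = n then Suc j else 0)" by simp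
  finally show ?thesis .
qed

text \<open>The half-edges of a node are its sources, \<open>m\<close> for an old node and, for the
  new node \<open>n\<close>, one per edge up to and including the current one, together with one for
  each time it was a target.\<close>

lemma urn_prob:
  assumes m: "m > 0" and j: "length ys < m" and v: "valid m n bs"
  shows "pmf (urn m (bs @ ys)) x
    = real ((if x < n then m else if x = n then Suc (length ys) else 0) + count_list bs x + count_list ys x)
      / real (2 * (n * m + length ys) + 1)"
proof -
  have len: "length bs = n * m" using v by (simp add: valid_def)
  have "count (urn_mset m (bs @ ys)) x = (if x < n then m else if x = n then Suc (length ys) else 0) + count_list bs x + count_list ys x"
    using count_sources[OF m j, of n x] by (simp add: urn_mset_def len count_mset del: upt_Suc)
  then show ?thesis unfolding urn_def by (simp add: urn_mset_ne size_urn_mset len)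
qed

subsection \<open>Patterns\<close>

type_synonym pat = "(nat option list \<times> nat) list"

definition rk :: "nat set \<Rightarrow> nat \<Rightarrow> nat option" where
  "rk W y = (if y \<in> W then Some (rnk W y) else None)"

definition bout :: "nat \<Rightarrow> nat list \<Rightarrow> nat \<Rightarrow> nat list" where
  "bout m bs x = take m (drop (x * m) bs)"

text \<open>The pattern of a set of blocks: for each block, in increasing order, the ranks of its targets
  (\<open>None\<close> for a target outside the set) and its total indegree.\<close>
definition ptyp :: "nat \<Rightarrow> nat list \<Rightarrow> nat set \<Rightarrow> pat" where
  "ptyp m bs W = map (\<lambda>x. (map (rk W) (bout m bs x), count_list bs x)) (sl W)"

text \<open>Effect on an old pattern of a block with target ranks \<open>\<rho>\<close>: target
  lists never change, only indegrees grow. \<open>unbump\<close> reverses it, and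
  \<open>bump_ok\<close> excludes truncated subtraction.\<close>

definition bump :: "nat option list \<Rightarrow> pat \<Rightarrow> pat" where
  "bump \<rho> H = map (\<lambda>i. (fst (H ! i), snd (H ! i) + count_list \<rho> (Some i))) [0..<length H]"

definition unbump :: "nat option list \<Rightarrow> pat \<Rightarrow> pat" where
  "unbump \<rho> H = map (\<lambda>i. (fst (H ! i), snd (H ! i) - count_list \<rho> (Some i))) [0..<length H]"

definition bump_ok :: "nat option list \<Rightarrow> pat \<Rightarrow> bool" where
  "bump_ok \<rho> H \<longleftrightarrow> (\<forall>i<length H. count_list \<rho> (Some i) \<le> snd (H ! i))"

lemma length_ptyp [simp]: "length (ptyp m bs W) = card W"
  by (simp add: ptyp_def)

lemma length_bump [simp]: "length (bump \<rho> H) = length H" "length (unbump \<rho> H) = length H"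
  by (simp_all add: bump_def unbump_def)

text \<open>The pattern before the new block is determined by the pattern after it and by the
  targets; so the gain terms of the drift have one predecessor for each target list.\<close>

lemma bump_eq_iff: "bump \<rho> G = H \<longleftrightarrow> bump_ok \<rho> H \<and> G = unbump \<rho> H"
proof
  assume "bump \<rho> G = H"
  then show "bump_ok \<rho> H \<and> G = unbump \<rho> H"
    by (auto simp: bump_def unbump_def bump_ok_def intro!: nth_equalityI prod_eqI)
next
  assume "bump_ok \<rho> H \<and> G = unbump \<rho> H"
  then show "bump \<rho> G = H"
    by (auto simp: bump_def unbump_def bump_ok_def intro!: nth_equalityI prod_eqI)
qed

lemma bump_id: "(\<And>i. i < length H \<Longrightarrow> Some i \<notin> set \<rho>) \<Longrightarrow> bump \<rho> H = H"
  by (auto simp: bump_def count_list_0_iff intro!: nth_equalityI prod_eqI)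

lemma rk_eq_Some_iff:
  assumes "finite W" "i < card W" shows "rk W y = Some i \<longleftrightarrow> y = sl W ! i"
  using nth_rnk[OF assms(1), of y] rnk_nth[OF assms] sl_nth_mem[OF assms] by (auto simp: rk_def)

lemma rk_range: "finite W \<Longrightarrow> rk W y = Some i \<Longrightarrow> i < card W"
  using nth_rnk[of W y] by (auto simp: rk_def split: if_splits)

lemma sl_insert_top:
  assumes "W \<subseteq> {0..<n}" shows "sl (insert n W) = sl W @ [n]"
proof -
  have fW: "finite W" using assms finite_subset by blast
  have "sorted_wrt (<) (sl W @ [n])"
    using strict_sorted_list_of_set[of W] assms fW by (auto simp: sorted_wrt_append)
  moreover have "set (sl W @ [n]) = insert n W" using fW by auto
  ultimately show ?thesis by (metis sorted_list_of_set.idem_if_sorted_distinct strict_sorted_iff)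
qed

lemma rk_insert_top:
  assumes "W \<subseteq> {0..<n}" "y \<noteq> n" shows "rk (insert n W) y = rk W y"
proof -
  have "{w \<in> insert n W. w < y} = {w \<in> W. w < y}" if "y \<in> W" using that assms by auto
  then show ?thesis using assms by (auto simp: rk_def rnk_def)
qed

lemma count_list_map_eq:
  assumes "\<And>y. f y = b \<longleftrightarrow> y = a" shows "count_list (map f ys) b = count_list ys a"
  by (induction ys) (use assms in auto)

lemma bout_append:
  assumes "length bs = n * m" "x < n" shows "bout m (bs @ ys) x = bout m bs x"
proof -
  have "x * m + m \<le> n * m" using mult_le_mono1[of "Suc x" n m] assms(2) by simp
  then show ?thesis using assms(1) by (simp add: bout_def)
qed

text \<open>Ranks are taken in \<open>insert n W\<close> so that the same target list also describes
  the set containing the new node. Since \<open>n\<close> is the largest element, its rank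
  \<open>card W\<close> lies beyond the pattern of \<open>W\<close> and \<open>bump\<close> ignores
  it.\<close>

lemma ptyp_append_old:
  assumes v: "valid m n bs" and W: "W \<subseteq> {0..<n}"
  shows "ptyp m (bs @ ys) W = bump (map (rk (insert n W)) ys) (ptyp m bs W)"
proof -
  have len: "length bs = n * m" using v by (simp add: valid_def)
  have fW: "finite W" using W finite_subset by blast
  show ?thesis
  proof (rule nth_equalityI)
    fix i assume "i < length (ptyp m (bs @ ys) W)"
    then have i: "i < card W" by simp
    then have lt: "sl W ! i < n" using sl_nth_mem[OF fW] W by fastforce
    have nW: "n \<notin> W" using W by auto
    have "sl (insert n W) ! i = sl W ! i" using sl_insert_top[OF W] i by (simp add: nth_append)
    moreover have "i < card (insert n W)" using i fW nW by simp
    ultimately have "rk (insert n W) y = Some i \<longleftrightarrow> y = sl W ! i" for y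
      using rk_eq_Some_iff[of "insert n W" i y] fW by simp
    then have "count_list (map (rk (insert n W)) ys) (Some i) = count_list ys (sl W ! i)"
      by (rule count_list_map_eq)
    then show "ptyp m (bs @ ys) W ! i = bump (map (rk (insert n W)) ys) (ptyp m bs W) ! i"
      using i by (simp add: ptyp_def bump_def bout_append[OF len lt])
  qed simp
qed

lemma ptyp_append_new:
  assumes v: "valid m n bs" and W: "W \<subseteq> {0..<n}" and ys: "length ys = m"
  shows "ptyp m (bs @ ys) (insert n W) = (let \<rho> = map (rk (insert n W)) ys in
     bump \<rho> (ptyp m bs W) @ [(\<rho>, count_list \<rho> (Some (card W)))])"
proof -
  have len: "length bs = n * m" using v by (simp add: valid_def)
  have fW: "finite W" using W finite_subset by blast
  have nW: "n \<notin> W" using W by auto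
  define \<rho> where "\<rho> = map (rk (insert n W)) ys"
  have outn: "bout m (bs @ ys) n = ys" using len ys by (simp add: bout_def)
  have "count_list bs n = 0" using v by (auto simp: valid_def count_list_0_iff)
  moreover have "count_list \<rho> (Some (card W)) = count_list ys n"
  proof -
    have "sl (insert n W) ! card W = n" using sl_insert_top[OF W] by (simp add: nth_append)
    then have "rk (insert n W) y = Some (card W) \<longleftrightarrow> y = n" for y
      using rk_eq_Some_iff[of "insert n W" "card W" y] fW nW by simp
    then show ?thesis unfolding \<rho>_def by (rule count_list_map_eq)
  qed
  moreover have "map (\<lambda>x. (map (rk (insert n W)) (bout m (bs @ ys) x), count_list (bs @ ys) x)) (sl W) = ptyp m (bs @ ys) W"
    unfolding ptyp_def
  proof (rule map_cong[OF refl], rule prod_eqI)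
    fix x assume "x \<in> set (sl W)"
    then have x: "x < n" using fW W by auto
    have "set (bout m bs x) \<subseteq> set bs" unfolding bout_def by (meson set_drop_subset set_take_subset subset_trans)
    then have "y \<noteq> n" if "y \<in> set (bout m bs x)" for y using that v by (auto simp: valid_def)
    then show "fst (map (rk (insert n W)) (bout m (bs @ ys) x), count_list (bs @ ys) x)
      = fst (map (rk W) (bout m (bs @ ys) x), count_list (bs @ ys) x)"
      using rk_insert_top[OF W] by (simp add: bout_append[OF len x])
  qed simp
  ultimately have "ptyp m (bs @ ys) (insert n W) = ptyp m (bs @ ys) W @ [(\<rho>, count_list \<rho> (Some (card W)))]"
    unfolding ptyp_def sl_insert_top[OF W] by (simp add: outn \<rho>_def)
  then show ?thesis using ptyp_append_old[OF v W, of ys] by (simp add: \<rho>_def Let_def)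
qed

subsection \<open>Law of the attachments of a new block\<close>

text \<open>Urn weight of rank \<open>i\<close> given the indegrees \<open>ds\<close> and the
  earlier targets \<open>\<rho>\<close> of the same block. The value \<open>i = length ds\<close> is
  the rank of the new node, whose own half-edges so far number
  \<open>Suc (length \<rho>)\<close>.\<close>

definition wtS :: "nat \<Rightarrow> nat list \<Rightarrow> nat option list \<Rightarrow> nat \<Rightarrow> real" where
  "wtS m ds \<rho> i = real (if i < length ds then m + ds ! i + count_list \<rho> (Some i)
     else Suc (length \<rho>) + count_list \<rho> (Some i))"

definition tot :: "nat \<Rightarrow> nat \<Rightarrow> nat option list \<Rightarrow> real" where
  "tot m n \<rho> = real (2 * (n * m + length \<rho>) + 1)"

fun patt :: "nat \<Rightarrow> nat \<Rightarrow> nat list \<Rightarrow> nat option list \<Rightarrow> nat option \<Rightarrow> real" where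
  "patt m n ds \<rho> (Some i) = (if i \<le> length ds then wtS m ds \<rho> i / tot m n \<rho> else 0)"
| "patt m n ds \<rho> None = 1 - (\<Sum>i\<le>length ds. wtS m ds \<rho> i / tot m n \<rho>)"

definition pblock :: "nat \<Rightarrow> nat \<Rightarrow> nat list \<Rightarrow> nat option list \<Rightarrow> real" where
  "pblock m n ds \<rho> = (\<Prod>j<length \<rho>. patt m n ds (take j \<rho>) (\<rho> ! j))"

lemma pblock_snoc: "pblock m n ds (\<rho> @ [r]) = pblock m n ds \<rho> * patt m n ds \<rho> r"
proof -
  have "(\<Prod>j<length \<rho>. patt m n ds (take j \<rho>) ((\<rho> @ [r]) ! j)) = (\<Prod>j<length \<rho>. patt m n ds (take j \<rho>) (\<rho> ! j))"
    by (rule prod.cong) (auto simp: nth_append)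
  then show ?thesis by (simp add: pblock_def)
qed

text \<open>The weights of the members of \<open>insert n W\<close> depend on the past only through
  the indegrees recorded in the pattern, and \<open>None\<close> takes the remaining probability.
  Thus the conditional law of the targets is a function of the pattern, which closes the drift
  equations.\<close>

lemma urn_rk_prob:
  assumes m: "m > 0" and v: "valid m n bs" and W: "W \<subseteq> {0..<n}" and j: "length ys < m"
  shows "measure_pmf.prob (urn m (bs @ ys)) {x. rk (insert n W) x = r}
     = patt m n (map (count_list bs) (sl W)) (map (rk (insert n W)) ys) r"
proof -
  let ?U = "urn m (bs @ ys)" and ?W = "insert n W" and ?ds = "map (count_list bs) (sl W)"
  let ?\<rho> = "map (rk (insert n W)) ys"
  have fW: "finite W" using W finite_subset by blast
  have nW: "n \<notin> W" using W by auto
  have S: "measure_pmf.prob ?U {x. rk ?W x = Some i} = patt m n ?ds ?\<rho> (Some i)" for i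
  proof (cases "i \<le> card W")
    case True
    then have i: "i < card ?W" using fW nW by simp
    have eq: "rk ?W x = Some i \<longleftrightarrow> x = sl ?W ! i" for x using rk_eq_Some_iff[of ?W i x] i fW by simp
    have cnt: "count_list ?\<rho> (Some i) = count_list ys (sl ?W ! i)" using eq by (rule count_list_map_eq)
    have "{x. rk ?W x = Some i} = {sl ?W ! i}" using eq by auto
    then have "measure_pmf.prob ?U {x. rk ?W x = Some i} = pmf ?U (sl ?W ! i)" by (simp add: measure_pmf_single)
    also have "\<dots> = patt m n ?ds ?\<rho> (Some i)"
    proof (cases "i < card W")
      case True
      have "sl ?W ! i = sl W ! i" using True sl_insert_top[OF W] by (simp add: nth_append)
      moreover have "sl W ! i < n" using sl_nth_mem[OF fW True] W by auto
      ultimately show ?thesis using True cnt unfolding urn_prob[OF m j v] by (simp add: wtS_def tot_def)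
    next
      case False
      then have ic: "i = card W" using \<open>i \<le> card W\<close> by simp
      have "sl ?W ! i = n" using ic sl_insert_top[OF W] by (simp add: nth_append)
      moreover have "count_list bs n = 0" using v by (auto simp: valid_def count_list_0_iff)
      ultimately show ?thesis using ic cnt unfolding urn_prob[OF m j v] by (simp add: wtS_def tot_def)
    qed
    finally show ?thesis .
  next
    case False
    have "rk ?W x \<noteq> Some i" for x using rk_range[of ?W x i] fW nW False by auto
    then show ?thesis using False by simp
  qed
  show ?thesis
  proof (cases r)
    case (Some i)
    then show ?thesis using S by simp
  next
    case None
    have "{x. rk ?W x \<noteq> None} = (\<Union>i\<le>card W. {x. rk ?W x = Some i})"
      using rk_range[of ?W] fW nW by (auto simp: less_Suc_eq_le)
    then have "measure_pmf.prob ?U {x. rk ?W x \<noteq> None} = (\<Sum>i\<le>card W. measure_pmf.prob ?U {x. rk ?W x = Some i})"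
      by (simp only:) (rule measure_pmf.finite_measure_finite_Union, auto simp: disjoint_family_on_def)
    also have "\<dots> = (\<Sum>i\<le>card W. patt m n ?ds ?\<rho> (Some i))" using S by simp
    finally have "measure_pmf.prob ?U {x. rk ?W x = None} = 1 - (\<Sum>i\<le>card W. patt m n ?ds ?\<rho> (Some i))"
      by (subst prob_not) simp
    then show ?thesis using None by simp
  qed
qed

lemma block_prob:
  assumes m: "m > 0" and v: "valid m n bs" and W: "W \<subseteq> {0..<n}"
  shows "length \<rho> \<le> m \<Longrightarrow> measure_pmf.prob (block m bs (length \<rho>)) {ys. map (rk (insert n W)) ys = \<rho>}
     = pblock m n (map (count_list bs) (sl W)) \<rho>"
proof (induction \<rho> rule: rev_induct)
  case Nil
  then show ?case by (simp add: pblock_def)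
next
  case (snoc r \<rho>)
  let ?f = "map (rk (insert n W))"
  have "measure_pmf.prob (block m bs (length (\<rho> @ [r]))) {ys. ?f ys = \<rho> @ [r]}
    = pE (block m bs (Suc (length \<rho>))) (\<lambda>ys. if ?f ys = \<rho> @ [r] then 1 else 0)"
    by (simp add: pE_indicator)
  also have "\<dots> = pE (block m bs (length \<rho>)) (\<lambda>ys. pE (map_pmf (\<lambda>x. ys @ [x]) (urn m (bs @ ys)))
      (\<lambda>ys. if ?f ys = \<rho> @ [r] then 1 else 0))"
    unfolding block.simps by (rule pE_bind) (auto simp: finite_block finite_urn)
  also have "\<dots> = pE (block m bs (length \<rho>)) (\<lambda>ys. (if ?f ys = \<rho> then 1 else 0) * patt m n (map (count_list bs) (sl W)) \<rho> r)"
  proof (rule pE_cong)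
    fix ys assume "ys \<in> set_pmf (block m bs (length \<rho>))"
    then have len: "length ys < m" using length_block snoc.prems by fastforce
    have "pE (map_pmf (\<lambda>x. ys @ [x]) (urn m (bs @ ys))) (\<lambda>ys. if ?f ys = \<rho> @ [r] then 1 else 0 :: real)
      = pE (urn m (bs @ ys)) (\<lambda>x. if ?f ys = \<rho> \<and> rk (insert n W) x = r then 1 else 0)" by simp
    also have "\<dots> = (if ?f ys = \<rho> then 1 else 0) * measure_pmf.prob (urn m (bs @ ys)) {x. rk (insert n W) x = r}"
      by (cases "?f ys = \<rho>") (simp_all add: pE_indicator)
    also have "\<dots> = (if ?f ys = \<rho> then 1 else 0) * patt m n (map (count_list bs) (sl W)) \<rho> r"
      using urn_rk_prob[OF m v W len] by simp
    finally show "pE (map_pmf (\<lambda>x. ys @ [x]) (urn m (bs @ ys))) (\<lambda>ys. if ?f ys = \<rho> @ [r] then 1 else 0 :: real)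
      = (if ?f ys = \<rho> then 1 else 0) * patt m n (map (count_list bs) (sl W)) \<rho> r" .
  qed
  also have "\<dots> = pblock m n (map (count_list bs) (sl W)) (\<rho> @ [r])"
    using snoc by (simp add: pE_indicator pblock_snoc)
  finally show ?case .
qed

definition kS :: "nat option list \<Rightarrow> nat" where
  "kS \<rho> = length (filter (\<lambda>r. r \<noteq> None) \<rho>)"

lemma tot_limit:
  assumes m: "m > 0" shows "(\<lambda>n. 1 / tot m n \<rho>) \<longlonglongrightarrow> 0" "(\<lambda>n. real n * (1 / tot m n \<rho>)) \<longlonglongrightarrow> 1 / (2 * real m)"
proof -
  have l: "(\<lambda>n. 2 * real m + (2 * length \<rho> + 1) / real n) \<longlonglongrightarrow> 2 * real m + 0"
    by (intro tendsto_add tendsto_const lim_const_over_n)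
  have "(\<lambda>n. 1 / (2 * real m + (2 * length \<rho> + 1) / real n)) \<longlonglongrightarrow> 1 / (2 * real m + 0)"
    by (intro tendsto_divide tendsto_const l) (use m in simp)
  moreover have "\<forall>\<^sub>F n in sequentially. 1 / (2 * real m + (2 * length \<rho> + 1) / real n) = real n * (1 / tot m n \<rho>)"
    using eventually_gt_at_top[of 0]
  proof eventually_elim
    case (elim n)
    have "tot m n \<rho> = real n * (2 * real m + (2 * length \<rho> + 1) / real n)"
      using elim by (simp add: tot_def field_simps)
    then show ?case using elim by simp
  qed
  ultimately show 2: "(\<lambda>n. real n * (1 / tot m n \<rho>)) \<longlonglongrightarrow> 1 / (2 * real m)"
    using Lim_transform_eventually by force
  have "(\<lambda>n. inverse (real n) * (real n * (1 / tot m n \<rho>))) \<longlonglongrightarrow> 0 * (1 / (2 * real m))"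
    by (intro tendsto_mult lim_inverse_n 2)
  moreover have "\<forall>\<^sub>F n in sequentially. inverse (real n) * (real n * (1 / tot m n \<rho>)) = 1 / tot m n \<rho>"
    using eventually_gt_at_top[of 0] by eventually_elim simp
  ultimately show "(\<lambda>n. 1 / tot m n \<rho>) \<longlonglongrightarrow> 0" using Lim_transform_eventually by force
qed

text \<open>A target of given rank has probability of order at most \<open>1 / n\<close>, and a
  target outside the set has probability tending to 1.\<close>

lemma pblock_limit:
  assumes m: "m > 0"
  shows "\<exists>\<kappa>\<ge>0. (\<lambda>n. real n ^ kS \<rho> * pblock m n ds \<rho>) \<longlonglongrightarrow> \<kappa>"
proof (induction \<rho> rule: rev_induct)
  case Nil
  show ?case by (intro exI[of _ 1]) (simp add: kS_def pblock_def)
next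
  case (snoc r \<rho>)
  then obtain \<kappa> where \<kappa>: "\<kappa> \<ge> 0" "(\<lambda>n. real n ^ kS \<rho> * pblock m n ds \<rho>) \<longlonglongrightarrow> \<kappa>" by auto
  have "\<exists>\<mu>\<ge>0. (\<lambda>n. (if r = None then 1 else real n) * patt m n ds \<rho> r) \<longlonglongrightarrow> \<mu>"
  proof (cases r)
    case None
    have "(\<lambda>n. 1 - (\<Sum>i\<le>length ds. wtS m ds \<rho> i * (1 / tot m n \<rho>))) \<longlonglongrightarrow> 1 - (\<Sum>i\<le>length ds. wtS m ds \<rho> i * 0)"
      by (intro tendsto_diff tendsto_sum tendsto_mult tendsto_const tot_limit[OF m])
    then show ?thesis using None by (intro exI[of _ 1]) simp
  next
    case (Some i)
    show ?thesis
    proof (cases "i \<le> length ds")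
      case True
      have "(\<lambda>n. wtS m ds \<rho> i * (real n * (1 / tot m n \<rho>))) \<longlonglongrightarrow> wtS m ds \<rho> i * (1 / (2 * real m))"
        by (intro tendsto_mult tendsto_const tot_limit[OF m])
      then show ?thesis using Some True
        by (intro exI[of _ "wtS m ds \<rho> i * (1 / (2 * real m))"]) (simp add: mult.commute wtS_def)
    next
      case False
      then show ?thesis using Some by (intro exI[of _ 0]) simp
    qed
  qed
  then obtain \<mu> where \<mu>: "\<mu> \<ge> 0" "(\<lambda>n. (if r = None then 1 else real n) * patt m n ds \<rho> r) \<longlonglongrightarrow> \<mu>" by auto
  have "(\<lambda>n. (real n ^ kS \<rho> * pblock m n ds \<rho>) * ((if r = None then 1 else real n) * patt m n ds \<rho> r)) \<longlonglongrightarrow> \<kappa> * \<mu>"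
    by (intro tendsto_mult \<kappa> \<mu>)
  moreover have "(real n ^ kS \<rho> * pblock m n ds \<rho>) * ((if r = None then 1 else real n) * patt m n ds \<rho> r)
     = real n ^ kS (\<rho> @ [r]) * pblock m n ds (\<rho> @ [r])" for n
    by (simp add: kS_def pblock_snoc)
  ultimately show ?case using \<kappa>(1) \<mu>(1) by (intro exI[of _ "\<kappa> * \<mu>"]) simp
qed

lemma pblock_limit':
  assumes m: "m > 0" and k: "k \<le> kS \<rho>"
  shows "\<exists>\<kappa>\<ge>0. (\<lambda>n. real n ^ k * pblock m n ds \<rho>) \<longlonglongrightarrow> \<kappa>"
proof -
  obtain \<kappa> where \<kappa>: "\<kappa> \<ge> 0" "(\<lambda>n. real n ^ kS \<rho> * pblock m n ds \<rho>) \<longlonglongrightarrow> \<kappa>" using pblock_limit[OF m] by blast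
  have "(\<lambda>n. inverse (real n) ^ (kS \<rho> - k) * (real n ^ kS \<rho> * pblock m n ds \<rho>)) \<longlonglongrightarrow> 0 ^ (kS \<rho> - k) * \<kappa>"
    by (intro tendsto_mult tendsto_power lim_inverse_n \<kappa>)
  moreover have "\<forall>\<^sub>F n in sequentially. inverse (real n) ^ (kS \<rho> - k) * (real n ^ kS \<rho> * pblock m n ds \<rho>)
     = real n ^ k * pblock m n ds \<rho>"
    using eventually_gt_at_top[of 0]
  proof eventually_elim
    case (elim n)
    have "real n ^ kS \<rho> = real n ^ (kS \<rho> - k + k)" using k by simp
    then have eq: "real n ^ kS \<rho> = real n ^ (kS \<rho> - k) * real n ^ k" by (simp only: power_add)
    have "inverse (real n) ^ (kS \<rho> - k) * real n ^ (kS \<rho> - k) = 1"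
      using elim by (simp add: power_mult_distrib[symmetric])
    then show ?case unfolding eq by (metis mult.assoc mult_1)
  qed
  ultimately have "(\<lambda>n. real n ^ k * pblock m n ds \<rho>) \<longlonglongrightarrow> 0 ^ (kS \<rho> - k) * \<kappa>"
    by (rule Lim_transform_eventually)
  then show ?thesis using \<kappa>(1) by (intro exI[of _ "0 ^ (kS \<rho> - k) * \<kappa>"]) simp
qed

subsection \<open>Components of a pattern\<close>

text \<open>The target lists come in reverse order, newest block first.\<close>
fun comps :: "nat option list list \<Rightarrow> nat set set" where
  "comps [] = {}"
| "comps (\<rho> # R) = (let Z = {i. Some i \<in> set \<rho> \<and> i < length R} in
     insert (insert (length R) (\<Union>{B\<in>comps R. B \<inter> Z \<noteq> {}})) {B\<in>comps R. B \<inter> Z = {}})"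

definition ncomp :: "pat \<Rightarrow> nat" where
  "ncomp H = card (comps (rev (map fst H)))"

lemma comps_Union: "\<Union>(comps R) = {0..<length R}"
proof (induction R)
  case (Cons \<rho> R)
  define Z where "Z = {i. Some i \<in> set \<rho> \<and> i < length R}"
  have "\<Union>(comps (\<rho> # R)) = insert (length R) (\<Union>(comps R))"
    unfolding comps.simps Let_def Z_def[symmetric] by blast
  then show ?case using Cons by auto
qed simp

lemma finite_comps: "finite (comps R)"
proof -
  have "comps R \<subseteq> Pow {0..<length R}" using comps_Union[of R] by auto
  then show ?thesis by (rule finite_subset) simp
qed

lemma comps_disjoint: "A \<in> comps R \<Longrightarrow> B \<in> comps R \<Longrightarrow> A \<inter> B \<noteq> {} \<Longrightarrow> A = B"
proof (induction R arbitrary: A B)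
  case (Cons \<rho> R)
  define Z where "Z = {i. Some i \<in> set \<rho> \<and> i < length R}"
  define N where "N = insert (length R) (\<Union>{B\<in>comps R. B \<inter> Z \<noteq> {}})"
  have cs: "comps (\<rho> # R) = insert N {B\<in>comps R. B \<inter> Z = {}}"
    unfolding comps.simps Let_def Z_def[symmetric] N_def by simp
  have nh: "N \<inter> C = {}" if C: "C \<in> comps R" "C \<inter> Z = {}" for C
  proof (rule ccontr)
    assume "N \<inter> C \<noteq> {}"
    then obtain x where x: "x \<in> N" "x \<in> C" by auto
    have "x < length R" using x(2) C(1) comps_Union[of R] by auto
    then obtain B' where "B' \<in> comps R" "B' \<inter> Z \<noteq> {}" "x \<in> B'" using x(1) by (auto simp: N_def)
    then show False using Cons.IH[of B' C] C x by auto
  qed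
  show ?case
    using Cons.prems nh[of A] nh[of B] Cons.IH[of A B] unfolding cs by auto
qed simp

lemma comps_nonempty: "B \<in> comps R \<Longrightarrow> B \<noteq> {}"
  by (induction R arbitrary: B) (auto simp: Let_def)

lemma card_some_le: "card {i. Some i \<in> set \<rho> \<and> P i} \<le> kS \<rho>"
proof -
  have "card {i. Some i \<in> set \<rho> \<and> P i} \<le> card (the ` set (filter (\<lambda>r. r \<noteq> None) \<rho>))"
    by (intro card_mono) (force intro: rev_image_eqI)+
  also have "\<dots> \<le> card (set (filter (\<lambda>r. r \<noteq> None) \<rho>))" by (intro card_image_le) simp
  also have "\<dots> \<le> kS \<rho>" unfolding kS_def by (rule card_length)
  finally show ?thesis .
qed

text \<open>The new component absorbs the old ones that contain a target, and disjoint components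
  need distinct targets, so at most \<open>kS \<rho>\<close> are absorbed. This balances the drift:
  each additional component of the older pattern gains a power of \<open>n\<close> in the count and
  costs one in the attachment probability.\<close>

lemma card_comps_Cons: "card (comps R) + 1 \<le> card (comps (\<rho> # R)) + kS \<rho>" "card (comps (\<rho> # R)) > 0"
proof -
  define Z where "Z = {i. Some i \<in> set \<rho> \<and> i < length R}"
  define N where "N = insert (length R) (\<Union>{B\<in>comps R. B \<inter> Z \<noteq> {}})"
  define hit where "hit = {B\<in>comps R. B \<inter> Z \<noteq> {}}"
  define miss where "miss = {B\<in>comps R. B \<inter> Z = {}}"
  have cs: "comps (\<rho> # R) = insert N miss"
    unfolding comps.simps Let_def Z_def[symmetric] N_def miss_def by simp
  have fin: "finite hit" "finite miss" using finite_comps[of R] by (auto simp: hit_def miss_def)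
  have "N \<notin> miss" using comps_Union[of R] by (auto simp: N_def miss_def)
  then have c1: "card (comps (\<rho> # R)) = card miss + 1" using cs fin by simp
  have "comps R = hit \<union> miss" "hit \<inter> miss = {}" by (auto simp: hit_def miss_def)
  then have c2: "card (comps R) = card hit + card miss" using fin by (simp add: card_Un_disjoint)
  define f where "f B = (SOME i. i \<in> B \<inter> Z)" for B
  have f: "f B \<in> B \<inter> Z" if "B \<in> hit" for B
    using someI_ex[of "\<lambda>i. i \<in> B \<inter> Z"] that unfolding f_def hit_def by blast
  have "inj_on f hit"
  proof (rule inj_onI)
    fix A B assume "A \<in> hit" "B \<in> hit" "f A = f B"
    then have "f A \<in> A \<inter> B" using f[of A] f[of B] by auto
    then show "A = B" using comps_disjoint[of A R B] \<open>A \<in> hit\<close> \<open>B \<in> hit\<close> by (auto simp: hit_def)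
  qed
  moreover have "f ` hit \<subseteq> Z" using f by auto
  moreover have "finite Z" by (simp add: Z_def)
  ultimately have "card hit \<le> card Z" by (rule card_inj_on_le)
  also have "\<dots> \<le> kS \<rho>" unfolding Z_def by (rule card_some_le)
  finally show "card (comps R) + 1 \<le> card (comps (\<rho> # R)) + kS \<rho>" using c1 c2 by simp
  show "card (comps (\<rho> # R)) > 0" using c1 by simp
qed

lemma ncomp_snoc: "ncomp H + 1 \<le> ncomp (H @ [(\<rho>, d)]) + kS \<rho>"
  using card_comps_Cons(1)[of "rev (map fst H)" \<rho>] by (simp add: ncomp_def)

lemma ncomp_pos: "H \<noteq> [] \<Longrightarrow> ncomp H > 0"
  using card_comps_Cons(2) by (cases H rule: rev_cases) (auto simp: ncomp_def simp del: comps.simps)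

lemma ncomp_cong: "map fst H = map fst H' \<Longrightarrow> ncomp H = ncomp H'"
  by (simp add: ncomp_def)

lemma ncomp_unbump: "ncomp (unbump \<rho> H) = ncomp H"
  by (rule ncomp_cong) (auto simp: unbump_def intro!: nth_equalityI)

section \<open>Paths inside a component\<close>

definition pedge :: "nat option list list \<Rightarrow> (nat \<times> nat) set" where
  "pedge R = {(i, j). i < length R \<and> j < length R \<and> (Some j \<in> set (rev R ! i) \<or> Some i \<in> set (rev R ! j))}"

lemma pedge_Cons: "pedge R \<subseteq> pedge (\<rho> # R)"
  by (auto simp: pedge_def nth_append)

lemma pedge_new: "Some i \<in> set \<rho> \<Longrightarrow> i < length R \<Longrightarrow> (i, length R) \<in> pedge (\<rho> # R) \<and> (length R, i) \<in> pedge (\<rho> # R)"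
  by (auto simp: pedge_def nth_append)

lemma relpow_mono_rel:
  fixes R R' :: "('a \<times> 'a) set"
  shows "R \<subseteq> R' \<Longrightarrow> R ^^ k \<subseteq> R' ^^ k"
  by (induction k) auto

lemma relpow_refl_mono:
  fixes R :: "('a \<times> 'a) set"
  assumes "k \<le> l" shows "(R \<union> Id) ^^ k \<subseteq> (R \<union> Id) ^^ l"
  using assms
proof (induction l)
  case (Suc l)
  have "(R \<union> Id) ^^ l \<subseteq> (R \<union> Id) ^^ Suc l" by auto
  then show ?case using Suc by (cases "k = Suc l") auto
qed simp

text \<open>Two members of the newest component are joined through the new node: \<open>L\<close>
  steps, one step to it, one step away from it, \<open>L\<close> steps again. Only a bound in terms
  of the length is needed.\<close>

fun reach_len :: "nat \<Rightarrow> nat" where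
  "reach_len 0 = 0"
| "reach_len (Suc h) = 2 * reach_len h + 2"

lemma comps_connected:
  "B \<in> comps R \<Longrightarrow> i \<in> B \<Longrightarrow> j \<in> B \<Longrightarrow> (i, j) \<in> (pedge R \<union> Id) ^^ reach_len (length R)"
proof (induction R arbitrary: B i j)
  case (Cons \<rho> R)
  define Z where "Z = {i. Some i \<in> set \<rho> \<and> i < length R}"
  define N where "N = insert (length R) (\<Union>{B\<in>comps R. B \<inter> Z \<noteq> {}})"
  have cs: "comps (\<rho> # R) = insert N {B\<in>comps R. B \<inter> Z = {}}"
    unfolding comps.simps Let_def Z_def[symmetric] N_def by simp
  let ?E = "pedge (\<rho> # R) \<union> Id" and ?L = "reach_len (length R)" and ?h = "length R"
  have old: "(i, j) \<in> ?E ^^ ?L" if "A \<in> comps R" "i \<in> A" "j \<in> A" for A i j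
  proof -
    have "(pedge R \<union> Id) ^^ ?L \<subseteq> ?E ^^ ?L" by (rule relpow_mono_rel) (use pedge_Cons in auto)
    then show ?thesis using Cons.IH[OF that] by blast
  qed
  have up: "x \<in> ?E ^^ (2 * ?L + 2)" if "x \<in> ?E ^^ k" "k \<le> 2 * ?L + 2" for x k
    using relpow_refl_mono[OF that(2)] that(1) by blast
  have toh: "(i, ?h) \<in> ?E ^^ (?L + 1) \<and> (?h, i) \<in> ?E ^^ (1 + ?L)" if "i \<in> N" "i \<noteq> ?h" for i
  proof -
    obtain A z where A: "A \<in> comps R" "i \<in> A" "z \<in> A" "z \<in> Z" using \<open>i \<in> N\<close> \<open>i \<noteq> ?h\<close> by (auto simp: N_def)
    have e: "(z, ?h) \<in> ?E ^^ 1" "(?h, z) \<in> ?E ^^ 1" using pedge_new[of z \<rho> R] A(4) by (auto simp: Z_def)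
    show ?thesis using old[OF A(1,2,3)] old[OF A(1,3,2)] e by (auto simp only: relpow_add)
  qed
  have "(i, j) \<in> ?E ^^ (2 * ?L + 2)"
  proof (cases "B = N")
    case False
    then have "B \<in> comps R" using Cons.prems(1) cs by auto
    then show ?thesis using up[OF old[of B i j]] Cons.prems by simp
  next
    case True
    consider "i = ?h" "j = ?h" | "i = ?h" "j \<noteq> ?h" | "i \<noteq> ?h" "j = ?h" | "i \<noteq> ?h" "j \<noteq> ?h" by blast
    then show ?thesis
    proof cases
      case 1
      then have "(i, j) \<in> ?E ^^ 0" by simp
      then show ?thesis by (rule up) simp
    next
      case 2
      then have "(i, j) \<in> ?E ^^ (1 + ?L)" using toh[of j] Cons.prems True by simp
      then show ?thesis by (rule up) simp
    next
      case 3
      then have "(i, j) \<in> ?E ^^ (?L + 1)" using toh[of i] Cons.prems True by simp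
      then show ?thesis by (rule up) simp
    next
      case 4
      then have "(i, ?h) \<in> ?E ^^ (?L + 1)" "(?h, j) \<in> ?E ^^ (1 + ?L)" using toh Cons.prems True by auto
      then have "(i, j) \<in> ?E ^^ ((?L + 1) + (1 + ?L))" unfolding relpow_add[of "?L + 1"] by blast
      then show ?thesis by (rule up) simp
    qed
  qed
  then show ?case by simp
qed simp

text \<open>\<open>comps\<close> looks only at edges from a later block to an earlier one, whereas
  \<open>pedge\<close> ignores the direction. The hypothesis that targets are never later than their
  source reconciles the two.\<close>

lemma comps_closed:
  assumes "\<And>x i. x < length R \<Longrightarrow> Some i \<in> set (rev R ! x) \<Longrightarrow> i \<le> x"
    and "B \<in> comps R" "(i, j) \<in> pedge R" "i \<in> B"
  shows "j \<in> B"
  using assms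
proof (induction R arbitrary: B i j)
  case (Cons \<rho> R)
  define Z where "Z = {i. Some i \<in> set \<rho> \<and> i < length R}"
  define N where "N = insert (length R) (\<Union>{B\<in>comps R. B \<inter> Z \<noteq> {}})"
  have cs: "comps (\<rho> # R) = insert N {B\<in>comps R. B \<inter> Z = {}}"
    unfolding comps.simps Let_def Z_def[symmetric] N_def by simp
  have fwd: "i \<le> x" if "x < length R" "Some i \<in> set (rev R ! x)" for x i
    using Cons.prems(1)[of x i] that by (simp add: nth_append)
  have ZN: "z \<in> N" if "z \<in> Z" for z
  proof -
    have "z \<in> \<Union>(comps R)" using that comps_Union[of R] by (simp add: Z_def)
    then show ?thesis using that by (auto simp: N_def)
  qed
  consider (old) "(i, j) \<in> pedge R" | (hj) "i = length R" "j \<in> Z \<or> j = length R" | (ih) "j = length R" "i \<in> Z"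
  proof -
    have ij: "i < Suc (length R)" "j < Suc (length R)"
      "Some j \<in> set ((rev R @ [\<rho>]) ! i) \<or> Some i \<in> set ((rev R @ [\<rho>]) ! j)"
      using Cons.prems(3) by (auto simp: pedge_def)
    show thesis
    proof (cases "i < length R")
      case True
      show thesis
      proof (cases "j < length R")
        case j: True
        then show thesis using True ij old by (auto simp: pedge_def nth_append)
      next
        case False
        then have "j = length R" using ij by simp
        moreover have "i \<in> Z" using ij(3) True \<open>j = length R\<close> fwd[of i j] by (auto simp: nth_append Z_def)
        ultimately show thesis using ih by blast
      qed
    next
      case False
      then have i: "i = length R" using ij by simp
      show thesis
      proof (cases "j < length R")
        case True
        then have "j \<in> Z" using ij(3) i fwd[of j i] by (auto simp: nth_append Z_def)
        then show thesis using hj i by blast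
      next
        case False
        then show thesis using hj i ij by simp
      qed
    qed
  qed
  then show ?case
  proof cases
    case old
    then have lt: "i < length R" by (simp add: pedge_def)
    show ?thesis
    proof (cases "B = N")
      case True
      then obtain A where A: "A \<in> comps R" "A \<inter> Z \<noteq> {}" "i \<in> A" using Cons.prems(4) lt by (auto simp: N_def)
      then have "j \<in> A" using Cons.IH[OF fwd A(1) old A(3)] by blast
      then show ?thesis using A True by (auto simp: N_def)
    next
      case False
      then have "B \<in> comps R" using Cons.prems(2) cs by auto
      then show ?thesis using Cons.IH[OF fwd _ old Cons.prems(4)] by blast
    qed
  next
    case hj
    have "length R \<in> N" by (simp add: N_def)
    then have "B \<inter> N \<noteq> {}" "N \<in> comps (\<rho> # R)" using Cons.prems(4) hj cs by auto
    then have "B = N" using comps_disjoint Cons.prems(2) by blast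
    then show ?thesis using hj ZN by (auto simp: N_def)
  next
    case ih
    then have "i \<in> N" using ZN by simp
    then have "B \<inter> N \<noteq> {}" "N \<in> comps (\<rho> # R)" using Cons.prems(4) cs by auto
    then have "B = N" using comps_disjoint Cons.prems(2) by blast
    then show ?thesis using ih by (auto simp: N_def)
  qed
qed simp

subsection \<open>Counting occurrences of a pattern\<close>

lemma count_list_bout:
  "length bs = n * m \<Longrightarrow> count_list bs x = (\<Sum>y<n. count_list (bout m bs y) x)"
proof (induction n arbitrary: bs)
  case (Suc n)
  let ?a = "take (n * m) bs" and ?b = "drop (n * m) bs"
  have len: "length ?a = n * m" using Suc.prems by simp
  have "bout m bs y = bout m ?a y" if "y < n" for y using bout_append[OF len that, of ?b] by simp
  moreover have "bout m bs n = ?b" using Suc.prems by (simp add: bout_def)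
  ultimately have "(\<Sum>y<Suc n. count_list (bout m bs y) x) = count_list ?a x + count_list ?b x"
    using Suc.IH[OF len] by simp
  also have "\<dots> = count_list bs x" by (metis append_take_drop_id count_list_append)
  finally show ?case by simp
qed simp

text \<open>Adjacency that may be used only from nodes of indegree at most \<open>D\<close>, so that
  every node has at most \<open>m + D\<close> successors, whatever the maximum degree of the
  graph.\<close>

definition brel :: "nat \<Rightarrow> nat \<Rightarrow> nat \<Rightarrow> nat list \<Rightarrow> (nat \<times> nat) set" where
  "brel m D n bs = {(x, y). x < n \<and> y < n \<and> count_list bs x \<le> D \<and> (y \<in> set (bout m bs x) \<or> x \<in> set (bout m bs y))}"

lemma card_brel:
  assumes "length bs = n * m"
  shows "finite (brel m D n bs `` {x})" "card (brel m D n bs `` {x}) \<le> m + D"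
proof -
  have sub: "brel m D n bs `` {x} \<subseteq> set (bout m bs x) \<union> {y\<in>{..<n}. x \<in> set (bout m bs y)}"
    by (auto simp: brel_def)
  then show "finite (brel m D n bs `` {x})" by (rule finite_subset) simp
  show "card (brel m D n bs `` {x}) \<le> m + D"
  proof (cases "count_list bs x \<le> D")
    case True
    have "card {y\<in>{..<n}. x \<in> set (bout m bs y)} = (\<Sum>y<n. if x \<in> set (bout m bs y) then 1 else 0)"
      by (simp add: sum.inter_filter[symmetric])
    also have "\<dots> \<le> (\<Sum>y<n. count_list (bout m bs y) x)"
      by (intro sum_mono) (auto simp: count_list_0_iff Suc_le_eq neq0_conv[symmetric])
    also have "\<dots> = count_list bs x" using count_list_bout[OF assms] by simp
    finally have "card {y\<in>{..<n}. x \<in> set (bout m bs y)} \<le> D" using True by simp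
    moreover have "card (set (bout m bs x)) \<le> m"
      using card_length[of "bout m bs x"] by (simp add: bout_def)
    moreover have "card (brel m D n bs `` {x}) \<le> card (set (bout m bs x)) + card {y\<in>{..<n}. x \<in> set (bout m bs y)}"
      using card_mono[OF _ sub] card_Un_le[of "set (bout m bs x)" "{y\<in>{..<n}. x \<in> set (bout m bs y)}"] by simp
    ultimately show ?thesis by linarith
  next
    case False
    then have "brel m D n bs `` {x} = {}" by (auto simp: brel_def)
    then show ?thesis by simp
  qed
qed

lemma card_reach:
  assumes fin: "\<And>x. finite (R `` {x})" and bd: "\<And>x. card (R `` {x}) \<le> K"
  shows "finite (((R \<union> Id) ^^ k) `` {x}) \<and> card (((R \<union> Id) ^^ k) `` {x}) \<le> (K + 1) ^ k"
proof (induction k)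
  case (Suc k)
  let ?A = "((R \<union> Id) ^^ k) `` {x}"
  have eq: "((R \<union> Id) ^^ Suc k) `` {x} = (\<Union>y\<in>?A. insert y (R `` {y}))" by auto
  have "card (\<Union>y\<in>?A. insert y (R `` {y})) \<le> (\<Sum>y\<in>?A. card (insert y (R `` {y})))"
    using Suc by (intro card_UN_le) simp
  also have "\<dots> \<le> (\<Sum>y\<in>?A. K + 1)"
  proof (rule sum_mono)
    fix y
    show "card (insert y (R `` {y})) \<le> K + 1" using card_insert_le_m1[of "Suc K" "R `` {y}" y] bd[of y] by simp
  qed
  also have "\<dots> = card ?A * (K + 1)" by simp
  also have "\<dots> \<le> (K + 1) ^ k * (K + 1)" using Suc by (intro mult_le_mono1) simp
  finally show ?case unfolding eq using Suc fin by (simp add: mult.commute)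
qed simp

lemma ptyp_edge:
  assumes v: "valid m n bs" and W: "W \<subseteq> {0..<n}" and H: "ptyp m bs W = H"
    and D: "\<And>i. i < length H \<Longrightarrow> snd (H ! i) \<le> D"
    and e: "(i, j) \<in> pedge (rev (map fst H))"
  shows "(sl W ! i, sl W ! j) \<in> brel m D n bs"
proof -
  have fW: "finite W" using W finite_subset by blast
  have len: "length H = card W" using H by auto
  have ij: "i < card W" "j < card W" "Some j \<in> set (fst (H ! i)) \<or> Some i \<in> set (fst (H ! j))"
    using e len by (auto simp: pedge_def)
  have mem: "sl W ! i < n" "sl W ! j < n" using sl_nth_mem[OF fW] ij W by fastforce+
  have tgt: "sl W ! b \<in> set (bout m bs (sl W ! a))" if ab: "a < card W" "b < card W" "Some b \<in> set (fst (H ! a))" for a b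
  proof -
    obtain y where "y \<in> set (bout m bs (sl W ! a))" "rk W y = Some b"
      using ab H by (auto simp: ptyp_def)
    then show ?thesis using rk_eq_Some_iff[OF fW ab(2)] by simp
  qed
  have "count_list bs (sl W ! i) \<le> D" using D[of i] ij len H by (auto simp: ptyp_def)
  then show ?thesis using mem ij tgt[of i j] tgt[of j i] by (auto simp: brel_def)
qed

text \<open>Indegrees in \<open>H\<close> are bounded, so a component is confined to a set of
  bounded size once one of its vertices is known. The vertex \<open>z\<close> settles one component,
  and each of the other \<open>ncomp H - 1\<close> has at most \<open>n\<close> choices for a
  representative.\<close>

lemma occurrences_through:
  "\<exists>C\<ge>0. \<forall>n bs z. valid m n bs \<longrightarrow>
     real (card {W. W \<subseteq> {0..<n} \<and> z \<in> W \<and> ptyp m bs W = H}) \<le> C * real n ^ (ncomp H - 1)"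
proof -
  define D where "D = sum_list (map snd H)"
  have D: "snd (H ! i) \<le> D" if "i < length H" for i
    unfolding D_def using that by (intro member_le_sum_list) (auto intro!: nth_mem)
  define R where "R = rev (map fst H)"
  define P where "P = comps R"
  define c where "c = ncomp H"
  have cP: "card P = c" by (simp add: P_def R_def c_def ncomp_def)
  define L where "L = reach_len (length R)"
  define K where "K = (m + D + 1) ^ L"
  \<comment> \<open>\<open>K\<close> bounds the number of vertices within reach of one
    representative, so \<open>W\<close> is one of at most this many subsets of a union of
    \<open>c\<close> such sets.\<close>
  define C where "C = real (2 ^ (c * K))"
  have "real (card {W. W \<subseteq> {0..<n} \<and> z \<in> W \<and> ptyp m bs W = H}) \<le> C * real n ^ (c - 1)" if v: "valid m n bs" for n bs z
  proof -
    have len: "length bs = n * m" using v by (simp add: valid_def)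
    define Bl where "Bl x = ((brel m D n bs \<union> Id) ^^ L) `` {x}" for x
    have Bl: "finite (Bl x)" "card (Bl x) \<le> K" for x
      using card_reach[of "brel m D n bs" "m + D" L x] card_brel[OF len] unfolding Bl_def K_def by auto
    define Zs where "Zs = {zs. set zs \<subseteq> {0..<n} \<and> length zs = c - 1}"
    have fZ: "finite Zs" and cZ: "card Zs = n ^ (c - 1)"
      using finite_lists_length_eq[of "{0..<n}" "c - 1"] card_lists_length_eq[of "{0..<n}" "c - 1"] by (auto simp: Zs_def)
    define U where "U zs = (\<Union>y\<in>set (z # zs). Bl y)" for zs
    have sub: "{W. W \<subseteq> {0..<n} \<and> z \<in> W \<and> ptyp m bs W = H} \<subseteq> (\<Union>zs\<in>Zs. Pow (U zs))"
    proof clarify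
      fix W assume W: "W \<subseteq> {0..<n}" "z \<in> W" and H: "H = ptyp m bs W"
      have fW: "finite W" using W finite_subset by blast
      have h: "length R = card W" by (simp add: R_def H)
      have conn: "sl W ! j \<in> Bl (sl W ! i)" if "B \<in> P" "i \<in> B" "j \<in> B" for B i j
      proof -
        have "(i, j) \<in> (pedge R \<union> Id) ^^ L" using comps_connected that unfolding P_def L_def by blast
        moreover have "(i, j) \<in> (pedge R \<union> Id) ^^ k \<Longrightarrow> (sl W ! i, sl W ! j) \<in> (brel m D n bs \<union> Id) ^^ k" for k j
        proof (induction k arbitrary: j)
          case (Suc k)
          then obtain y where y: "(i, y) \<in> (pedge R \<union> Id) ^^ k" "(y, j) \<in> pedge R \<union> Id" by auto
          have "(sl W ! y, sl W ! j) \<in> brel m D n bs \<union> Id"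
            using y(2) ptyp_edge[OF v W(1) H[symmetric] D, of y j] by (auto simp: R_def)
          then show ?case using Suc.IH[OF y(1)] by auto
        qed simp
        ultimately show ?thesis by (simp add: Bl_def)
      qed
      define i0 where "i0 = rnk W z"
      have i0: "i0 < card W" "sl W ! i0 = z" using nth_rnk[OF fW W(2)] by (auto simp: i0_def)
      then have "i0 \<in> \<Union>P" using comps_Union[of R] h by (simp add: P_def)
      then obtain B0 where B0: "B0 \<in> P" "i0 \<in> B0" by auto
      have fP: "finite P" by (simp add: P_def finite_comps)
      obtain Bs where Bs: "set Bs = P - {B0}" "distinct Bs" using finite_distinct_list[of "P - {B0}"] fP by auto
      have lB: "length Bs = c - 1" using distinct_card[OF Bs(2)] Bs(1) B0 fP cP by simp
      define zs where "zs = map (\<lambda>B. sl W ! (SOME i. i \<in> B)) Bs"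
      have some: "(SOME i. i \<in> B) \<in> B" if "B \<in> P" for B
        using comps_nonempty[of B R] that by (simp add: P_def some_in_eq)
      have "zs \<in> Zs"
      proof -
        have inn: "sl W ! (SOME i. i \<in> B) \<in> {0..<n}" if "B \<in> P" for B
        proof -
          have idx: "(SOME i. i \<in> B) < card W" using some[OF that] that comps_Union[of R] h by (auto simp: P_def)
          show ?thesis by (rule subsetD[OF W(1) sl_nth_mem[OF fW idx]])
        qed
        have "set zs \<subseteq> {0..<n}" unfolding zs_def set_map Bs(1)
        proof (rule image_subsetI)
          fix B assume "B \<in> P - {B0}"
          then show "sl W ! (SOME i. i \<in> B) \<in> {0..<n}" by (intro inn) simp
        qed
        then show ?thesis using lB by (simp add: Zs_def zs_def)
      qed
      moreover have "W \<subseteq> U zs"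
      proof
        fix w assume w: "w \<in> W"
        define i where "i = rnk W w"
        have i: "i < card W" "sl W ! i = w" using nth_rnk[OF fW w] by (auto simp: i_def)
        then have "i \<in> \<Union>P" using comps_Union[of R] h by (simp add: P_def)
        then obtain B where B: "B \<in> P" "i \<in> B" by auto
        show "w \<in> U zs"
        proof (cases "B = B0")
          case True
          then show ?thesis using conn[OF B0(1) B0(2), of i] B i i0 by (simp add: U_def)
        next
          case False
          then have "B \<in> set Bs" using B Bs by simp
          moreover have "w \<in> Bl (sl W ! (SOME i. i \<in> B))" using conn[OF B(1) some[OF B(1)] B(2)] i by simp
          ultimately show ?thesis by (auto simp: U_def zs_def)
        qed
      qed
      ultimately show "W \<in> (\<Union>zs\<in>Zs. Pow (U zs))" by auto
    qed
    show ?thesis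
    proof (cases "c = 0")
      case True
      have "{W. W \<subseteq> {0..<n} \<and> z \<in> W \<and> ptyp m bs W = H} = {}"
      proof -
        have "H = []" using True ncomp_pos[of H] by (auto simp: c_def)
        then have "card W = 0" if "ptyp m bs W = H" for W using that by (metis length_ptyp list.size(3))
        then show ?thesis using finite_subset by fastforce
      qed
      then show ?thesis by (simp only:) (simp add: C_def)
    next
      case False
      have cU: "card (U zs) \<le> c * K" if "zs \<in> Zs" for zs
      proof -
        have "card (U zs) \<le> (\<Sum>y\<in>set (z # zs). card (Bl y))" unfolding U_def by (rule card_UN_le) simp
        also have "\<dots> \<le> (\<Sum>y\<in>set (z # zs). K)" by (intro sum_mono Bl)
        also have "\<dots> = card (set (z # zs)) * K" by simp
        also have "\<dots> \<le> c * K" using card_length[of "z # zs"] that False by (intro mult_le_mono1) (auto simp: Zs_def)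
        finally show ?thesis .
      qed
      have fU: "finite (U zs)" for zs using Bl by (simp add: U_def)
      have "card {W. W \<subseteq> {0..<n} \<and> z \<in> W \<and> ptyp m bs W = H} \<le> card (\<Union>zs\<in>Zs. Pow (U zs))"
        using sub fZ fU by (intro card_mono) auto
      also have "\<dots> \<le> (\<Sum>zs\<in>Zs. card (Pow (U zs)))" by (rule card_UN_le[OF fZ])
      also have "\<dots> \<le> (\<Sum>zs\<in>Zs. 2 ^ (c * K))"
        by (rule sum_mono) (use cU fU in \<open>simp add: card_Pow\<close>)
      also have "\<dots> = n ^ (c - 1) * 2 ^ (c * K)" by (simp add: cZ)
      finally have "real (card {W. W \<subseteq> {0..<n} \<and> z \<in> W \<and> ptyp m bs W = H}) \<le> real (n ^ (c - 1) * 2 ^ (c * K))"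
        by (simp only: of_nat_le_iff)
      then show ?thesis by (simp add: C_def mult.commute)
    qed
  qed
  then show ?thesis unfolding c_def by (intro exI[of _ C]) (simp add: C_def)
qed

text \<open>Ensures that the pattern without its last block has at least \<open>c - 1\<close>
  components, so that its count can be compared with \<open>n ^ (c - 1)\<close>.\<close>

lemma ncomp_snoc_ge: "ncomp (G @ [(\<rho>, d)]) \<le> ncomp G + 1"
proof -
  let ?R = "rev (map fst G)"
  define Z where "Z = {i. Some i \<in> set \<rho> \<and> i < length ?R}"
  define N where "N = insert (length ?R) (\<Union>{B\<in>comps ?R. B \<inter> Z \<noteq> {}})"
  have cs: "comps (\<rho> # ?R) = insert N {B\<in>comps ?R. B \<inter> Z = {}}"
    unfolding comps.simps Let_def Z_def[symmetric] N_def by simp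
  have "card (insert N {B\<in>comps ?R. B \<inter> Z = {}}) \<le> card (insert N (comps ?R))"
    using finite_comps[of ?R] by (intro card_mono) auto
  also have "\<dots> \<le> Suc (card (comps ?R))" by (rule card_insert_le_m1) auto
  finally show ?thesis using cs by (simp add: ncomp_def del: comps.simps)
qed

section \<open>Pattern counts: size, jumps and drift\<close>

definition Xc :: "nat \<Rightarrow> pat \<Rightarrow> nat \<Rightarrow> nat list \<Rightarrow> real" where
  "Xc m H n bs = real (card {W. W \<subseteq> {0..<n} \<and> ptyp m bs W = H})"

lemma Xc_sum: "Xc m H n bs = (\<Sum>W\<in>Pow {0..<n}. if ptyp m bs W = H then 1 else 0)"
proof -
  have "{W. W \<subseteq> {0..<n} \<and> ptyp m bs W = H} = {W\<in>Pow {0..<n}. ptyp m bs W = H}" by auto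
  then show ?thesis by (simp add: Xc_def sum.inter_filter[symmetric])
qed

lemma finite_sub: "finite {W. W \<subseteq> {0..<n :: nat} \<and> P W}"
  by (rule finite_subset[of _ "Pow {0..<n}"]) auto

text \<open>Summing over the \<open>n\<close> vertices through which an occurrence may pass costs
  one more factor \<open>n\<close>.\<close>

lemma Xc_bound:
  assumes H: "H \<noteq> []"
    and C: "\<And>n bs z. valid m n bs \<Longrightarrow>
      real (card {W. W \<subseteq> {0..<n} \<and> z \<in> W \<and> ptyp m bs W = H}) \<le> C * real n ^ (ncomp H - 1)"
    and v: "valid m n bs"
  shows "Xc m H n bs \<le> C * real n ^ ncomp H"
proof -
  let ?S = "\<lambda>z. {W. W \<subseteq> {0..<n} \<and> z \<in> W \<and> ptyp m bs W = H}"
  have "{W. W \<subseteq> {0..<n} \<and> ptyp m bs W = H} \<subseteq> (\<Union>z<n. ?S z)"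
  proof clarify
    fix W assume W: "W \<subseteq> {0..<n}" "H = ptyp m bs W"
    have "W \<noteq> {}" using H W(2) by (auto simp: ptyp_def)
    then show "W \<in> (\<Union>z<n. {Wa. Wa \<subseteq> {0..<n} \<and> z \<in> Wa \<and> ptyp m bs Wa = ptyp m bs W})" using W(1) by auto
  qed
  then have "card {W. W \<subseteq> {0..<n} \<and> ptyp m bs W = H} \<le> card (\<Union>z<n. ?S z)"
    by (intro card_mono) (auto simp: finite_sub)
  also have "\<dots> \<le> (\<Sum>z<n. card (?S z))" by (rule card_UN_le) simp
  finally have "Xc m H n bs \<le> real (\<Sum>z<n. card (?S z))" unfolding Xc_def by (simp only: of_nat_le_iff)
  also have "\<dots> = (\<Sum>z<n. real (card (?S z)))" by simp
  also have "\<dots> \<le> (\<Sum>z<n. C * real n ^ (ncomp H - 1))" by (intro sum_mono C[OF v])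
  also have "\<dots> = C * (real n * real n ^ (ncomp H - 1))" by simp
  also have "real n * real n ^ (ncomp H - 1) = real n ^ ncomp H"
    using ncomp_pos[OF H] by (metis Suc_pred' power_Suc)
  finally show ?thesis .
qed

lemma ptyp_unchanged:
  assumes v: "valid m n bs" and W: "W \<subseteq> {0..<n}" and d: "W \<inter> set ys = {}"
  shows "ptyp m (bs @ ys) W = ptyp m bs W"
proof -
  have fW: "finite W" using W finite_subset by blast
  have nW: "n \<notin> W" using W by auto
  have "Some i \<notin> set (map (rk (insert n W)) ys)" if "i < length (ptyp m bs W)" for i
  proof
    assume "Some i \<in> set (map (rk (insert n W)) ys)"
    then obtain y where y: "y \<in> set ys" "rk (insert n W) y = Some i" by auto
    have i: "i < card W" using that by simp
    then have "y = sl (insert n W) ! i" using rk_eq_Some_iff[of "insert n W" i y] y fW nW by simp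
    then have "y \<in> W" using i sl_insert_top[OF W] sl_nth_mem[OF fW i] by (simp add: nth_append)
    then show False using d y by auto
  qed
  then show ?thesis unfolding ptyp_append_old[OF v W] by (rule bump_id)
qed

text \<open>Only sets containing a target or the new node can change status: at most
  \<open>m\<close> vertices for occurrences lost and \<open>m + 1\<close> for those gained, whence
  \<open>2 * m + 1\<close>. The power of 2 comes from \<open>Suc n \<le> 2 * n\<close>.\<close>

lemma Xc_jump:
  assumes m: "m > 0" and H: "H \<noteq> []" and C0: "C \<ge> 0"
    and C: "\<And>n bs z. valid m n bs \<Longrightarrow>
      real (card {W. W \<subseteq> {0..<n} \<and> z \<in> W \<and> ptyp m bs W = H}) \<le> C * real n ^ (ncomp H - 1)"
    and v: "valid m n bs" and ys: "ys \<in> set_pmf (block m bs m)" and n: "n > 0"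
  shows "\<bar>Xc m H (Suc n) (bs @ ys) - Xc m H n bs\<bar> \<le> (C * 2 ^ (ncomp H - 1) * (2 * m + 1)) * real n ^ (ncomp H - 1)"
proof -
  define c where "c = ncomp H - 1"
  note v' = valid_append[OF m v ys]
  define A where "A = {W. W \<subseteq> {0..<n} \<and> ptyp m bs W = H}"
  define A' where "A' = {W. W \<subseteq> {0..<Suc n} \<and> ptyp m (bs @ ys) W = H}"
  have fin: "finite A" "finite A'" unfolding A_def A'_def by (rule finite_sub)+
  have cys: "card (set ys) \<le> m" using card_length[of ys] length_block[OF ys] by simp
  let ?S = "\<lambda>z. {W. W \<subseteq> {0..<n} \<and> z \<in> W \<and> ptyp m bs W = H}"
  let ?S' = "\<lambda>z. {W. W \<subseteq> {0..<Suc n} \<and> z \<in> W \<and> ptyp m (bs @ ys) W = H}"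
  have s1: "A - A' \<subseteq> (\<Union>z\<in>set ys. ?S z)"
  proof
    fix W assume W: "W \<in> A - A'"
    then have "W \<subseteq> {0..<n}" "ptyp m bs W = H" by (auto simp: A_def)
    moreover have "W \<inter> set ys \<noteq> {}"
    proof
      assume "W \<inter> set ys = {}"
      then have "ptyp m (bs @ ys) W = H" using ptyp_unchanged[OF v] calculation by simp
      then show False using W calculation by (force simp: A'_def)
    qed
    ultimately show "W \<in> (\<Union>z\<in>set ys. ?S z)" by auto
  qed
  have s2: "A' - A \<subseteq> (\<Union>z\<in>insert n (set ys). ?S' z)"
  proof
    fix W assume W: "W \<in> A' - A"
    then have WA: "W \<subseteq> {0..<Suc n}" "ptyp m (bs @ ys) W = H" by (auto simp: A'_def)
    have "W \<inter> insert n (set ys) \<noteq> {}"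
    proof
      assume e: "W \<inter> insert n (set ys) = {}"
      then have "W \<subseteq> {0..<n}" using WA(1) by (auto simp: less_Suc_eq)
      moreover have "W \<inter> set ys = {}" using e by auto
      ultimately have "ptyp m bs W = H" using ptyp_unchanged[OF v] WA by simp
      then show False using W \<open>W \<subseteq> {0..<n}\<close> by (simp add: A_def)
    qed
    then show "W \<in> (\<Union>z\<in>insert n (set ys). ?S' z)" using WA by auto
  qed
  have n2: "real (Suc n) ^ c \<le> 2 ^ c * real n ^ c"
    using n by (simp only: power_mult_distrib[symmetric]) (intro power_mono, auto)
  have n1: "real n ^ c \<le> 2 ^ c * real n ^ c" using power_mono[of 1 "2 :: real" c] by (simp add: mult_le_cancel_right1)
  have "real (card (A - A')) \<le> real (\<Sum>z\<in>set ys. card (?S z))"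
    using order_trans[OF card_mono[OF _ s1] card_UN_le] by (simp only: of_nat_le_iff) (simp add: finite_sub)
  also have "\<dots> = (\<Sum>z\<in>set ys. real (card (?S z)))" by simp
  also have "\<dots> \<le> (\<Sum>z\<in>set ys. C * (2 ^ c * real n ^ c))"
    by (intro sum_mono order_trans[OF C[OF v, folded c_def]] mult_left_mono n1 C0)
  also have "\<dots> \<le> real m * (C * (2 ^ c * real n ^ c))"
    using cys C0 by (simp add: mult_right_mono)
  finally have d1: "real (card (A - A')) \<le> real m * (C * (2 ^ c * real n ^ c))" .
  have "real (card (A' - A)) \<le> real (\<Sum>z\<in>insert n (set ys). card (?S' z))"
    using order_trans[OF card_mono[OF _ s2] card_UN_le] by (simp only: of_nat_le_iff) (simp add: finite_sub)
  also have "\<dots> = (\<Sum>z\<in>insert n (set ys). real (card (?S' z)))" by (simp only: of_nat_sum)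
  also have "\<dots> \<le> (\<Sum>z\<in>insert n (set ys). C * (2 ^ c * real n ^ c))"
    by (intro sum_mono order_trans[OF C[OF v', folded c_def]] mult_left_mono n2 C0)
  also have "\<dots> = real (card (insert n (set ys))) * (C * (2 ^ c * real n ^ c))" by (simp only: sum_constant)
  also have "\<dots> \<le> real (m + 1) * (C * (2 ^ c * real n ^ c))"
    using card_insert_le_m1[of "Suc m" "set ys" n] cys C0 by (intro mult_right_mono) auto
  finally have d2: "real (card (A' - A)) \<le> real (m + 1) * (C * (2 ^ c * real n ^ c))" .
  have "A = (A \<inter> A') \<union> (A - A')" "A' = (A \<inter> A') \<union> (A' - A)" by auto
  then have "card A = card (A \<inter> A') + card (A - A')" "card A' = card (A \<inter> A') + card (A' - A)"
    using fin card_Un_disjoint[of "A \<inter> A'" "A - A'"] card_Un_disjoint[of "A \<inter> A'" "A' - A"] by auto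
  then have "\<bar>real (card A') - real (card A)\<bar> \<le> real (card (A - A')) + real (card (A' - A))" by simp
  also have "\<dots> \<le> real m * (C * (2 ^ c * real n ^ c)) + real (m + 1) * (C * (2 ^ c * real n ^ c))"
    using d1 d2 by simp
  finally show ?thesis unfolding Xc_def A_def[symmetric] A'_def[symmetric] c_def[symmetric]
    by (simp add: algebra_simps)
qed

text \<open>Target lists that change the pattern. Rank \<open>h\<close> is the new node and leaves
  the old pattern alone, so it is an allowed entry but does not count as a hit.\<close>

definition NT :: "nat \<Rightarrow> nat \<Rightarrow> nat option list set" where
  "NT m h = {\<sigma>. length \<sigma> = m \<and> set \<sigma> \<subseteq> insert None (Some ` {0..h}) \<and> (\<exists>i<h. Some i \<in> set \<sigma>)}"

lemma finite_NT: "finite (NT m h)"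
proof -
  have "NT m h \<subseteq> {\<sigma>. set \<sigma> \<subseteq> insert None (Some ` {0..h}) \<and> length \<sigma> = m}" by (auto simp: NT_def)
  then show ?thesis by (rule finite_subset) (rule finite_lists_length_eq, simp)
qed

text \<open>Conditional probability that a given occurrence is destroyed: since indegrees are
  recorded, every hit destroys it.\<close>

definition Acoef :: "nat \<Rightarrow> pat \<Rightarrow> nat \<Rightarrow> real" where
  "Acoef m H n = (\<Sum>\<sigma>\<in>NT m (length H). pblock m n (map snd H) \<sigma>)"

text \<open>Gain from old sets: those showing \<open>unbump \<sigma> H\<close> become occurrences of
  \<open>H\<close> when they are hit according to \<open>\<sigma>\<close>.\<close>

definition Bold :: "nat \<Rightarrow> pat \<Rightarrow> nat \<Rightarrow> nat list \<Rightarrow> real" where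
  "Bold m H n bs = (\<Sum>\<sigma>\<in>NT m (length H). if bump_ok \<sigma> H
     then pblock m n (map snd (unbump \<sigma> H)) \<sigma> * Xc m (unbump \<sigma> H) n bs else 0)"

text \<open>Gain from sets that contain the new node. The last entry \<open>(\<rho>, d)\<close> of
  the pattern prescribes its targets and indegree, so the earlier pattern of the older part is
  determined.\<close>

definition Bnew :: "nat \<Rightarrow> pat \<Rightarrow> nat option list \<Rightarrow> nat \<Rightarrow> nat \<Rightarrow> nat list \<Rightarrow> real" where
  "Bnew m G \<rho> d n bs = (if length \<rho> = m \<and> d = count_list \<rho> (Some (length G)) \<and> bump_ok \<rho> G
     then pblock m n (map snd (unbump \<rho> G)) \<rho> * Xc m (unbump \<rho> G) n bs else 0)"

lemma map_snd_ptyp: "map snd (ptyp m bs W) = map (count_list bs) (sl W)"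
  by (simp add: ptyp_def)

text \<open>A block that misses \<open>W\<close> leaves its pattern alone, so only lists in
  \<open>NT\<close> matter. Their probabilities depend on the current pattern, and in each term
  \<open>pblock\<close> is evaluated at the pattern selected by the indicator.\<close>

lemma old_change:
  assumes m: "m > 0" and v: "valid m n bs" and W: "W \<subseteq> {0..<n}"
  shows "pE (block m bs m) (\<lambda>ys. (if ptyp m (bs @ ys) W = H then 1 else 0) - (if ptyp m bs W = H then 1 else 0))
    = (\<Sum>\<sigma>\<in>NT m (length H). (if bump_ok \<sigma> H
     then pblock m n (map snd (unbump \<sigma> H)) \<sigma> * (if ptyp m bs W = unbump \<sigma> H then 1 else 0) else 0)
     - pblock m n (map snd H) \<sigma> * (if ptyp m bs W = H then 1 else 0))"
proof -
  have fW: "finite W" using W finite_subset by blast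
  have nW: "n \<notin> W" using W by auto
  define T where "T = ptyp m bs W"
  define c where "c \<sigma> = (if bump_ok \<sigma> H \<and> T = unbump \<sigma> H then 1 else 0) - (if T = H then 1 else 0 :: real)" for \<sigma>
  let ?\<rho> = "\<lambda>ys. map (rk (insert n W)) ys"
  have "pE (block m bs m) (\<lambda>ys. (if ptyp m (bs @ ys) W = H then 1 else 0) - (if ptyp m bs W = H then 1 else 0))
    = pE (block m bs m) (\<lambda>ys. \<Sum>\<sigma>\<in>NT m (length H). c \<sigma> * (if ?\<rho> ys = \<sigma> then 1 else 0))"
  proof (rule pE_cong)
    fix ys assume "ys \<in> set_pmf (block m bs m)"
    then have len: "length ys = m" by (rule length_block)
    have new: "ptyp m (bs @ ys) W = H \<longleftrightarrow> bump_ok (?\<rho> ys) H \<and> T = unbump (?\<rho> ys) H"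
      unfolding ptyp_append_old[OF v W] bump_eq_iff T_def ..
    have "(\<Sum>\<sigma>\<in>NT m (length H). c \<sigma> * (if ?\<rho> ys = \<sigma> then 1 else 0))
        = (\<Sum>\<sigma>\<in>NT m (length H). if ?\<rho> ys = \<sigma> then c \<sigma> else 0)"
      by (rule sum.cong) auto
    also have "\<dots> = (if ?\<rho> ys \<in> NT m (length H) then c (?\<rho> ys) else 0)"
      using finite_NT by (simp add: sum.delta')
    also have "\<dots> = (if ptyp m (bs @ ys) W = H then 1 else 0) - (if ptyp m bs W = H then 1 else 0)"
    proof (cases "?\<rho> ys \<in> NT m (length H)")
      case True
      then show ?thesis using new by (simp add: c_def T_def)
    next
      case False
      have "ptyp m (bs @ ys) W = H \<longleftrightarrow> ptyp m bs W = H"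
      proof (cases "card W = length H")
        case True
        have rng: "r \<in> insert None (Some ` {0..length H})" if r: "r \<in> set (?\<rho> ys)" for r
        proof (cases r)
          case (Some i)
          then obtain y where "rk (insert n W) y = Some i" using r by auto
          then have "i < card (insert n W)" using rk_range[of "insert n W" y i] fW by simp
          then show ?thesis using Some True fW nW by auto
        qed simp
        then have "Some i \<notin> set (?\<rho> ys)" if "i < length (ptyp m bs W)" for i
          using False len that True rng by (auto simp: NT_def)
        then have "bump (?\<rho> ys) (ptyp m bs W) = ptyp m bs W" by (rule bump_id)
        then show ?thesis unfolding ptyp_append_old[OF v W] by simp
      next
        case False
        then have "ptyp m (bs @ ys) W \<noteq> H" "ptyp m bs W \<noteq> H" by auto
        then show ?thesis by simp
      qed
      then show ?thesis using False by simp
    qed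
    finally show "(if ptyp m (bs @ ys) W = H then 1 else 0) - (if ptyp m bs W = H then 1 else 0)
      = (\<Sum>\<sigma>\<in>NT m (length H). c \<sigma> * (if ?\<rho> ys = \<sigma> then 1 else 0))" by simp
  qed
  also have "\<dots> = (\<Sum>\<sigma>\<in>NT m (length H). c \<sigma> * pblock m n (map snd T) \<sigma>)"
    unfolding pE_sum[OF finite_block]
  proof (rule sum.cong[OF refl])
    fix \<sigma> assume "\<sigma> \<in> NT m (length H)"
    then have len: "length \<sigma> = m" by (simp add: NT_def)
    have "measure_pmf.prob (block m bs m) {ys. ?\<rho> ys = \<sigma>} = pblock m n (map snd T) \<sigma>"
      using block_prob[OF m v W, of \<sigma>] len by (simp add: T_def map_snd_ptyp)
    then show "pE (block m bs m) (\<lambda>ys. c \<sigma> * (if ?\<rho> ys = \<sigma> then 1 else 0)) = c \<sigma> * pblock m n (map snd T) \<sigma>"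
      by (simp add: pE_indicator)
  qed
  also have "\<dots> = (\<Sum>\<sigma>\<in>NT m (length H). (if bump_ok \<sigma> H
     then pblock m n (map snd (unbump \<sigma> H)) \<sigma> * (if T = unbump \<sigma> H then 1 else 0) else 0)
     - pblock m n (map snd H) \<sigma> * (if T = H then 1 else 0))"
    by (rule sum.cong) (auto simp: c_def)
  finally show ?thesis unfolding T_def .
qed

lemma new_occurrence:
  assumes m: "m > 0" and v: "valid m n bs" and W: "W \<subseteq> {0..<n}"
  shows "pE (block m bs m) (\<lambda>ys. if ptyp m (bs @ ys) (insert n W) = G @ [(\<rho>, d)] then 1 else 0)
    = (if length \<rho> = m \<and> d = count_list \<rho> (Some (length G)) \<and> bump_ok \<rho> G
     then pblock m n (map snd (unbump \<rho> G)) \<rho> * (if ptyp m bs W = unbump \<rho> G then 1 else 0) else 0)"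
proof -
  define T where "T = ptyp m bs W"
  let ?\<rho> = "\<lambda>ys. map (rk (insert n W)) ys"
  define P where "P \<longleftrightarrow> d = count_list \<rho> (Some (length G)) \<and> bump_ok \<rho> G \<and> T = unbump \<rho> G"
  have "pE (block m bs m) (\<lambda>ys. if ptyp m (bs @ ys) (insert n W) = G @ [(\<rho>, d)] then 1 else 0)
     = pE (block m bs m) (\<lambda>ys. (if P then 1 else 0) * (if ?\<rho> ys = \<rho> then 1 else 0))"
  proof (rule pE_cong)
    fix ys assume "ys \<in> set_pmf (block m bs m)"
    then have len: "length ys = m" by (rule length_block)
    have lenT: "card W = length G" if "T = unbump \<rho>' G" for \<rho>'
      using arg_cong[OF that, of length] by (simp add: T_def)
    have "ptyp m (bs @ ys) (insert n W) = G @ [(\<rho>, d)] \<longleftrightarrow> bump (?\<rho> ys) T = G \<and> ?\<rho> ys = \<rho> \<and> count_list (?\<rho> ys) (Some (card W)) = d"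
      unfolding ptyp_append_new[OF v W len] Let_def T_def by simp
    also have "\<dots> \<longleftrightarrow> P \<and> ?\<rho> ys = \<rho>" unfolding bump_eq_iff P_def using lenT by auto
    finally show "(if ptyp m (bs @ ys) (insert n W) = G @ [(\<rho>, d)] then 1 else 0)
      = (if P then 1 else 0) * (if ?\<rho> ys = \<rho> then 1 else 0 :: real)" by simp
  qed
  also have "\<dots> = (if P then 1 else 0) * measure_pmf.prob (block m bs m) {ys. ?\<rho> ys = \<rho>}"
    by (simp add: pE_indicator)
  also have "\<dots> = (if length \<rho> = m \<and> P then pblock m n (map snd T) \<rho> else 0)"
  proof (cases "length \<rho> = m")
    case True
    then show ?thesis using block_prob[OF m v W, of \<rho>] by (simp add: T_def map_snd_ptyp)
  next
    case False
    have "measure_pmf.prob (block m bs m) {ys. ?\<rho> ys = \<rho>} \<le> measure_pmf.prob (block m bs m) {ys. False}"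
      by (rule prob_mono_pmf) (use length_block False in fastforce)
    then show ?thesis using False by (simp add: measure_le_0_iff)
  qed
  also have "\<dots> = (if length \<rho> = m \<and> d = count_list \<rho> (Some (length G)) \<and> bump_ok \<rho> G
     then pblock m n (map snd (unbump \<rho> G)) \<rho> * (if T = unbump \<rho> G then 1 else 0) else 0)"
    by (auto simp: P_def)
  finally show ?thesis by (simp add: T_def)
qed

text \<open>Subsets of \<open>{0..<Suc n}\<close> are split by whether they contain the new node:
  those without it give the loss and \<open>Bold\<close>, those with it give
  \<open>Bnew\<close>.\<close>

lemma Xc_drift:
  assumes m: "m > 0" and v: "valid m n bs"
  shows "pE (block m bs m) (\<lambda>ys. Xc m (G @ [(\<rho>, d)]) (Suc n) (bs @ ys) - Xc m (G @ [(\<rho>, d)]) n bs)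
    = - Acoef m (G @ [(\<rho>, d)]) n * Xc m (G @ [(\<rho>, d)]) n bs + (Bold m (G @ [(\<rho>, d)]) n bs + Bnew m G \<rho> d n bs)"
proof -
  define H where "H = G @ [(\<rho>, d)]"
  let ?P = "Pow {0..<n}"
  let ?I = "\<lambda>bs W. if ptyp m bs W = H then 1 else 0 :: real"
  have split: "Xc m H (Suc n) (bs @ ys) - Xc m H n bs
     = (\<Sum>W\<in>?P. ?I (bs @ ys) W - ?I bs W) + (\<Sum>W\<in>?P. ?I (bs @ ys) (insert n W))" for ys
  proof -
    have "Pow {0..<Suc n} = ?P \<union> insert n ` ?P" by (simp add: atLeast0_lessThan_Suc Pow_insert)
    moreover have "?P \<inter> insert n ` ?P = {}" by auto
    ultimately have "Xc m H (Suc n) (bs @ ys) = (\<Sum>W\<in>?P. ?I (bs @ ys) W) + (\<Sum>W\<in>insert n ` ?P. ?I (bs @ ys) W)"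
      unfolding Xc_sum by (simp add: sum.union_disjoint)
    also have "(\<Sum>W\<in>insert n ` ?P. ?I (bs @ ys) W) = (\<Sum>W\<in>?P. ?I (bs @ ys) (insert n W))"
    proof (rule sum.reindex_cong[of "insert n"])
      show "inj_on (insert n) ?P"
        by (rule inj_onI) (metis Pow_iff atLeastLessThan_iff insert_ident less_irrefl subsetD)
    qed auto
    finally show ?thesis unfolding Xc_sum[of m H n] by (simp add: sum_subtractf)
  qed
  have "pE (block m bs m) (\<lambda>ys. Xc m H (Suc n) (bs @ ys) - Xc m H n bs)
    = (\<Sum>W\<in>?P. pE (block m bs m) (\<lambda>ys. ?I (bs @ ys) W - ?I bs W))
      + (\<Sum>W\<in>?P. pE (block m bs m) (\<lambda>ys. ?I (bs @ ys) (insert n W)))"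
    unfolding split by (simp only: pE_add[OF finite_block] pE_sum[OF finite_block])
  also have "(\<Sum>W\<in>?P. pE (block m bs m) (\<lambda>ys. ?I (bs @ ys) W - ?I bs W)) = (\<Sum>W\<in>?P. \<Sum>\<sigma>\<in>NT m (length H).
     (if bump_ok \<sigma> H then pblock m n (map snd (unbump \<sigma> H)) \<sigma> * (if ptyp m bs W = unbump \<sigma> H then 1 else 0) else 0)
     - pblock m n (map snd H) \<sigma> * ?I bs W)"
    by (rule sum.cong[OF refl], rule old_change[OF m v]) simp
  also have "\<dots> = (\<Sum>\<sigma>\<in>NT m (length H). \<Sum>W\<in>?P.
     (if bump_ok \<sigma> H then pblock m n (map snd (unbump \<sigma> H)) \<sigma> * (if ptyp m bs W = unbump \<sigma> H then 1 else 0) else 0)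
     - pblock m n (map snd H) \<sigma> * ?I bs W)"
    by (rule sum.swap)
  also have "\<dots> = (\<Sum>\<sigma>\<in>NT m (length H).
     (if bump_ok \<sigma> H then pblock m n (map snd (unbump \<sigma> H)) \<sigma> * Xc m (unbump \<sigma> H) n bs else 0)
     - pblock m n (map snd H) \<sigma> * Xc m H n bs)"
    by (rule sum.cong[OF refl]) (simp only: sum_subtractf Xc_sum sum_distrib_left[symmetric] if_distrib[of "sum _"] split: if_split,
        simp add: sum_distrib_left)
  also have "\<dots> = Bold m H n bs - Acoef m H n * Xc m H n bs"
    by (simp add: Bold_def Acoef_def sum_subtractf sum_distrib_right)
  also have "(\<Sum>W\<in>?P. pE (block m bs m) (\<lambda>ys. ?I (bs @ ys) (insert n W))) = Bnew m G \<rho> d n bs"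
  proof -
    have "(\<Sum>W\<in>?P. pE (block m bs m) (\<lambda>ys. ?I (bs @ ys) (insert n W)))
      = (\<Sum>W\<in>?P. if length \<rho> = m \<and> d = count_list \<rho> (Some (length G)) \<and> bump_ok \<rho> G
     then pblock m n (map snd (unbump \<rho> G)) \<rho> * (if ptyp m bs W = unbump \<rho> G then 1 else 0) else 0)"
      unfolding H_def by (rule sum.cong[OF refl], rule new_occurrence[OF m v]) simp
    note eq = this
    show ?thesis
    proof (cases "length \<rho> = m \<and> d = count_list \<rho> (Some (length G)) \<and> bump_ok \<rho> G")
      case True
      show ?thesis unfolding eq Bnew_def if_P[OF True] Xc_sum sum_distrib_left ..
    next
      case False
      show ?thesis unfolding eq Bnew_def if_not_P[OF False] by simp
    qed
  qed
  finally show ?thesis by (simp add: H_def)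
qed

text \<open>Induction measure. A predecessor has a smaller indegree total or one block fewer; the 1
  per block makes the latter a decrease even when the indegree is 0.\<close>

definition tdeg :: "pat \<Rightarrow> nat" where
  "tdeg H = (\<Sum>i<length H. snd (H ! i) + 1)"

lemma tdeg_unbump:
  assumes "\<sigma> \<in> NT m (length H)" "bump_ok \<sigma> H" shows "tdeg (unbump \<sigma> H) < tdeg H"
proof -
  obtain i where i: "i < length H" "Some i \<in> set \<sigma>" using assms by (auto simp: NT_def)
  have "count_list \<sigma> (Some i) > 0" using i(2) by (metis count_list_0_iff neq0_conv)
  then have "snd (H ! i) - count_list \<sigma> (Some i) + 1 < snd (H ! i) + 1"
    using assms(2) i(1) by (auto simp: bump_ok_def)
  then show ?thesis unfolding tdeg_def length_bump using i(1)
    by (intro sum_strict_mono_ex1) (auto simp: unbump_def intro!: bexI[of _ i])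
qed

lemma tdeg_unbump_le: "tdeg (unbump \<sigma> H) \<le> tdeg H"
  unfolding tdeg_def length_bump by (rule sum_mono) (simp add: unbump_def)

lemma tdeg_snoc: "tdeg G < tdeg (G @ [(\<rho>, d)])"
proof -
  have "(\<Sum>i<length G. snd ((G @ [(\<rho>, d)]) ! i) + 1) = tdeg G"
    unfolding tdeg_def by (rule sum.cong) (auto simp: nth_append)
  then show ?thesis by (simp add: tdeg_def)
qed

text \<open>The drift of \<open>H\<close> involves only \<open>H\<close> itself and patterns of
  smaller \<open>tdeg\<close>, whose limits are known. If \<open>H\<close> has \<open>c\<close>
  components, a predecessor with \<open>e + (c - 1)\<close> components has a count of order at most
  \<open>n ^ (e + (c - 1))\<close> and requires at least \<open>e\<close> hits; so each gain term
  divided by \<open>n ^ (c - 1)\<close> converges, as \<open>stochastic_approximation\<close>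
  demands.\<close>

theorem pattern_limit:
  assumes m: "m > 0"
  shows "\<exists>x. L1conv (\<lambda>n. bam m (n * m)) (\<lambda>n bs. Xc m H n bs / real n ^ ncomp H) x"
proof (induction "tdeg H" arbitrary: H rule: less_induct)
  case less
  let ?S = "\<lambda>n. bam m (n * m)"
  interpret fin_pmfs ?S by standard (rule finite_bam)
  show ?case
  proof (cases H rule: rev_cases)
    case Nil
    \<comment> \<open>The empty set is the only occurrence of the empty pattern, which has no
      components, so the normalized count is constantly 1.\<close>
    have "{W. W \<subseteq> {0..<n} \<and> ptyp m bs W = []} = {{}}" for n bs
    proof -
      have "ptyp m bs W = [] \<longleftrightarrow> card W = 0" for W by (metis length_0_conv length_ptyp)
      then show ?thesis using finite_subset by fastforce
    qed
    then have eq: "Xc m H n bs / real n ^ ncomp H = 1" for n bs by (simp add: Nil Xc_def ncomp_def)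
    have "L1conv ?S (\<lambda>n s. 1) 1" by (rule L1conv_const) simp
    then show ?thesis unfolding eq by blast
  next
    case (snoc G x)
    obtain \<rho> d where x: "x = (\<rho>, d)" by (cases x)
    have H: "H = G @ [(\<rho>, d)]" using snoc x by simp
    have Hne: "H \<noteq> []" using H by simp
    define c where "c = ncomp H"
    have c: "c > 0" using ncomp_pos[OF Hne] by (simp add: c_def)
    obtain C where C: "C \<ge> 0" "\<And>n bs z. valid m n bs \<Longrightarrow>
      real (card {W. W \<subseteq> {0..<n} \<and> z \<in> W \<and> ptyp m bs W = H}) \<le> C * real n ^ (c - 1)"
      using occurrences_through[of m H] unfolding c_def by blast
    define C' where "C' = C * 2 ^ (c - 1) * (2 * m + 1)"
    \<comment> \<open>A single constant has to serve for the size bound and for the jump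
      bound.\<close>
    have CC': "C \<le> C'"
    proof -
      have "1 * 1 \<le> (2 :: real) ^ (c - 1) * (2 * real m + 1)" by (intro mult_mono) auto
      then have "C * 1 \<le> C * (2 ^ (c - 1) * (2 * real m + 1))" using C(1) by (intro mult_left_mono) auto
      then show ?thesis by (simp add: C'_def mult.assoc add.commute)
    qed
    let ?\<kappa> = "\<lambda>n bs. map_pmf ((@) bs) (block m bs m)"
    have lim: "\<exists>\<beta>. L1conv ?S (\<lambda>n bs. pblock m n ds \<sigma> * Xc m H' n bs / real n ^ (c - 1)) \<beta>"
      if sm: "tdeg H' < tdeg H" and k: "ncomp H' + 1 \<le> c + kS \<sigma>" and k0: "ncomp H' \<ge> c - 1" for H' \<sigma> ds
    proof -
      obtain y where y: "L1conv ?S (\<lambda>n bs. Xc m H' n bs / real n ^ ncomp H') y" using less[OF sm] by blast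
      define e where "e = ncomp H' - (c - 1)"
      have e: "e \<le> kS \<sigma>" "ncomp H' = e + (c - 1)" using k k0 c by (auto simp: e_def)
      obtain \<mu> where "(\<lambda>n. real n ^ e * pblock m n ds \<sigma>) \<longlonglongrightarrow> \<mu>" using pblock_limit'[OF m e(1)] by blast
      then have "L1conv ?S (\<lambda>n bs. (real n ^ e * pblock m n ds \<sigma>) * (Xc m H' n bs / real n ^ ncomp H')) (\<mu> * y)"
        using y by (rule L1conv_mult)
      then have "L1conv ?S (\<lambda>n bs. pblock m n ds \<sigma> * Xc m H' n bs / real n ^ (c - 1)) (\<mu> * y)"
      proof (rule L1conv_cong)
        show "\<forall>\<^sub>F n in sequentially. \<forall>s\<in>set_pmf (?S n). (real n ^ e * pblock m n ds \<sigma>) * (Xc m H' n s / real n ^ ncomp H')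
           = pblock m n ds \<sigma> * Xc m H' n s / real n ^ (c - 1)"
          using eventually_gt_at_top[of 0] by eventually_elim (simp add: e(2) power_add)
      qed
      then show ?thesis by blast
    qed
    have lim0: "\<exists>\<beta>. L1conv ?S (\<lambda>n bs. 0) \<beta>" using L1conv_const[of "\<lambda>_. 0" 0] by auto
    have new: "\<exists>\<beta>. L1conv ?S (\<lambda>n bs. Bnew m G \<rho> d n bs / real n ^ (c - 1)) \<beta>"
    proof -
      have "\<exists>\<beta>. L1conv ?S (\<lambda>n bs. pblock m n (map snd (unbump \<rho> G)) \<rho> * Xc m (unbump \<rho> G) n bs / real n ^ (c - 1)) \<beta>"
      proof (cases "ncomp G \<ge> c - 1")
        case True
        show ?thesis
        proof (rule lim)
          show "tdeg (unbump \<rho> G) < tdeg H" using tdeg_unbump_le[of \<rho> G] tdeg_snoc[of G \<rho> d] H by simp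
          show "ncomp (unbump \<rho> G) + 1 \<le> c + kS \<rho>" using ncomp_snoc[of G \<rho> d] H by (simp add: ncomp_unbump c_def)
          show "ncomp (unbump \<rho> G) \<ge> c - 1" using True by (simp add: ncomp_unbump)
        qed
      next
        case False
        then show ?thesis using ncomp_snoc_ge[of G \<rho> d] H by (simp add: c_def)
      qed
      note ex = this
      show ?thesis
      proof (cases "length \<rho> = m \<and> d = count_list \<rho> (Some (length G)) \<and> bump_ok \<rho> G")
        case True
        show ?thesis unfolding Bnew_def if_P[OF True] by (rule ex)
      next
        case False
        show ?thesis unfolding Bnew_def if_not_P[OF False] using lim0 by simp
      qed
    qed
    have old: "\<exists>\<beta>. L1conv ?S (\<lambda>n bs. Bold m H n bs / real n ^ (c - 1)) \<beta>"
    proof -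
      define F where "F \<sigma> n bs = (if bump_ok \<sigma> H
         then pblock m n (map snd (unbump \<sigma> H)) \<sigma> * Xc m (unbump \<sigma> H) n bs else 0) / real n ^ (c - 1)" for \<sigma> n bs
      have "\<exists>\<beta>. L1conv ?S (F \<sigma>) \<beta>" if \<sigma>: "\<sigma> \<in> NT m (length H)" for \<sigma>
      proof (cases "bump_ok \<sigma> H")
        case True
        obtain i where "Some i \<in> set \<sigma>" using \<sigma> by (auto simp: NT_def)
        then have "kS \<sigma> > 0" by (auto simp: kS_def filter_empty_conv)
        then show ?thesis using lim[OF tdeg_unbump[OF \<sigma> True], of \<sigma> "map snd (unbump \<sigma> H)"] True
          by (simp add: ncomp_unbump c_def F_def[abs_def])
      next
        case False
        then show ?thesis using lim0 by (simp add: F_def[abs_def])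
      qed
      then have "\<forall>\<sigma>\<in>NT m (length H). \<exists>\<beta>. L1conv ?S (F \<sigma>) \<beta>" by simp
      then obtain \<beta> where \<beta>: "\<forall>\<sigma>\<in>NT m (length H). L1conv ?S (F \<sigma>) (\<beta> \<sigma>)" by (rule bchoice[THEN exE])
      have "L1conv ?S (\<lambda>n s. \<Sum>\<sigma>\<in>NT m (length H). F \<sigma> n s) (\<Sum>\<sigma>\<in>NT m (length H). \<beta> \<sigma>)"
        by (rule L1conv_sum[OF finite_NT]) (use \<beta> in simp)
      moreover have "(\<Sum>\<sigma>\<in>NT m (length H). F \<sigma> n bs) = Bold m H n bs / real n ^ (c - 1)" for n bs
        unfolding F_def Bold_def by (rule sum_divide_distrib[symmetric])
      ultimately show ?thesis by auto
    qed
    obtain b where B: "L1conv ?S (\<lambda>n bs. (Bold m H n bs + Bnew m G \<rho> d n bs) / real n ^ (c - 1)) b"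
    proof -
      obtain b1 b2 where "L1conv ?S (\<lambda>n bs. Bold m H n bs / real n ^ (c - 1)) b1"
        "L1conv ?S (\<lambda>n bs. Bnew m G \<rho> d n bs / real n ^ (c - 1)) b2"
        using old new by (elim exE) (rule that)
      from L1conv_add[OF this] show thesis by (intro that) (simp add: add_divide_distrib)
    qed
    obtain a where a: "(\<lambda>n. real n * Acoef m H n) \<longlonglongrightarrow> a" "a \<ge> 0"
    proof -
      \<comment> \<open>Every list in \<open>NT\<close> contains a hit, so multiplying its
        probability by \<open>n\<close> gives a finite limit; these limits add up to the rate
        \<open>a\<close>.\<close>
      have "\<exists>\<mu>\<ge>0. (\<lambda>n. real n ^ 1 * pblock m n (map snd H) \<sigma>) \<longlonglongrightarrow> \<mu>" if \<sigma>: "\<sigma> \<in> NT m (length H)" for \<sigma>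
      proof (rule pblock_limit'[OF m])
        obtain i where "Some i \<in> set \<sigma>" using \<sigma> by (auto simp: NT_def)
        then show "1 \<le> kS \<sigma>" by (auto simp: kS_def Suc_le_eq filter_empty_conv)
      qed
      then have "\<forall>\<sigma>\<in>NT m (length H). \<exists>\<mu>. \<mu> \<ge> 0 \<and> (\<lambda>n. real n ^ 1 * pblock m n (map snd H) \<sigma>) \<longlonglongrightarrow> \<mu>" by simp
      then obtain \<mu> where \<mu>: "\<forall>\<sigma>\<in>NT m (length H). \<mu> \<sigma> \<ge> 0 \<and> (\<lambda>n. real n ^ 1 * pblock m n (map snd H) \<sigma>) \<longlonglongrightarrow> \<mu> \<sigma>"
        by (rule bchoice[THEN exE])
      have "(\<lambda>n. \<Sum>\<sigma>\<in>NT m (length H). real n ^ 1 * pblock m n (map snd H) \<sigma>) \<longlonglongrightarrow> (\<Sum>\<sigma>\<in>NT m (length H). \<mu> \<sigma>)"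
        by (intro tendsto_sum) (use \<mu> in blast)
      moreover have "(\<Sum>\<sigma>\<in>NT m (length H). \<mu> \<sigma>) \<ge> 0" using \<mu> by (intro sum_nonneg) blast
      ultimately show thesis by (intro that) (simp_all add: Acoef_def sum_distrib_left)
    qed
    have "L1conv ?S (\<lambda>n bs. Xc m H n bs / real n ^ c) (b / (a + c))"
    proof (rule stochastic_approximation[where \<kappa> = ?\<kappa> and A = "Acoef m H" and C = C' and B = "\<lambda>n bs. Bold m H n bs + Bnew m G \<rho> d n bs"])
      show "bam m (Suc n * m) = bind_pmf (bam m (n * m)) (?\<kappa> n)" for n by (rule bam_Suc_block)
      show "finite (set_pmf (?\<kappa> n bs))" for n bs by (simp add: finite_block)
      show "c > 0" by (rule c)
      fix n :: nat and bs assume n: "n > 0" and "bs \<in> set_pmf (bam m (n * m))"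
      then have v: "valid m n bs" using valid_bam[OF m] by blast
      have "Xc m H n bs \<le> C * real n ^ c" using Xc_bound[OF Hne _ v, of C] C(2) by (simp add: c_def)
      also have "\<dots> \<le> C' * real n ^ c" using CC' by (intro mult_right_mono) auto
      finally show "\<bar>Xc m H n bs\<bar> \<le> C' * real n ^ c" by (simp add: Xc_def)
      show "pE (?\<kappa> n bs) (\<lambda>s'. Xc m H (Suc n) s' - Xc m H n bs)
         = - Acoef m H n * Xc m H n bs + (Bold m H n bs + Bnew m G \<rho> d n bs)"
        using Xc_drift[OF m v, of G \<rho> d] by (simp add: H)
      fix s' assume "s' \<in> set_pmf (?\<kappa> n bs)"
      then obtain ys where ys: "ys \<in> set_pmf (block m bs m)" "s' = bs @ ys" by auto
      show "\<bar>Xc m H (Suc n) s' - Xc m H n bs\<bar> \<le> C' * real n ^ (c - 1)"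
        using Xc_jump[OF m Hne C(1) _ v ys(1) n] C(2) unfolding ys(2) C'_def c_def by simp
    qed (use a B in auto)
    then show ?thesis unfolding c_def by blast
  qed
qed

subsection \<open>Degree moments of the attachment process\<close>

abbreviation fm :: "nat \<Rightarrow> real" where
  "fm d \<equiv> real d * sqrt (real d)"

text \<open>Discrete form of the derivative of the power 3/2: for \<open>s = sqrt (d + 1)\<close>
  and \<open>r = sqrt d\<close> one has \<open>(s - r) * (s + r) = 1\<close>, which turns the
  difference of cubes into a quadratic expression divided by \<open>s + r\<close>.\<close>

lemma fm_Suc: "fm (Suc d) - fm d \<le> 3 / 2 * sqrt (real (Suc d))"
proof -
  define s where "s = sqrt (real (Suc d))"
  define r where "r = sqrt (real d)"
  have s2: "real (Suc d) = s * s" and r2: "real d = r * r" by (simp_all add: s_def r_def)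
  have rs: "0 \<le> r" "r \<le> s" by (simp_all add: r_def s_def)
  have sr1: "(s - r) * (s + r) = 1" using s2 r2 by (simp add: algebra_simps)
  have "0 < s" by (simp add: s_def)
  then have "s + r > 0" using rs by linarith
  have "(s * s * s - r * r * r) * (s + r) = (s * s + s * r + r * r) * ((s - r) * (s + r))" by (simp add: algebra_simps)
  also have "\<dots> = s * s + s * r + r * r" using sr1 by simp
  also have "\<dots> \<le> 3 / 2 * s * (s + r)"
  proof -
    have "r * r \<le> s * r" "r * r \<le> s * s" using rs by (auto intro: mult_right_mono mult_mono)
    then show ?thesis by (simp add: algebra_simps)
  qed
  finally have "s * s * s - r * r * r \<le> 3 / 2 * s" using \<open>s + r > 0\<close> by simp
  moreover have "fm (Suc d) = s * s * s" "fm d = r * r * r" by (simp_all add: s_def r_def)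
  ultimately show ?thesis by (simp only: s_def)
qed

lemma sum_count_list_le: "(\<Sum>x<N. count_list bs x) \<le> length bs" for bs :: "nat list"
proof (induction bs)
  case (Cons a bs)
  have "(\<Sum>x<N. count_list (a # bs) x) = (\<Sum>x<N. (if a = x then 1 else 0) + count_list bs x)"
    by (rule sum.cong) auto
  also have "\<dots> = (\<Sum>x<N. if a = x then 1 else 0) + (\<Sum>x<N. count_list bs x)" by (simp add: sum.distrib)
  also have "(\<Sum>x<N. if a = x then 1 else 0 :: nat) \<le> 1" by (simp add: sum.delta')
  finally show ?case using Cons by simp
qed simp

lemma urn_pmf_le:
  assumes m: "m > 0"
  shows "pmf (urn m bs) x \<le> real ((if x \<le> length bs div m then m else 0) + count_list bs x) / real (2 * length bs + 1)"
proof -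
  let ?t = "length bs"
  have t: "?t = ?t div m * m + ?t mod m" by simp
  have "count (mset (map (\<lambda>i. i div m) [0..<Suc ?t])) x \<le> (if x \<le> ?t div m then m else 0)"
    using count_sources[of m "?t mod m" "?t div m" x] m by (simp add: Suc_leI del: upt_Suc)
  then have "count (urn_mset m bs) x \<le> (if x \<le> ?t div m then m else 0) + count_list bs x"
    by (simp add: urn_mset_def count_mset del: upt_Suc)
  then have "real (count (urn_mset m bs) x) \<le> real ((if x \<le> ?t div m then m else 0) + count_list bs x)"
    by (simp only: of_nat_le_iff)
  then show ?thesis unfolding urn_def by (simp add: urn_mset_ne size_urn_mset divide_right_mono)
qed

text \<open>Subtracting the baseline \<open>fm m\<close> makes nodes without incoming edges, in
  particular those not yet present, contribute 0; so the range \<open>N\<close> can be fixed while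
  the process runs.\<close>

definition excess :: "nat \<Rightarrow> nat \<Rightarrow> nat list \<Rightarrow> real" where
  "excess m N bs = (\<Sum>x<N. fm (m + count_list bs x) - fm m)"

lemma fm_mono: "a \<le> b \<Longrightarrow> fm a \<le> fm b"
  by (intro mult_mono) auto

text \<open>A node is hit with probability at most its weight divided by \<open>2 * t + 1\<close>,
  and a hit adds about \<open>3 / 2\<close> times the root of the weight; so the expected gain is
  about \<open>3 / 4 / (t + 1 / 2)\<close> times the moment. The constant covers the baseline and
  the step from \<open>D x\<close> to \<open>Suc (D x)\<close> under the root.\<close>

lemma excess_step:
  assumes m: "m > 0"
  shows "pE (urn m bs) (\<lambda>y. excess m N (bs @ [y]))
    \<le> excess m N bs + 3 / 4 / (real (length bs) + 1 / 2) * excess m N bs + 3 / 2 * (fm m + m)"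
proof -
  define t where "t = length bs"
  define D where "D x = m + count_list bs x" for x
  define w where "w x = real ((if x \<le> t div m then m else 0) + count_list bs x)" for x
  have w0: "w x \<ge> 0" for x by (simp add: w_def)
  have inc: "excess m N (bs @ [y]) = excess m N bs + (\<Sum>x<N. (fm (Suc (D x)) - fm (D x)) * (if y = x then 1 else 0))" for y
  proof -
    have "excess m N (bs @ [y]) = (\<Sum>x<N. (fm (D x) - fm m) + (fm (Suc (D x)) - fm (D x)) * (if y = x then 1 else 0))"
      unfolding excess_def by (rule sum.cong) (auto simp: D_def add_ac)
    then show ?thesis by (simp only: sum.distrib excess_def D_def)
  qed
  have trm: "(fm (Suc (D x)) - fm (D x)) * pmf (urn m bs) x
     \<le> 3 / 2 / (2 * real t + 1) * ((fm (D x) - fm m) + (if x \<le> t div m then fm m else 0) + w x / 2)" for x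
  proof -
    have D1: "1 \<le> real (D x)" using m by (simp add: D_def)
    have sq: "sqrt (real (Suc (D x))) \<le> sqrt (real (D x)) + 1 / 2"
    proof (rule real_le_lsqrt)
      have "1 \<le> sqrt (real (D x))" using D1 by simp
      moreover have "(sqrt (real (D x)) + 1 / 2)\<^sup>2 = real (D x) + sqrt (real (D x)) + 1 / 4"
        by (simp add: power2_sum power_divide)
      ultimately show "real (Suc (D x)) \<le> (sqrt (real (D x)) + 1 / 2)\<^sup>2" by linarith
    qed simp_all
    have "fm (Suc (D x)) - fm (D x) \<ge> 0" using fm_mono[of "D x" "Suc (D x)"] by simp
    have "w x * sqrt (real (Suc (D x))) \<le> w x * (sqrt (real (D x)) + 1 / 2)"
      by (rule mult_left_mono[OF sq w0])
    also have "\<dots> = w x * sqrt (real (D x)) + w x / 2" by (simp add: algebra_simps)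
    also have "w x * sqrt (real (D x)) \<le> (fm (D x) - fm m) + (if x \<le> t div m then fm m else 0)"
    proof (cases "x \<le> t div m")
      case True
      then show ?thesis by (simp add: w_def D_def)
    next
      case False
      have "real m * sqrt (real m) \<le> real m * sqrt (real (D x))" by (intro mult_left_mono) (auto simp: D_def)
      then have "real (count_list bs x) * sqrt (real (D x)) \<le> fm (D x) - fm m" by (simp add: D_def algebra_simps)
      then show ?thesis using False by (simp add: w_def)
    qed
    finally have wb: "w x * sqrt (real (Suc (D x))) \<le> (fm (D x) - fm m) + (if x \<le> t div m then fm m else 0) + w x / 2"
      by simp
    have "(fm (Suc (D x)) - fm (D x)) * pmf (urn m bs) x \<le> (3 / 2 * sqrt (real (Suc (D x)))) * (w x / (2 * real t + 1))"
      using urn_pmf_le[OF m, of bs x] fm_Suc[of "D x"] \<open>fm (Suc (D x)) - fm (D x) \<ge> 0\<close>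
      by (intro mult_mono) (auto simp: w_def t_def add.commute)
    also have "\<dots> = 3 / 2 / (2 * real t + 1) * (w x * sqrt (real (Suc (D x))))" by simp
    also have "\<dots> \<le> 3 / 2 / (2 * real t + 1) * ((fm (D x) - fm m) + (if x \<le> t div m then fm m else 0) + w x / 2)"
      by (rule mult_left_mono[OF wb]) simp
    finally show ?thesis .
  qed
  have e1: "pE (urn m bs) (\<lambda>y. excess m N (bs @ [y]))
    = excess m N bs + (\<Sum>x<N. (fm (Suc (D x)) - fm (D x)) * pmf (urn m bs) x)"
  proof -
    have pr: "pE (urn m bs) (\<lambda>y. if y = x then 1 else 0) = pmf (urn m bs) x" for x
      by (simp add: pE_indicator measure_pmf_single)
    show ?thesis unfolding inc by (simp add: pE_add[OF finite_urn] pE_sum[OF finite_urn] pr)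
  qed
  have "(\<Sum>x<N. (fm (Suc (D x)) - fm (D x)) * pmf (urn m bs) x)
    \<le> (\<Sum>x<N. 3 / 2 / (2 * real t + 1) * ((fm (D x) - fm m) + (if x \<le> t div m then fm m else 0) + w x / 2))"
    by (rule sum_mono[OF trm])
  also have "\<dots> = 3 / 2 / (2 * real t + 1) * (excess m N bs + (\<Sum>x<N. if x \<le> t div m then fm m else 0) + (\<Sum>x<N. w x) / 2)"
    by (simp only: sum_distrib_left[symmetric] sum.distrib sum_divide_distrib[symmetric] excess_def D_def)
  also have "\<dots> \<le> 3 / 2 / (2 * real t + 1) * (excess m N bs + (2 * real t + 1) * fm m + (2 * real t + 1) * m)"
  proof (rule mult_left_mono)
    have card: "real (card {x\<in>{..<N}. x \<le> t div m}) \<le> 1 + real (t div m)"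
    proof -
      have "card {x\<in>{..<N}. x \<le> t div m} \<le> card {..t div m}" by (intro card_mono) auto
      then show ?thesis by simp
    qed
    have tm: "real (t div m) \<le> real t" by simp
    have if_sum: "(\<Sum>x<N. if x \<le> t div m then c else 0) = real (card {x\<in>{..<N}. x \<le> t div m}) * c" for c :: real
      by (simp add: sum.inter_filter[symmetric])
    have 1: "(\<Sum>x<N. if x \<le> t div m then fm m else 0) \<le> (2 * real t + 1) * fm m"
      unfolding if_sum by (rule mult_right_mono) (use card tm in linarith, simp)
    have "(\<Sum>x<N. w x) = (\<Sum>x<N. (if x \<le> t div m then real m else 0) + real (count_list bs x))"
      by (rule sum.cong) (auto simp: w_def)
    also have "\<dots> = real (card {x\<in>{..<N}. x \<le> t div m}) * real m + real (\<Sum>x<N. count_list bs x)"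
      by (simp only: sum.distrib if_sum of_nat_sum)
    also have "\<dots> \<le> (1 + real (t div m)) * m + real t"
      using card sum_count_list_le[of bs N] by (intro add_mono mult_right_mono) (auto simp: t_def simp del: of_nat_sum)
    also have "\<dots> \<le> (1 + real t) * m + real t * m"
    proof (intro add_mono mult_right_mono)
      have "real t * 1 \<le> real t * real m" using m by (intro mult_left_mono) auto
      then show "real t \<le> real t * real m" by simp
    qed (use tm in auto)
    also have "\<dots> = (2 * real t + 1) * m" by (simp add: algebra_simps)
    finally have "(\<Sum>x<N. w x) \<le> (2 * real t + 1) * m" .
    moreover have "0 \<le> (2 * real t + 1) * m" by simp
    ultimately have 2: "(\<Sum>x<N. w x) / 2 \<le> (2 * real t + 1) * m" by linarith
    show "excess m N bs + (\<Sum>x<N. if x \<le> t div m then fm m else 0) + (\<Sum>x<N. w x) / 2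
       \<le> excess m N bs + (2 * real t + 1) * fm m + (2 * real t + 1) * m" using 1 2 by linarith
  qed simp
  also have "\<dots> = 3 / 4 / (real t + 1 / 2) * excess m N bs + 3 / 2 * (fm m + m)"
  proof -
    have "3 / 2 / p * (a + p * b + p * c) = 3 / 4 / (p / 2) * a + 3 / 2 * (b + c)" if "p \<noteq> 0" for p a b c :: real
      using that by (simp add: field_simps)
    from this[of "2 * real t + 1" "excess m N bs" "fm m" "real m"] show ?thesis by (simp add: add_divide_distrib)
  qed
  finally show ?thesis unfolding e1 t_def by linarith
qed

lemma length_bam: "bs \<in> set_pmf (bam m t) \<Longrightarrow> length bs = t"
  by (induction t arbitrary: bs) auto

text \<open>The bound \<open>4 * c * (t + 1 / 2)\<close> with \<open>c = 3 / 2 * (fm m + m)\<close>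
  reproduces itself: one step adds \<open>3 * c\<close> from the growth factor and \<open>c\<close>
  from the constant, together \<open>4 * c\<close>. A growth coefficient below 1 is what makes a
  linear bound possible.\<close>

lemma excess_bound:
  assumes m: "m > 0"
  shows "pE (bam m t) (excess m N) \<le> 6 * (fm m + m) * (real t + 1 / 2)"
proof (induction t)
  case 0
  show ?case by (simp add: excess_def)
next
  case (Suc t)
  define c where "c = 3 / 2 * (fm m + m)"
  have c4: "6 * (fm m + m) = 4 * c" by (simp add: c_def)
  have IH: "pE (bam m t) (excess m N) \<le> 4 * c * (real t + 1 / 2)" using Suc.IH unfolding c4 .
  have "pE (bam m (Suc t)) (excess m N) = pE (bam m t) (\<lambda>bs. pE (urn m bs) (\<lambda>y. excess m N (bs @ [y])))"
    unfolding bam.simps by (subst pE_bind) (simp_all add: finite_bam finite_urn)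
  also have "\<dots> \<le> pE (bam m t) (\<lambda>bs. excess m N bs + 3 / 4 / (real t + 1 / 2) * excess m N bs + c)"
    by (rule pE_mono[OF finite_bam]) (use excess_step[OF m] length_bam in \<open>force simp: c_def\<close>)
  also have "\<dots> = pE (bam m t) (excess m N) + 3 / 4 / (real t + 1 / 2) * pE (bam m t) (excess m N) + c"
    by (simp add: pE_add[OF finite_bam])
  also have "\<dots> \<le> 4 * c * (real t + 1 / 2) + 3 / 4 / (real t + 1 / 2) * (4 * c * (real t + 1 / 2)) + c"
    using IH by (intro add_mono mult_left_mono) auto
  also have "3 / 4 / (real t + 1 / 2) * (4 * c * (real t + 1 / 2)) = 3 * c"
  proof -
    have gen: "3 / 4 / p * (4 * c * p) = 3 * c" if "p > 0" for p :: real using that by simp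
    show ?thesis by (rule gen) (rule add_nonneg_pos, simp_all)
  qed
  finally show ?case unfolding c4 by (simp add: algebra_simps)
qed

lemma bam_dmom:
  assumes m: "m > 0" and n: "n > 0"
  shows "pE (bam m (n * m)) (\<lambda>bs. dmom n (\<lambda>v. m + count_list bs v)) \<le> (6 * (fm m + m) * (m + 1) + fm m) * n"
proof -
  have "dmom n (\<lambda>v. m + count_list bs v) = excess m n bs + n * fm m" for bs
    by (simp add: dmom_def excess_def sum_subtractf)
  then have "pE (bam m (n * m)) (\<lambda>bs. dmom n (\<lambda>v. m + count_list bs v)) = pE (bam m (n * m)) (excess m n) + n * fm m"
    by (simp add: pE_add[OF finite_bam])
  also have "\<dots> \<le> 6 * (fm m + m) * (real (n * m) + 1 / 2) + n * fm m" using excess_bound[OF m, of "n * m" n] by simp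
  also have "\<dots> \<le> 6 * (fm m + m) * (real n * (m + 1)) + n * fm m"
    using n by (intro add_right_mono mult_left_mono) (auto simp: algebra_simps)
  finally show ?thesis by (simp add: algebra_simps)
qed

subsection \<open>Neighbourhood types in the attachment graph\<close>

lemma set_bout:
  assumes v: "valid m n bs" and m: "m > 0"
  shows "set (bout m bs x) = {bs ! i | i. i < length bs \<and> i div m = x}"
proof -
  have "i div m = x \<longleftrightarrow> x * m \<le> i \<and> i < x * m + m" for i
    using m by (metis add.commute div_nat_eqI dividend_less_div_times div_times_less_eq_dividend mult.commute mult_Suc_right)
  then have "{bs ! i | i. i < length bs \<and> i div m = x} = {bs ! i | i. i < length bs \<and> x * m \<le> i \<and> i < x * m + m}" by simp
  also have "\<dots> = set (bout m bs x)"
  proof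
    show "{bs ! i | i. i < length bs \<and> x * m \<le> i \<and> i < x * m + m} \<subseteq> set (bout m bs x)"
    proof clarify
      fix i assume i: "i < length bs" "x * m \<le> i" "i < x * m + m"
      have "bout m bs x ! (i - x * m) = bs ! i" using i by (simp add: bout_def)
      moreover have "i - x * m < m" "i - x * m < length bs - x * m" using i by linarith+
      then have "i - x * m < length (bout m bs x)" by (simp add: bout_def)
      ultimately show "bs ! i \<in> set (bout m bs x)" by (metis nth_mem)
    qed
    show "set (bout m bs x) \<subseteq> {bs ! i | i. i < length bs \<and> x * m \<le> i \<and> i < x * m + m}"
    proof
      fix y assume "y \<in> set (bout m bs x)"
      then obtain k where k: "k < length (bout m bs x)" "y = bout m bs x ! k" by (auto simp: in_set_conv_nth)
      then have "y = bs ! (x * m + k)" "x * m + k < length bs" "k < m" by (auto simp: bout_def)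
      then show "y \<in> {bs ! i | i. i < length bs \<and> x * m \<le> i \<and> i < x * m + m}" by (auto intro!: exI[of _ "x * m + k"])
    qed
  qed
  finally show ?thesis by simp
qed

lemma bagraph_edge:
  assumes v: "valid m n bs" and m: "m > 0"
  shows "{x, y} \<in> bagraph m bs \<longleftrightarrow> x \<noteq> y \<and> (y \<in> set (bout m bs x) \<or> x \<in> set (bout m bs y))"
  unfolding set_bout[OF v m] bagraph_def by (auto simp: doubleton_eq_iff)

lemma sgraph_bagraph:
  assumes v: "valid m n bs" and m: "m > 0" shows "sgraph n (bagraph m bs)"
proof -
  have "i div m < n" if "i < length bs" for i
    using that v m by (simp add: valid_def less_mult_imp_div_less)
  moreover have "bs ! i < n" if "i < length bs" for i using v nth_mem[OF that] by (auto simp: valid_def)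
  ultimately show ?thesis unfolding sgraph_def bagraph_def by (auto simp: card_insert_if)
qed

lemma dg_bagraph:
  assumes v: "valid m n bs" and m: "m > 0" and x: "x < n"
  shows "dg (bagraph m bs) x \<le> m + count_list bs x"
proof -
  have len: "length bs = n * m" using v by (simp add: valid_def)
  have "{y. {x, y} \<in> bagraph m bs} \<subseteq> brel m (count_list bs x) n bs `` {x}"
    using bagraph_edge[OF v m] sgraph_edge[OF sgraph_bagraph[OF v m]] x by (auto simp: brel_def)
  then have "dg (bagraph m bs) x \<le> card (brel m (count_list bs x) n bs `` {x})"
    unfolding dg_def by (intro card_mono card_brel[OF len])
  also have "\<dots> \<le> m + count_list bs x" by (rule card_brel[OF len])
  finally show ?thesis .
qed

section \<open>Balls recognized from patterns\<close>

definition pgraph :: "pat \<Rightarrow> nat set set" where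
  "pgraph H = {{i, j} | i j. i \<noteq> j \<and> i < length H \<and> j < length H \<and> Some j \<in> set (fst (H ! i))}"

lemma pgraph_edge:
  "{i, j} \<in> pgraph H \<longleftrightarrow> i \<noteq> j \<and> i < length H \<and> j < length H
     \<and> (Some j \<in> set (fst (H ! i)) \<or> Some i \<in> set (fst (H ! j)))"
  unfolding pgraph_def by (auto simp: doubleton_eq_iff)

text \<open>The trace in the pattern of a vertex without neighbours outside the set: no edge leaves,
  and incoming edges from inside already account for the whole recorded indegree.\<close>

definition pclosed :: "pat \<Rightarrow> nat \<Rightarrow> bool" where
  "pclosed H i \<longleftrightarrow> None \<notin> set (fst (H ! i)) \<and> snd (H ! i) = (\<Sum>k<length H. count_list (fst (H ! k)) (Some i))"

definition pshape :: "nat \<Rightarrow> pat \<times> nat \<Rightarrow> bool" where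
  "pshape l = (\<lambda>(H, r). r < length H \<and> ball (pgraph H) l r = {0..<length H}
     \<and> (\<forall>j<l. \<forall>i\<in>ball (pgraph H) j r. pclosed H i))"

lemma ptyp_target:
  assumes W: "finite W" and ij: "i < card W" "j < card W"
  shows "Some j \<in> set (fst (ptyp m bs W ! i)) \<longleftrightarrow> sl W ! j \<in> set (bout m bs (sl W ! i))"
  using ij rk_eq_Some_iff[OF W ij(2)] by (force simp: ptyp_def image_iff)

lemma ptyp_graph:
  assumes v: "valid m n bs" and m: "m > 0" and W: "W \<subseteq> {0..<n}" and ij: "i < card W" "j < card W"
  shows "{sl W ! i, sl W ! j} \<in> bagraph m bs \<longleftrightarrow> {i, j} \<in> pgraph (ptyp m bs W)"
proof -
  have fW: "finite W" using W finite_subset by blast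
  have "sl W ! i \<noteq> sl W ! j \<longleftrightarrow> i \<noteq> j" using rnk_nth[OF fW ij(1)] rnk_nth[OF fW ij(2)] by metis
  then show ?thesis unfolding bagraph_edge[OF v m] pgraph_edge
    using ptyp_target[OF fW ij] ptyp_target[OF fW ij(2,1)] ij by simp
qed

text \<open>This is why patterns record indegrees: without them, edges arriving from outside \<open>W\<close> would be
  invisible.\<close>
lemma ptyp_closed:
  assumes v: "valid m n bs" and m: "m > 0" and W: "W \<subseteq> {0..<n}" and i: "i < card W"
  shows "(\<forall>y. {sl W ! i, y} \<in> bagraph m bs \<longrightarrow> y \<in> W) \<longleftrightarrow> pclosed (ptyp m bs W) i"
proof -
  have fW: "finite W" using W finite_subset by blast
  have len: "length bs = n * m" using v by (simp add: valid_def)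
  define x where "x = sl W ! i"
  have xW: "x \<in> W" using sl_nth_mem[OF fW i] by (simp add: x_def)
  have yn: "y < n" if "{x, y} \<in> bagraph m bs" for y using sgraph_edge[OF sgraph_bagraph[OF v m] that] by simp
  have out: "None \<notin> set (fst (ptyp m bs W ! i)) \<longleftrightarrow> (\<forall>y\<in>set (bout m bs x). y \<in> W)"
    using i by (auto simp: ptyp_def x_def rk_def image_iff split: if_splits)
  have cnt: "count_list (fst (ptyp m bs W ! k)) (Some i) = count_list (bout m bs (sl W ! k)) x" if "k < card W" for k
    using that count_list_map_eq[of "rk W" "Some i" x "bout m bs (sl W ! k)"] rk_eq_Some_iff[OF fW i]
    by (simp add: ptyp_def x_def)
  have "(\<Sum>k<card W. count_list (fst (ptyp m bs W ! k)) (Some i)) = (\<Sum>k<card W. count_list (bout m bs (sl W ! k)) x)"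
    by (rule sum.cong) (auto simp: cnt)
  also have "\<dots> = (\<Sum>y\<in>W. count_list (bout m bs y) x)"
    using sum.reindex_bij_betw[OF bij_sl[OF fW], of "\<lambda>y. count_list (bout m bs y) x"] by (simp add: atLeast0LessThan)
  finally have inner: "(\<Sum>k<card W. count_list (fst (ptyp m bs W ! k)) (Some i)) = (\<Sum>y\<in>W. count_list (bout m bs y) x)" .
  have "count_list bs x = (\<Sum>y\<in>{..<n}. count_list (bout m bs y) x)" using count_list_bout[OF len] by simp
  also have "\<dots> = (\<Sum>y\<in>W. count_list (bout m bs y) x) + (\<Sum>y\<in>{..<n} - W. count_list (bout m bs y) x)"
    using W by (intro sum.subset_diff[THEN trans, OF _ _ add.commute]) auto
  finally have tot: "count_list bs x = (\<Sum>y\<in>W. count_list (bout m bs y) x) + (\<Sum>y\<in>{..<n} - W. count_list (bout m bs y) x)" .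
  have "snd (ptyp m bs W ! i) = count_list bs x" using i by (simp add: ptyp_def x_def)
  then have "snd (ptyp m bs W ! i) = (\<Sum>k<length (ptyp m bs W). count_list (fst (ptyp m bs W ! k)) (Some i))
     \<longleftrightarrow> (\<Sum>y\<in>{..<n} - W. count_list (bout m bs y) x) = 0"
    using inner tot by simp
  also have "\<dots> \<longleftrightarrow> (\<forall>y\<in>{..<n} - W. x \<notin> set (bout m bs y))" by (simp add: count_list_0_iff)
  finally have "pclosed (ptyp m bs W) i \<longleftrightarrow> (\<forall>y\<in>set (bout m bs x). y \<in> W) \<and> (\<forall>y\<in>{..<n} - W. x \<notin> set (bout m bs y))"
    unfolding pclosed_def out by simp
  also have "\<dots> \<longleftrightarrow> (\<forall>y. {x, y} \<in> bagraph m bs \<longrightarrow> y \<in> W)"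
    using bagraph_edge[OF v m] xW yn by (metis Diff_iff lessThan_iff)
  finally show ?thesis by (simp add: x_def)
qed

lemma ball_iff_pshape:
  assumes v: "valid m n bs" and m: "m > 0" and W: "W \<subseteq> {0..<n}" and r: "r < card W"
  shows "ball (bagraph m bs) l (sl W ! r) = W \<longleftrightarrow> pshape l (ptyp m bs W, r)"
proof -
  have fW: "finite W" using W finite_subset by blast
  let ?H = "ptyp m bs W"
  have "ball (bagraph m bs) l (sl W ! r) = set (sl W) \<longleftrightarrow> ball (pgraph ?H) l r = {0..<length (sl W)}
      \<and> (\<forall>j<l. \<forall>i\<in>ball (pgraph ?H) j r. \<forall>y. {sl W ! i, y} \<in> bagraph m bs \<longrightarrow> y \<in> set (sl W))"
    by (rule ball_transfer) (use ptyp_graph[OF v m W] r pgraph_edge in auto)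
  moreover have "(\<forall>y. {sl W ! i, y} \<in> bagraph m bs \<longrightarrow> y \<in> W) \<longleftrightarrow> pclosed ?H i" if "i \<in> ball (pgraph ?H) j r" for i j
  proof -
    have "sgraph (card W) (pgraph ?H)" unfolding sgraph_def pgraph_def by (auto simp: card_insert_if)
    then have "i < card W" using ball_subset[of "card W" "pgraph ?H" r j] r that by auto
    then show ?thesis by (rule ptyp_closed[OF v m W])
  qed
  ultimately show ?thesis using r fW by (simp add: pshape_def)
qed

text \<open>A ball is connected and by \<open>comps_closed\<close> stays inside one component, so
  counts of neighbourhood patterns are normalized by \<open>n\<close> itself. The hypothesis of
  \<open>comps_closed\<close> holds because targets never exceed their sources and ranks preserve
  the order.\<close>

lemma ncomp_pshape:
  assumes v: "valid m n bs" and m: "m > 0" and W: "W \<subseteq> {0..<n}" and s: "pshape l (ptyp m bs W, r)"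
  shows "ncomp (ptyp m bs W) = 1"
proof -
  let ?H = "ptyp m bs W"
  define R where "R = rev (map fst ?H)"
  have fW: "finite W" using W finite_subset by blast
  have r: "r < card W" and conn: "ball (pgraph ?H) l r = {0..<card W}" using s by (auto simp: pshape_def)
  have fwd: "i \<le> x" if x: "x < length R" "Some i \<in> set (rev R ! x)" for x i
  proof -
    have xc: "x < card W" using x by (simp add: R_def)
    then obtain y where y: "y \<in> set (bout m bs (sl W ! x))" "rk W y = Some i"
      using x by (auto simp: R_def ptyp_def)
    have i: "i < card W" using rk_range[OF fW y(2)] .
    then have "y = sl W ! i" using rk_eq_Some_iff[OF fW i] y(2) by simp
    moreover have "y \<le> sl W ! x" using y(1) v unfolding set_bout[OF v m] by (auto simp: valid_def)
    ultimately show ?thesis using sl_nth_less_iff[OF xc i] by (meson not_le)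
  qed
  have "r \<in> \<Union>(comps R)" using comps_Union[of R] r by (simp add: R_def)
  then obtain B where B: "B \<in> comps R" "r \<in> B" by auto
  have "ball (pgraph ?H) k r \<subseteq> B" for k
  proof (induction k)
    case (Suc k)
    have "y \<in> B" if "x \<in> ball (pgraph ?H) k r" "{x, y} \<in> pgraph ?H" for x y
    proof -
      have "(x, y) \<in> pedge R" using that(2) unfolding pgraph_edge by (auto simp: pedge_def R_def)
      then show ?thesis using comps_closed[OF fwd B(1)] Suc that(1) by blast
    qed
    then show ?case using Suc by auto
  qed (use B in simp)
  then have all: "{0..<card W} \<subseteq> B" using conn by metis
  have "comps R = {B}"
  proof -
    have "A = B" if "A \<in> comps R" for A
    proof (rule comps_disjoint[OF that B(1)])
      have "A \<subseteq> {0..<card W}" using comps_Union[of R] that by (auto simp: R_def)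
      then show "A \<inter> B \<noteq> {}" using all comps_nonempty[OF that] by blast
    qed
    then show ?thesis using B by blast
  qed
  then show ?thesis by (simp add: ncomp_def R_def[symmetric])
qed

definition batype :: "nat \<Rightarrow> nat \<Rightarrow> nat list \<Rightarrow> nat \<Rightarrow> pat \<times> nat" where
  "batype m l bs v = (let W = ball (bagraph m bs) l v in (ptyp m bs W, rnk W v))"

lemma batype_props:
  fixes l :: nat
  assumes v: "valid m n bs" and m: "m > 0" and x: "x < n"
  defines "W \<equiv> ball (bagraph m bs) l x"
  shows "W \<subseteq> {0..<n}" "finite W" "rnk W x < card W" "sl W ! rnk W x = x" "pshape l (batype m l bs x)"
proof -
  show W: "W \<subseteq> {0..<n}" unfolding W_def by (rule ball_subset[OF sgraph_bagraph[OF v m] x])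
  then show fW: "finite W" using finite_subset by blast
  have "x \<in> W" by (simp add: W_def)
  then show r: "rnk W x < card W" "sl W ! rnk W x = x" using nth_rnk[OF fW] by auto
  then show "pshape l (batype m l bs x)"
    using ball_iff_pshape[OF v m W r(1), of l] by (simp add: batype_def Let_def W_def[symmetric])
qed

text \<open>As for Erdos-Renyi graphs, a vertex and its ball determine each other through the rank
  \<open>r\<close>. Being a ball is a property of the pattern alone, so the number of vertices is
  exactly a pattern count.\<close>

lemma card_batype:
  assumes v: "valid m n bs" and m: "m > 0" and s: "pshape l (H, r)"
  shows "real (card {x\<in>{0..<n}. batype m l bs x = (H, r)}) = Xc m H n bs"
proof -
  let ?E = "bagraph m bs"
  have "card {x\<in>{0..<n}. batype m l bs x = (H, r)} = card {W. W \<subseteq> {0..<n} \<and> ptyp m bs W = H}"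
  proof (rule bij_betw_same_card[of "ball ?E l"], rule bij_betw_byWitness[where f' = "\<lambda>W. sl W ! r"])
    show "\<forall>x\<in>{x \<in> {0..<n}. batype m l bs x = (H, r)}. sl (ball ?E l x) ! r = x"
      using batype_props(4)[OF v m] by (auto simp: batype_def Let_def)
    have W: "ball ?E l (sl W ! r) = W" "r < card W" if "W \<subseteq> {0..<n}" "ptyp m bs W = H" for W
    proof -
      show "r < card W" using s that(2) by (auto simp: pshape_def)
      then show "ball ?E l (sl W ! r) = W" using ball_iff_pshape[OF v m that(1), of r l] s that(2) by simp
    qed
    show "\<forall>W\<in>{W. W \<subseteq> {0..<n} \<and> ptyp m bs W = H}. ball ?E l (sl W ! r) = W" using W by auto
    show "ball ?E l ` {x \<in> {0..<n}. batype m l bs x = (H, r)} \<subseteq> {W. W \<subseteq> {0..<n} \<and> ptyp m bs W = H}"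
    proof clarify
      fix x assume x: "x \<in> {0..<n}" "batype m l bs x = (H, r)"
      then show "ball ?E l x \<subseteq> {0..<n} \<and> ptyp m bs (ball ?E l x) = H"
        using batype_props(1)[OF v m, of x l] by (simp add: batype_def Let_def)
    qed
    show "(\<lambda>W. sl W ! r) ` {W. W \<subseteq> {0..<n} \<and> ptyp m bs W = H} \<subseteq> {x \<in> {0..<n}. batype m l bs x = (H, r)}"
    proof
      fix x assume "x \<in> (\<lambda>W. sl W ! r) ` {W. W \<subseteq> {0..<n} \<and> ptyp m bs W = H}"
      then obtain W0 where W0: "W0 \<subseteq> {0..<n}" "ptyp m bs W0 = H" "x = sl W0 ! r" by auto
      have fW: "finite W0" using W0(1) finite_subset by blast
      have "x < n" using sl_nth_mem[OF fW W(2)[OF W0(1,2)]] W0 by auto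
      then show "x \<in> {x \<in> {0..<n}. batype m l bs x = (H, r)}"
        using W[OF W0(1,2)] W0 rnk_nth[OF fW] by (simp add: batype_def Let_def)
    qed
  qed
  then show ?thesis by (simp add: Xc_def)
qed

definition barep :: "pat \<times> nat \<Rightarrow> rgraph" where
  "barep = (\<lambda>(H, r). \<lparr>rV = {0..<length H}, rE = pgraph H, rroots = [r]\<rparr>)"

lemma barep_batype:
  assumes v: "valid m n bs" and m: "m > 0" and x: "x < n"
  shows "wf_rgraph (barep (batype m l bs x))" "riso (nbhd (bagraph m bs) l [x]) (barep (batype m l bs x))"
proof -
  define W where "W = ball (bagraph m bs) l x"
  note p = batype_props[OF v m x, of l, folded W_def]
  have "sgraph (card W) (pgraph (ptyp m bs W))" unfolding sgraph_def pgraph_def by (auto simp: card_insert_if)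
  then show "wf_rgraph (barep (batype m l bs x))"
    using p(3) by (simp add: wf_rgraph_def barep_def batype_def Let_def W_def[symmetric] sgraph_def)
  show "riso (nbhd (bagraph m bs) l [x]) (barep (batype m l bs x))"
    using riso_ranks[OF sgraph_bagraph[OF v m] x W_def ptyp_graph[OF v m p(1)]]
    by (simp add: barep_def batype_def Let_def W_def[symmetric])
qed

lemma batype_freq_limit:
  assumes m: "m > 0"
  shows "\<exists>x. L1conv (\<lambda>n. bam m (n * m)) (freq (\<lambda>n bs. batype m l bs) {(H, r)}) x"
proof -
  let ?S = "\<lambda>n. bam m (n * m)"
  interpret fin_pmfs ?S by standard (rule finite_bam)
  have zero: ?thesis if "\<And>n bs. bs \<in> set_pmf (?S n) \<Longrightarrow> freq (\<lambda>n bs. batype m l bs) {(H, r)} n bs = 0"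
  proof -
    have "L1conv ?S (\<lambda>n s. 0) 0" by (rule L1conv_const) simp
    then have "L1conv ?S (freq (\<lambda>n bs. batype m l bs) {(H, r)}) 0"
      by (rule L1conv_cong) (use that in \<open>auto intro!: always_eventually\<close>)
    then show ?thesis by blast
  qed
  show ?thesis
  \<comment> \<open>Realizability is asked for because \<open>ncomp H = 1\<close> is derived from an
    actual set; a pattern that never occurs has frequency 0.\<close>
  proof (cases "pshape l (H, r) \<and> (\<exists>n bs W. valid m n bs \<and> W \<subseteq> {0..<n} \<and> ptyp m bs W = H)")
    case True
    then have s: "pshape l (H, r)" and "ncomp H = 1" using ncomp_pshape[OF _ m] by blast+
    then obtain x where x: "L1conv ?S (\<lambda>n bs. Xc m H n bs / real n ^ 1) x" using pattern_limit[OF m, of H] by auto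
    have "L1conv ?S (freq (\<lambda>n bs. batype m l bs) {(H, r)}) x"
    proof (rule L1conv_cong[OF x], intro always_eventually allI ballI)
      fix n bs assume "bs \<in> set_pmf (?S n)"
      then have v: "valid m n bs" using valid_bam[OF m] by blast
      show "Xc m H n bs / real n ^ 1 = freq (\<lambda>n bs. batype m l bs) {(H, r)} n bs"
        using card_batype[OF v m s] by (simp add: freq_def)
    qed
    then show ?thesis by blast
  next
    case False
    show ?thesis
    proof (rule zero)
      fix n bs assume "bs \<in> set_pmf (?S n)"
      then have v: "valid m n bs" using valid_bam[OF m] by blast
      have "batype m l bs x \<noteq> (H, r)" if "x < n" for x
      proof
        assume e: "batype m l bs x = (H, r)"
        note p = batype_props[OF v m that, of l]
        have "ptyp m bs (ball (bagraph m bs) l x) = H" using e by (simp add: batype_def Let_def)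
        then show False using False p(1,5) e v by metis
      qed
      then have "{x\<in>{0..<n}. batype m l bs x \<in> {(H, r)}} = {}" by auto
      then show "freq (\<lambda>n bs. batype m l bs) {(H, r)} n bs = 0" by (simp only: freq_def) simp
    qed
  qed
qed

lemma ba_graph_seq:
  assumes m: "m > 0"
  shows "graph_seq (\<lambda>n. bam m (n * m)) (\<lambda>n bs. bagraph m bs) (\<lambda>n bs v. m + count_list bs v) (6 * (fm m + m) * (m + 1) + fm m)"
proof (standard, goal_cases)
  case 1 show ?case by (rule finite_bam)
next
  case 2 show ?case using sgraph_bagraph[OF valid_bam[OF m] m] by (auto intro!: always_eventually)
next
  case 3 show ?case using dg_bagraph[OF valid_bam[OF m] m] by (auto intro!: always_eventually)
next
  case 4 show ?case using eventually_gt_at_top[of 0] by eventually_elim (rule bam_dmom[OF m])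
qed

theorem ba_extension_counts:
  assumes m: "m > 0" and wfT: "wf_rgraph T"
  shows "extension_law (\<lambda>n. ba n m) T l"
proof -
  let ?S = "\<lambda>n. bam m (n * m)"
  let ?\<tau> = "\<lambda>n bs. batype m l bs"
  interpret graph_seq ?S "\<lambda>n bs. bagraph m bs" "\<lambda>n bs v. m + count_list bs v" "6 * (fm m + m) * (m + 1) + fm m"
    by (rule ba_graph_seq[OF m])
  have conv: "\<exists>x. L1conv ?S (freq ?\<tau> {\<sigma>}) x" for \<sigma>
    using batype_freq_limit[OF m, of l "fst \<sigma>" "snd \<sigma>"] by simp
  have tight: "\<exists>Fs. finite Fs \<and> (\<forall>\<^sub>F n in sequentially. pE (?S n) (freq ?\<tau> (- Fs) n) \<le> \<epsilon>)" if \<epsilon>: "\<epsilon> > 0" for \<epsilon> :: real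
  proof -
    obtain D where D: "\<forall>\<^sub>F n in sequentially.
      pE (?S n) (\<lambda>s. real (card {v\<in>{0..<n}. \<exists>w\<in>ball (bagraph m s) l v. m + count_list s w > D}) / n) \<le> \<epsilon>"
      using tight_degrees[OF \<epsilon>, of l] by (elim exE) (rule that)
    define h where "h = (D + 1) ^ l"
    \<comment> \<open>The ball size alone does not leave finitely many patterns, since indegrees are
      recorded even for boundary vertices. This is why \<open>tight_degrees\<close> is used with
      \<open>m\<close> plus the indegree and not with the degree in the simple graph.\<close>
    define A where "A = {\<rho> :: nat option list. set \<rho> \<subseteq> insert None (Some ` {0..h}) \<and> length \<rho> = m} \<times> {0..D}"
    define Fs where "Fs = {H. set H \<subseteq> A \<and> length H \<le> h} \<times> {0..h}"
    have "finite {\<rho> :: nat option list. set \<rho> \<subseteq> insert None (Some ` {0..h}) \<and> length \<rho> = m}"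
      by (rule finite_lists_length_eq) simp
    then have "finite A" by (simp add: A_def)
    then have finFs: "finite Fs" unfolding Fs_def by (intro finite_cartesian_product finite_lists_length_le) auto
    have "\<forall>\<^sub>F n in sequentially. pE (?S n) (freq ?\<tau> (- Fs) n) \<le> \<epsilon>"
      using D
    proof eventually_elim
      case (elim n)
      have "pE (?S n) (freq ?\<tau> (- Fs) n)
        \<le> pE (?S n) (\<lambda>s. real (card {v\<in>{0..<n}. \<exists>w\<in>ball (bagraph m s) l v. m + count_list s w > D}) / n)"
      proof (rule pE_mono[OF finite_bam])
        fix bs assume bs: "bs \<in> set_pmf (?S n)"
        have v: "valid m n bs" using valid_bam[OF m bs] .
        have len: "length bs = n * m" using v by (simp add: valid_def)
        have "{x\<in>{0..<n}. batype m l bs x \<in> - Fs} \<subseteq> {x\<in>{0..<n}. \<exists>w\<in>ball (bagraph m bs) l x. m + count_list bs w > D}"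
        proof clarify
          fix x assume x: "x \<in> {0..<n}" "batype m l bs x \<notin> Fs"
          define W where "W = ball (bagraph m bs) l x"
          have xn: "x < n" using x by simp
          note p = batype_props[OF v m xn, of l, folded W_def]
          show "\<exists>w\<in>ball (bagraph m bs) l x. m + count_list bs w > D"
          proof (rule ccontr)
            assume "\<not> (\<exists>w\<in>ball (bagraph m bs) l x. m + count_list bs w > D)"
            then have dW: "m + count_list bs w \<le> D" if "w \<in> W" for w using that by (auto simp: W_def not_less)
            have c: "card W \<le> h"
              unfolding W_def h_def
            proof (rule card_ball_le[OF sgraph_bagraph[OF v m] xn])
              fix w assume "w \<in> ball (bagraph m bs) l x"
              then have w: "w \<in> W" by (simp add: W_def)
              then have "w < n" using p(1) by auto
              then show "dg (bagraph m bs) w \<le> D" using dg_bagraph[OF v m, of w] dW[OF w] by simp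
            qed
            have "set (ptyp m bs W) \<subseteq> A"
            proof
              fix a assume "a \<in> set (ptyp m bs W)"
              then obtain w where w: "w \<in> W" "a = (map (rk W) (bout m bs w), count_list bs w)"
                using p(2) by (auto simp: ptyp_def)
              have "w < n" using w(1) p(1) by auto
              then have "w * m + m \<le> n * m" using mult_le_mono1[of "Suc w" n m] by simp
              then have lo: "length (bout m bs w) = m" by (simp add: bout_def len)
              have "rk W y \<in> insert None (Some ` {0..h})" for y
                using rk_range[OF p(2), of y] c by (cases "rk W y") auto
              then show "a \<in> A" using w lo dW[OF w(1)] by (auto simp: A_def)
            qed
            then have "batype m l bs x \<in> Fs"
              using c p(3) by (simp add: batype_def Let_def W_def[symmetric] Fs_def)
            then show False using x(2) by simp
          qed
        qed
        then have "card {x\<in>{0..<n}. batype m l bs x \<in> - Fs} \<le> card {x\<in>{0..<n}. \<exists>w\<in>ball (bagraph m bs) l x. m + count_list bs w > D}"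
          by (intro card_mono) auto
        then show "freq ?\<tau> (- Fs) n bs \<le> real (card {x\<in>{0..<n}. \<exists>w\<in>ball (bagraph m bs) l x. m + count_list bs w > D}) / n"
          unfolding freq_def by (intro divide_right_mono) auto
      qed
      then show ?case using elim by linarith
    qed
    then show ?thesis using finFs by blast
  qed
  obtain P where P: "\<And>A. L1conv ?S (freq ?\<tau> A) (measure_pmf.prob P A)"
    using freq_scheffe[of ?\<tau>, OF conv tight] by blast
  show ?thesis
  proof (rule extension_counts[OF wfT P, where R = barep])
    show "\<forall>\<^sub>F n in sequentially. \<forall>s\<in>set_pmf (?S n). \<forall>v<n. wf_rgraph (barep (batype m l s v))
       \<and> riso (nbhd (bagraph m s) l [v]) (barep (batype m l s v))"
      using barep_batype[OF valid_bam[OF m] m] by (auto intro!: always_eventually)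
    show "ba n m = map_pmf (bagraph m) (?S n)" for n by (rule ba_bam)
  qed
qed

theorem mainTheorem8:
  fixes M :: "nat \<Rightarrow> nat set set pmf" and T :: rgraph and l :: nat
  assumes model: "(\<exists>K::real. K > 0 \<and> M = (\<lambda>n. er n (K / real n)))
                \<or> (\<exists>m::nat. m \<ge> 1 \<and> M = (\<lambda>n. ba n m))"
    and wfT: "wf_rgraph T"
  shows "\<exists>q :: rgraph set \<Rightarrow> real.
     (\<forall>C \<in> Ext T. q C \<in> {0..1} \<and>
        (\<forall>\<epsilon>>0. \<forall>\<theta>>0. \<exists>N. \<forall>n\<ge>N.
           measure_pmf.prob (M n)
             {E. \<forall>us. length us = length (rroots T) \<and> set us \<subseteq> {0..<n}
                    \<and> riso (nbhd E l us) T \<longrightarrow>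
                  \<bar>real (card {v \<in> {0..<n}. nbhd E l (us @ [v]) \<in> C}) / real n - q C\<bar> < \<epsilon>}
           \<ge> 1 - \<theta>))
     \<and> (q has_sum 1) (Ext T)"
  using model
proof (elim disjE exE conjE)
  fix K :: real assume K: "K > 0" and M: "M = (\<lambda>n. er n (K / real n))"
  show ?thesis using er_extension_counts[OF K wfT, of l] unfolding M extension_law_def .
next
  fix m :: nat assume "m \<ge> 1" and M: "M = (\<lambda>n. ba n m)"
  then have "m > 0" by simp
  then show ?thesis using ba_extension_counts[OF _ wfT, of m l] unfolding M extension_law_def by simp
qed

end
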